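(* Let $\mathcal{F}$ be a non-trivial minor-closed family of graphs and let $k\ge 3$ be fixed. There is a randomized algorithm that, given a graph $G\in\mathcal{F}$ with $n$ vertices that contains an induced cycle of size $k$, finds such an induced cycle in $O(n)$ expected time.
   Context: All graphs are finite, undirected and simple. A minor of a graph $G$ is a graph obtained from a subgraph of $G$ by a sequence of edge contractions. A family of graphs is minor-closed if it contains every minor of each of its members, and non-trivial if it does not contain all graphs. An induced cycle of size $k$ is a set of $k$ vertices whose induced subgraph is a cycle. The constant in $O(n)$ may depend on $\mathcal{F}$ and $k$. *)

theory Defs
  imports "HOL-Probability.Probability"
begin

section \<open>Finite simple graphs, minors and induced cycles\<close>

record 'a graph =
  verts :: "'a set"
  edges :: "'a set set"

definition is_graph :: "'a graph \<Rightarrow> bool" where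
  "is_graph G \<longleftrightarrow> finite (verts G) \<and> edges G \<subseteq> {e. e \<subseteq> verts G \<and> card e = 2}"

definition is_subgraph :: "'a graph \<Rightarrow> 'a graph \<Rightarrow> bool" where
  "is_subgraph H G \<longleftrightarrow> is_graph H \<and> verts H \<subseteq> verts G \<and> edges H \<subseteq> edges G"

definition graph_iso :: "'a graph \<Rightarrow> 'b graph \<Rightarrow> bool" where
  "graph_iso G H \<longleftrightarrow> (\<exists>f. bij_betw f (verts G) (verts H) \<and> edges H = (\<lambda>e. f ` e) ` edges G)"

text \<open>The vertex \<open>u\<close> plays the role of the new vertex; the contracted edge becomes a
  singleton and is dropped, and parallel edges are identified.\<close>

definition contract :: "'a \<Rightarrow> 'a \<Rightarrow> 'a graph \<Rightarrow> 'a graph" where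
  "contract u v G =
     \<lparr>verts = verts G - {v},
      edges = {e'. \<exists>e\<in>edges G. e' = (\<lambda>x. if x = v then u else x) ` e \<and> card e' = 2}\<rparr>"

definition contract_step :: "'a graph \<Rightarrow> 'a graph \<Rightarrow> bool" where
  "contract_step G H \<longleftrightarrow> (\<exists>u v. u \<noteq> v \<and> {u, v} \<in> edges G \<and> H = contract u v G)"

text \<open>Minors are taken up to isomorphism, so a minor-closed family is in particular closed
  under isomorphism.\<close>

definition is_minor :: "'a graph \<Rightarrow> 'a graph \<Rightarrow> bool" where
  "is_minor H G \<longleftrightarrow> is_graph H \<and>
     (\<exists>S K. is_subgraph S G \<and> contract_step\<^sup>*\<^sup>* S K \<and> graph_iso K H)"

definition minor_closed :: "'a graph set \<Rightarrow> bool" where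
  "minor_closed F \<longleftrightarrow> (\<forall>G\<in>F. \<forall>H. is_minor H G \<longrightarrow> H \<in> F)"

definition induced_subgraph :: "'a graph \<Rightarrow> 'a set \<Rightarrow> 'a graph" where
  "induced_subgraph G S = \<lparr>verts = S, edges = {e \<in> edges G. e \<subseteq> S}\<rparr>"

definition cycle_graph :: "nat \<Rightarrow> nat graph" where
  "cycle_graph k = \<lparr>verts = {..<k}, edges = {{i, (i + 1) mod k} |i. i < k}\<rparr>"

definition induced_cycle :: "'a graph \<Rightarrow> nat \<Rightarrow> 'a set \<Rightarrow> bool" where
  "induced_cycle G k S \<longleftrightarrow>
     S \<subseteq> verts G \<and> card S = k \<and> graph_iso (cycle_graph k) (induced_subgraph G S)"


section \<open>Randomized word RAM\<close>

text \<open>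
  A structured random access machine with words of \<open>w\<close> bits.  A program uses finitely many
  registers and finitely many arrays; register and array names are constants of the program,
  array indices are register contents (indirect addressing).  All arithmetic is modulo
  \<open>2 ^ w\<close>, except that subtraction is truncated at 0.  Randomness comes from a tape of fair
  coin flips, read one bit at a time.

  The word size is a parameter of the machine and not of the program; on inputs of size \<open>n\<close>,
  words of \<open>O(log n)\<close> bits are expressed by \<open>(n + 2) ^ d \<le> 2 ^ w\<close> with a constant \<open>d\<close>.
\<close>

datatype test = Less nat nat | Equal nat nat

datatype prog =
    Skip
  | Const nat nat
  | Move nat nat
  | Add nat nat nat
  | Sub nat nat nat
  | Load nat nat nat       \<comment> \<open>\<open>Load x a y\<close>: register \<open>x\<close> receives cell \<open>regs y\<close> of array \<open>a\<close>\<close>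
  | Store nat nat nat      \<comment> \<open>\<open>Store a x y\<close>: cell \<open>regs x\<close> of array \<open>a\<close> receives register \<open>y\<close>\<close>
  | Flip nat
  | Seq prog prog
  | Cond test prog prog
  | While test prog

record state =
  regs :: "nat \<Rightarrow> nat"
  arrays :: "nat \<Rightarrow> nat \<Rightarrow> nat"
  tape :: "bool stream"

fun test_holds :: "test \<Rightarrow> state \<Rightarrow> bool" where
  "test_holds (Less x y) s \<longleftrightarrow> regs s x < regs s y"
| "test_holds (Equal x y) s \<longleftrightarrow> regs s x = regs s y"

definition set_reg :: "nat \<Rightarrow> nat \<Rightarrow> nat \<Rightarrow> state \<Rightarrow> state" where
  "set_reg w x v s = s\<lparr>regs := (regs s)(x := v mod 2 ^ w)\<rparr>"

definition set_cell :: "nat \<Rightarrow> nat \<Rightarrow> nat \<Rightarrow> state \<Rightarrow> state" where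
  "set_cell a i v s = s\<lparr>arrays := (arrays s)(a := (arrays s a)(i := v))\<rparr>"

text \<open>\<open>exec w p s t s'\<close>: on words of \<open>w\<close> bits, \<open>p\<close> started in state \<open>s\<close> halts in state
  \<open>s'\<close> after exactly \<open>t\<close> unit-cost steps.\<close>

inductive exec :: "nat \<Rightarrow> prog \<Rightarrow> state \<Rightarrow> nat \<Rightarrow> state \<Rightarrow> bool" for w where
  Skip: "exec w Skip s 1 s"
| Const: "exec w (Const x c) s 1 (set_reg w x c s)"
| Move: "exec w (Move x y) s 1 (set_reg w x (regs s y) s)"
| Add: "exec w (Add x y z) s 1 (set_reg w x (regs s y + regs s z) s)"
| Sub: "exec w (Sub x y z) s 1 (set_reg w x (regs s y - regs s z) s)"
| Load: "exec w (Load x a y) s 1 (set_reg w x (arrays s a (regs s y)) s)"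
| Store: "exec w (Store a x y) s 1 (set_cell a (regs s x) (regs s y) s)"
| Flip: "exec w (Flip x) s 1
           (set_reg w x (of_bool (shd (tape s))) (s\<lparr>tape := stl (tape s)\<rparr>))"
| Seq: "exec w p s t s' \<Longrightarrow> exec w q s' u s'' \<Longrightarrow> exec w (Seq p q) s (t + u) s''"
| CondTrue: "test_holds b s \<Longrightarrow> exec w p s t s' \<Longrightarrow> exec w (Cond b p q) s (1 + t) s'"
| CondFalse: "\<not> test_holds b s \<Longrightarrow> exec w q s t s' \<Longrightarrow> exec w (Cond b p q) s (1 + t) s'"
| WhileFalse: "\<not> test_holds b s \<Longrightarrow> exec w (While b p) s 1 s"
| WhileTrue: "test_holds b s \<Longrightarrow> exec w p s t s' \<Longrightarrow> exec w (While b p) s' u s'' \<Longrightarrow>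
    exec w (While b p) s (1 + t + u) s''"

text \<open>The infimum of the empty set is \<open>\<infinity>\<close>: a run that does not halt has infinite running
  time.  By determinism (below) the set has at most one element.\<close>

definition run_time :: "nat \<Rightarrow> prog \<Rightarrow> state \<Rightarrow> ennreal" where
  "run_time w p s = (INF t\<in>{t. \<exists>s'. exec w p s t s'}. of_nat t)"

definition coin_flips :: "bool stream measure" where
  "coin_flips = stream_space (measure_pmf (bernoulli_pmf (1 / 2)))"

definition expected_time :: "nat \<Rightarrow> prog \<Rightarrow> (bool stream \<Rightarrow> state) \<Rightarrow> ennreal" where
  "expected_time w p init = (\<integral>\<^sup>+ \<omega>. run_time w p (init \<omega>) \<partial>coin_flips)"


section \<open>Input and output conventions\<close>

text \<open>A graph with vertex set \<open>{..<n}\<close> is given by a list of its edges, each edge occurring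
  once, in arbitrary order and with its end vertices in arbitrary order.\<close>

definition edge_list :: "'a graph \<Rightarrow> ('a \<times> 'a) list \<Rightarrow> bool" where
  "edge_list G es \<longleftrightarrow>
     distinct (map (\<lambda>(u, v). {u, v}) es) \<and> set (map (\<lambda>(u, v). {u, v}) es) = edges G"

text \<open>Registers 0 and 1 hold the numbers of vertices and edges, arrays 0 and 1 the first and
  second end vertices of the edges; everything else is 0.\<close>

definition input_state :: "nat \<Rightarrow> (nat \<times> nat) list \<Rightarrow> bool stream \<Rightarrow> state" where
  "input_state n es \<omega> =
     \<lparr>regs = (\<lambda>_. 0)(0 := n, 1 := length es),
      arrays = (\<lambda>a i. if i < length es \<and> a = 0 then fst (es ! i)
                      else if i < length es \<and> a = 1 then snd (es ! i)
                      else 0),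
      tape = \<omega>\<rparr>"

text \<open>The output is the set of the first \<open>k\<close> entries of array 2.\<close>

definition output_set :: "nat \<Rightarrow> state \<Rightarrow> nat set" where
  "output_set k s = arrays s 2 ` {..<k}"


section \<open>Determinism and measurability of the running time\<close>

lemma exec_deterministic:
  "exec w p s t s' \<Longrightarrow> exec w p s u s'' \<Longrightarrow> u = t \<and> s'' = s'"
proof (induction arbitrary: u s'' rule: exec.induct)
  case (Seq p s t s' q v r)
  from Seq.prems obtain t1 s1 u1 where "u = t1 + u1" "exec w p s t1 s1" "exec w q s1 u1 s''"
    by cases
  with Seq.IH show ?case by metis
next
  case (CondTrue b s p t s' q)
  from CondTrue.prems CondTrue.hyps(1) obtain u1 where "u = 1 + u1" "exec w p s u1 s''"
    by cases simp_all
  with CondTrue.IH show ?case by metis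
next
  case (CondFalse b s q t s' p)
  from CondFalse.prems CondFalse.hyps(1) obtain u1 where "u = 1 + u1" "exec w q s u1 s''"
    by cases simp_all
  with CondFalse.IH show ?case by metis
next
  case (WhileFalse b s p)
  from WhileFalse.prems WhileFalse.hyps show ?case
    by cases simp_all
next
  case (WhileTrue b s p t s' v r)
  from WhileTrue.prems WhileTrue.hyps(1) obtain t1 s1 u1
    where "u = 1 + t1 + u1" "exec w p s t1 s1" "exec w (While b p) s1 u1 s''"
    by cases simp_all
  with WhileTrue.IH show ?case by metis
qed (erule exec.cases; simp)+

lemma test_holds_tape [simp]: "test_holds b (s\<lparr>tape := \<tau>\<rparr>) = test_holds b s"
  by (cases b) auto

lemma set_reg_tape: "set_reg w x v (s\<lparr>tape := \<tau>\<rparr>) = (set_reg w x v s)\<lparr>tape := \<tau>\<rparr>"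
  by (simp add: set_reg_def)

lemma set_cell_tape: "set_cell a i v (s\<lparr>tape := \<tau>\<rparr>) = (set_cell a i v s)\<lparr>tape := \<tau>\<rparr>"
  by (simp add: set_cell_def)

lemma tape_set [simp]: "tape (set_reg w x v s) = tape s" "tape (set_cell a i v s) = tape s"
  by (simp_all add: set_reg_def set_cell_def)

text \<open>A halting run depends only on the finitely many coin flips it reads.\<close>

lemma exec_prefix:
  "exec w p s t s' \<Longrightarrow>
    \<exists>j\<le>t. tape s' = sdrop j (tape s) \<and>
      (\<forall>\<tau>. stake j \<tau> = stake j (tape s) \<longrightarrow>
        exec w p (s\<lparr>tape := \<tau>\<rparr>) t (s'\<lparr>tape := sdrop j \<tau>\<rparr>))"
proof (induction rule: exec.induct)
  case (Skip s)
  show ?case using exec.Skip by (intro exI[of _ 0]) auto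
next
  case (Const x c s)
  have "exec w (Const x c) (s\<lparr>tape := \<tau>\<rparr>) 1 ((set_reg w x c s)\<lparr>tape := \<tau>\<rparr>)" for \<tau>
    using exec.Const[of w x c "s\<lparr>tape := \<tau>\<rparr>"] by (simp add: set_reg_tape)
  then show ?case by (intro exI[of _ 0]) auto
next
  case (Move x y s)
  have "exec w (Move x y) (s\<lparr>tape := \<tau>\<rparr>) 1 ((set_reg w x (regs s y) s)\<lparr>tape := \<tau>\<rparr>)" for \<tau>
    using exec.Move[of w x y "s\<lparr>tape := \<tau>\<rparr>"] by (simp add: set_reg_tape)
  then show ?case by (intro exI[of _ 0]) auto
next
  case (Add x y z s)
  have "exec w (Add x y z) (s\<lparr>tape := \<tau>\<rparr>) 1
      ((set_reg w x (regs s y + regs s z) s)\<lparr>tape := \<tau>\<rparr>)" for \<tau>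
    using exec.Add[of w x y z "s\<lparr>tape := \<tau>\<rparr>"] by (simp add: set_reg_tape)
  then show ?case by (intro exI[of _ 0]) auto
next
  case (Sub x y z s)
  have "exec w (Sub x y z) (s\<lparr>tape := \<tau>\<rparr>) 1
      ((set_reg w x (regs s y - regs s z) s)\<lparr>tape := \<tau>\<rparr>)" for \<tau>
    using exec.Sub[of w x y z "s\<lparr>tape := \<tau>\<rparr>"] by (simp add: set_reg_tape)
  then show ?case by (intro exI[of _ 0]) auto
next
  case (Load x a y s)
  have "exec w (Load x a y) (s\<lparr>tape := \<tau>\<rparr>) 1
      ((set_reg w x (arrays s a (regs s y)) s)\<lparr>tape := \<tau>\<rparr>)" for \<tau>
    using exec.Load[of w x a y "s\<lparr>tape := \<tau>\<rparr>"] by (simp add: set_reg_tape)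
  then show ?case by (intro exI[of _ 0]) auto
next
  case (Store a x y s)
  have "exec w (Store a x y) (s\<lparr>tape := \<tau>\<rparr>) 1
      ((set_cell a (regs s x) (regs s y) s)\<lparr>tape := \<tau>\<rparr>)" for \<tau>
    using exec.Store[of w a x y "s\<lparr>tape := \<tau>\<rparr>"] by (simp add: set_cell_tape)
  then show ?case by (intro exI[of _ 0]) auto
next
  case (Flip x s)
  have "exec w (Flip x) (s\<lparr>tape := \<tau>\<rparr>) 1
      ((set_reg w x (of_bool (shd (tape s))) (s\<lparr>tape := stl (tape s)\<rparr>))\<lparr>tape := stl \<tau>\<rparr>)"
    if "shd \<tau> = shd (tape s)" for \<tau>
    using exec.Flip[of w x "s\<lparr>tape := \<tau>\<rparr>"] that by (simp add: set_reg_tape)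
  then show ?case by (intro exI[of _ 1]) auto
next
  case (Seq p s t s' q u s'')
  then obtain i j where ij: "i \<le> t" "j \<le> u" "tape s' = sdrop i (tape s)"
      "tape s'' = sdrop j (tape s')"
    and 1: "\<And>\<tau>. stake i \<tau> = stake i (tape s) \<Longrightarrow>
      exec w p (s\<lparr>tape := \<tau>\<rparr>) t (s'\<lparr>tape := sdrop i \<tau>\<rparr>)"
    and 2: "\<And>\<tau>. stake j \<tau> = stake j (tape s') \<Longrightarrow>
      exec w q (s'\<lparr>tape := \<tau>\<rparr>) u (s''\<lparr>tape := sdrop j \<tau>\<rparr>)"
    by blast
  have "exec w (Seq p q) (s\<lparr>tape := \<tau>\<rparr>) (t + u) (s''\<lparr>tape := sdrop (i + j) \<tau>\<rparr>)"
    if "stake (i + j) \<tau> = stake (i + j) (tape s)" for \<tau>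
  proof -
    have "stake i \<tau> = stake i (tape s)" "stake j (sdrop i \<tau>) = stake j (sdrop i (tape s))"
      using that by (simp_all flip: stake_add)
    then show ?thesis
      using exec.Seq[OF 1 2, of \<tau>] ij by (simp add: sdrop_add)
  qed
  then show ?case
    using ij by (intro exI[of _ "i + j"]) (auto simp: sdrop_add)
next
  case (CondTrue b s p t s' q)
  then obtain j where j: "j \<le> t" "tape s' = sdrop j (tape s)"
    and 1: "\<And>\<tau>. stake j \<tau> = stake j (tape s) \<Longrightarrow>
      exec w p (s\<lparr>tape := \<tau>\<rparr>) t (s'\<lparr>tape := sdrop j \<tau>\<rparr>)" by blast
  have "exec w (Cond b p q) (s\<lparr>tape := \<tau>\<rparr>) (1 + t) (s'\<lparr>tape := sdrop j \<tau>\<rparr>)"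
    if "stake j \<tau> = stake j (tape s)" for \<tau>
    using exec.CondTrue[OF _ 1[OF that]] CondTrue.hyps by (simp del: plus_1_eq_Suc)
  then show ?case
    using j by (intro exI[of _ j]) auto
next
  case (CondFalse b s q t s' p)
  then obtain j where j: "j \<le> t" "tape s' = sdrop j (tape s)"
    and 1: "\<And>\<tau>. stake j \<tau> = stake j (tape s) \<Longrightarrow>
      exec w q (s\<lparr>tape := \<tau>\<rparr>) t (s'\<lparr>tape := sdrop j \<tau>\<rparr>)" by blast
  have "exec w (Cond b p q) (s\<lparr>tape := \<tau>\<rparr>) (1 + t) (s'\<lparr>tape := sdrop j \<tau>\<rparr>)"
    if "stake j \<tau> = stake j (tape s)" for \<tau>
    using exec.CondFalse[OF _ 1[OF that]] CondFalse.hyps by (simp del: plus_1_eq_Suc)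
  then show ?case
    using j by (intro exI[of _ j]) auto
next
  case (WhileFalse b s p)
  then show ?case
    using exec.WhileFalse by (intro exI[of _ 0]) auto
next
  case (WhileTrue b s p t s' u s'')
  then obtain i j where ij: "i \<le> t" "j \<le> u" "tape s' = sdrop i (tape s)"
      "tape s'' = sdrop j (tape s')"
    and 1: "\<And>\<tau>. stake i \<tau> = stake i (tape s) \<Longrightarrow>
      exec w p (s\<lparr>tape := \<tau>\<rparr>) t (s'\<lparr>tape := sdrop i \<tau>\<rparr>)"
    and 2: "\<And>\<tau>. stake j \<tau> = stake j (tape s') \<Longrightarrow>
      exec w (While b p) (s'\<lparr>tape := \<tau>\<rparr>) u (s''\<lparr>tape := sdrop j \<tau>\<rparr>)"
    by blast
  have "exec w (While b p) (s\<lparr>tape := \<tau>\<rparr>) (1 + t + u) (s''\<lparr>tape := sdrop (i + j) \<tau>\<rparr>)"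
    if "stake (i + j) \<tau> = stake (i + j) (tape s)" for \<tau>
  proof -
    have "stake i \<tau> = stake i (tape s)" "stake j (sdrop i \<tau>) = stake j (sdrop i (tape s))"
      using that by (simp_all flip: stake_add)
    then show ?thesis
      using exec.WhileTrue[OF _ 1 2, of \<tau>] ij WhileTrue.hyps
      by (simp add: sdrop_add)
  qed
  then show ?case
    using ij by (intro exI[of _ "i + j"]) (auto simp: sdrop_add)
qed

lemma halts_prefix:
  assumes "exec w p (s\<lparr>tape := \<omega>\<rparr>) t s'" and "stake t \<tau> = stake t \<omega>"
  shows "\<exists>s''. exec w p (s\<lparr>tape := \<tau>\<rparr>) t s''"
proof -
  obtain j where j: "j \<le> t" "\<And>\<tau>. stake j \<tau> = stake j \<omega> \<Longrightarrow>
      exec w p (s\<lparr>tape := \<tau>\<rparr>) t (s'\<lparr>tape := sdrop j \<tau>\<rparr>)"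
    using exec_prefix[OF assms(1)] by auto
  have "stake j \<tau> = stake j \<omega>"
    using arg_cong[OF assms(2), of "take j"] j(1) by (simp add: take_stake min_absorb2 min_absorb1)
  then show ?thesis using j(2) by blast
qed

lemma run_time_measurable:
  "(\<lambda>\<omega>. run_time w p (input_state n es \<omega>)) \<in> borel_measurable coin_flips"
proof -
  let ?H = "\<lambda>t \<omega>. \<exists>s'. exec w p (input_state n es \<omega>) t s'"
  have tape: "input_state n es \<omega> = (input_state n es undefined)\<lparr>tape := \<omega>\<rparr>" for \<omega>
    by (simp add: input_state_def)
  have prefix: "?H t \<tau>" if "?H t \<omega>" "stake t \<tau> = stake t \<omega>" for t \<omega> \<tau>
    using that halts_prefix[where w = w and p = p and s = "input_state n es undefined"]
    unfolding tape[symmetric] by blast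
  define Q where "Q t = (\<lambda>xs. \<exists>\<tau>. stake t \<tau> = xs \<and> ?H t \<tau>)" for t
  have H: "?H t = (\<lambda>\<omega>. Q t (stake t \<omega>))" for t
    unfolding Q_def using prefix by (intro ext) metis
  have stake: "stake t \<in> measurable coin_flips (count_space UNIV)" for t
  proof -
    have "sets coin_flips = sets (stream_space (count_space (UNIV :: bool set)))"
      unfolding coin_flips_def by (rule sets_stream_space_cong) simp
    then show ?thesis
      using measurable_cong_sets[of coin_flips "stream_space (count_space UNIV)"] measurable_stake
      by blast
  qed
  have [measurable]: "Measurable.pred coin_flips (?H t)" for t
    unfolding H by (rule measurable_compose[OF stake]) simp
  have "run_time w p (input_state n es \<omega>) =
      (INF t. if ?H t \<omega> then of_nat t else \<infinity>)" for \<omega>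
    unfolding run_time_def
  proof (rule antisym)
    show "(INF t. if ?H t \<omega> then of_nat t else \<infinity>) \<le> (INF t\<in>{t. ?H t \<omega>}. of_nat t :: ennreal)"
    proof (rule INF_greatest)
      fix t assume "t \<in> {t. ?H t \<omega>}"
      then have "(if ?H t \<omega> then of_nat t else \<infinity>) \<le> (of_nat t :: ennreal)" by simp
      then show "(INF t. if ?H t \<omega> then of_nat t else \<infinity>) \<le> (of_nat t :: ennreal)"
        by (rule INF_lower2[OF UNIV_I])
    qed
  qed (rule INF_greatest, auto intro: INF_lower)
  moreover have "(\<lambda>\<omega>. INF t. if ?H t \<omega> then of_nat t else (\<infinity> :: ennreal))
      \<in> borel_measurable coin_flips"
    by measurable
  ultimately show ?thesis by (simp only:)
qed

end

theory Submission
  imports Defs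
begin

text \<open>
  Colour the vertices at random with \<open>0, 1, \<dots>, k\<close>, where 0 discards a vertex, and orient the graph
  with bounded out-degree; this is possible in linear time because the members of a non-trivial
  minor-closed family have \<open>O(n)\<close> edges.  A vertex with an out-neighbour whose colour is neither 0 nor
  adjacent to its own on the cycle \<open>1, \<dots>, k\<close> of colours is discarded as well.  Afterwards every
  edge joins cyclically adjacent colours, so every cycle through all colours in order is induced.  With
  constant probability a given induced cycle survives: it suffices that its vertices are coloured in
  order and that their boundedly many other out-neighbours have colour 0.

  A cycle through all colours is found by contractions.  Let every vertex of one colour class pick one of
  its out-neighbours, and contract it into that vertex if this has a prescribed adjacent colour.  The
  result is a minor with one colour less, hence again sparse; its coloured cycles lift to coloured
  cycles of the original graph, and with constant probability a fixed coloured cycle is kept.  When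
  three colours are left, the coloured triangles are detected by random picks again.  All constraints
  concern a bounded number of flips, each of which has to take a value depending only on earlier flips,
  so a round of linear length succeeds with probability bounded away from 0; rounds are repeated until
  one succeeds.
\<close>

section \<open>Word RAM programs: termination within a time bound\<close>

text \<open>A vertex can hit any one of its boundedly many out-neighbours with constant probability,
  but not a given in-neighbour. The arc between the vertices of the last two colours may go either
  way, so each stage spends one more flip on which of the two classes vanishes; one of the two
  answers always lets the tail pick the head. Wrong guesses do no harm, because whatever is found
  lifts to a genuine induced cycle: correctness holds for every halting run, and only the running
  time is random.

  A contraction has to preserve linear time. Duplicates are removed with a table of
  \<open>n * n\<close> cells that is never initialised, and edges at a vanishing vertex are kept
  only if they lead to the one colour class where the cycle continues. What remains is a simple edge
  list of a member of \<open>F\<close>, so the same sparsity bound holds at every stage. It comes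
  from Mader's argument: too many edges force a large complete graph into the family, and this
  contains every excluded graph.

  All samples of a round are drawn in advance, and their number does not depend on the outcome. So
  rounds read disjoint blocks of equal length of the tape, which are independent.\<close>

fun writes :: "prog \<Rightarrow> nat set" where
  "writes (Const x c) = {x}"
| "writes (Move x y) = {x}"
| "writes (Add x y z) = {x}"
| "writes (Sub x y z) = {x}"
| "writes (Load x a y) = {x}"
| "writes (Flip x) = {x}"
| "writes (Seq p q) = writes p \<union> writes q"
| "writes (Cond b p q) = writes p \<union> writes q"
| "writes (While b p) = writes p"
| "writes _ = {}"

fun stores :: "prog \<Rightarrow> nat set" where
  "stores (Store a x y) = {a}"
| "stores (Seq p q) = stores p \<union> stores q"
| "stores (Cond b p q) = stores p \<union> stores q"
| "stores (While b p) = stores p"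
| "stores _ = {}"

fun flip_free :: "prog \<Rightarrow> bool" where
  "flip_free (Flip x) \<longleftrightarrow> False"
| "flip_free (Seq p q) \<longleftrightarrow> flip_free p \<and> flip_free q"
| "flip_free (Cond b p q) \<longleftrightarrow> flip_free p \<and> flip_free q"
| "flip_free (While b p) \<longleftrightarrow> flip_free p"
| "flip_free _ \<longleftrightarrow> True"

text \<open>A syntactic bound on what \<open>p\<close> may change. Specifications below mention only
  the data that a program produces; everything else, including the tape of a flip-free program, is
  carried over by the frame.\<close>

definition frame :: "prog \<Rightarrow> state \<Rightarrow> state \<Rightarrow> bool" where
  "frame p s s' \<longleftrightarrow> (\<forall>r. r \<notin> writes p \<longrightarrow> regs s' r = regs s r) \<and>
     (\<forall>a. a \<notin> stores p \<longrightarrow> arrays s' a = arrays s a) \<and> (flip_free p \<longrightarrow> tape s' = tape s)"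

lemma frame_regs: "frame p s s' \<Longrightarrow> r \<notin> writes p \<Longrightarrow> regs s' r = regs s r"
  and frame_arrays: "frame p s s' \<Longrightarrow> a \<notin> stores p \<Longrightarrow> arrays s' a = arrays s a"
  and frame_tape: "frame p s s' \<Longrightarrow> flip_free p \<Longrightarrow> tape s' = tape s"
  by (auto simp: frame_def)

lemma frame_refl [simp]: "frame p s s"
  by (simp add: frame_def)

lemma frame_trans: "frame p s s' \<Longrightarrow> frame p s' s'' \<Longrightarrow> frame p s s''"
  by (auto simp: frame_def)

lemma frame_mono:
  "frame p s s' \<Longrightarrow> writes p \<subseteq> writes q \<Longrightarrow> stores p \<subseteq> stores q \<Longrightarrow> (flip_free q \<Longrightarrow> flip_free p) \<Longrightarrow>
    frame q s s'"
  by (auto simp: frame_def)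

lemma set_reg_simps [simp]:
  "regs (set_reg w x v s) = (regs s)(x := v mod 2 ^ w)"
  "arrays (set_reg w x v s) = arrays s"
  "regs (set_cell a i v s) = regs s"
  "arrays (set_cell a i v s) = (arrays s)(a := (arrays s a)(i := v))"
  by (simp_all add: set_reg_def set_cell_def)

lemma exec_frame: "exec w p s t s' \<Longrightarrow> frame p s s'"
  by (induction rule: exec.induct) (auto simp: frame_def)

text \<open>Total correctness with a worst-case time bound. The state contains the tape, so
  execution is deterministic and the existential is as strong as a statement about every run
  (\<open>halts_exec\<close>).\<close>

definition halts :: "nat \<Rightarrow> prog \<Rightarrow> state \<Rightarrow> nat \<Rightarrow> (state \<Rightarrow> bool) \<Rightarrow> bool" where
  "halts w p s T Q \<longleftrightarrow> (\<exists>t s'. exec w p s t s' \<and> t \<le> T \<and> Q s')"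

lemma halts_mono:
  "halts w p s T Q \<Longrightarrow> T \<le> T' \<Longrightarrow> (\<And>s'. Q s' \<Longrightarrow> frame p s s' \<Longrightarrow> Q' s') \<Longrightarrow> halts w p s T' Q'"
  unfolding halts_def using exec_frame order_trans by blast

lemma halts_Seq:
  assumes "halts w p s T Q" "\<And>s'. Q s' \<Longrightarrow> frame p s s' \<Longrightarrow> halts w q s' U R" "T + U \<le> V"
  shows "halts w (Seq p q) s V R"
proof -
  obtain t s' where 1: "exec w p s t s'" "t \<le> T" "Q s'" using assms(1) by (auto simp: halts_def)
  obtain u s'' where 2: "exec w q s' u s''" "u \<le> U" "R s''"
    using assms(2)[OF 1(3) exec_frame[OF 1(1)]] by (auto simp: halts_def)
  show ?thesis unfolding halts_def
    using exec.Seq[OF 1(1) 2(1)] 1 2 assms(3) by (intro exI[of _ "t + u"] exI[of _ s'']) auto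
qed

lemma halts_exec: "halts w p s T Q \<Longrightarrow> exec w p s t s' \<Longrightarrow> Q s' \<and> t \<le> T"
  unfolding halts_def using exec_deterministic by blast

section \<open>Evaluation of loop-free programs by simplification, and counting loops\<close>

fun while_free :: "prog \<Rightarrow> bool" where
  "while_free (Seq p q) \<longleftrightarrow> while_free p \<and> while_free q"
| "while_free (Cond b p q) \<longleftrightarrow> while_free p \<and> while_free q"
| "while_free (While b p) \<longleftrightarrow> False"
| "while_free _ \<longleftrightarrow> True"

fun cost :: "prog \<Rightarrow> nat" where
  "cost (Seq p q) = cost p + cost q"
| "cost (Cond b p q) = 1 + max (cost p) (cost q)"
| "cost _ = 1"

fun run :: "nat \<Rightarrow> prog \<Rightarrow> state \<Rightarrow> state" where
  "run w Skip s = s"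
| "run w (Const x c) s = set_reg w x c s"
| "run w (Move x y) s = set_reg w x (regs s y) s"
| "run w (Add x y z) s = set_reg w x (regs s y + regs s z) s"
| "run w (Sub x y z) s = set_reg w x (regs s y - regs s z) s"
| "run w (Load x a y) s = set_reg w x (arrays s a (regs s y)) s"
| "run w (Store a x y) s = set_cell a (regs s x) (regs s y) s"
| "run w (Flip x) s = set_reg w x (of_bool (shd (tape s))) (s\<lparr>tape := stl (tape s)\<rparr>)"
| "run w (Seq p q) s = run w q (run w p s)"
| "run w (Cond b p q) s = (if test_holds b s then run w p s else run w q s)"
| "run w (While b p) s = s"

lemma exec_run: "while_free p \<Longrightarrow> \<exists>t\<le>cost p. exec w p s t (run w p s)"
proof (induction p arbitrary: s)
  case (Seq p q)
  then obtain t u where "t \<le> cost p" "exec w p s t (run w p s)" "u \<le> cost q"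
      "exec w q (run w p s) u (run w q (run w p s))" by (metis while_free.simps(1))
  then show ?case by (intro exI[of _ "t + u"]) (auto intro: exec.Seq)
next
  case (Cond b p q)
  show ?case
  proof (cases "test_holds b s")
    case True
    obtain t where "t \<le> cost p" "exec w p s t (run w p s)" using Cond by auto
    then show ?thesis using True exec.CondTrue[OF True, of w p t _ q] by (intro exI[of _ "1 + t"]) auto
  next
    case False
    obtain t where "t \<le> cost q" "exec w q s t (run w q s)" using Cond by auto
    then show ?thesis using False exec.CondFalse[OF False, of w q t _ p] by (intro exI[of _ "1 + t"]) auto
  qed
next
  case (Flip x)
  show ?case using exec.Flip by (intro exI[of _ 1]) simp
qed (auto intro!: exI[of _ 1] exec.intros[simplified])

lemma halts_run: "while_free p \<Longrightarrow> cost p \<le> T \<Longrightarrow> Q (run w p s) \<Longrightarrow> halts w p s T Q"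
  unfolding halts_def using exec_run order_trans by blast

text \<open>Register 2 holds the constant 1 throughout.\<close>

definition For :: "nat \<Rightarrow> nat \<Rightarrow> prog \<Rightarrow> prog" where
  "For i l p = Seq (Const i 0) (While (Less i l) (Seq p (Add i i 2)))"

lemma For_simps [simp]:
  "writes (For i l p) = insert i (writes p)" "stores (For i l p) = stores p"
  "flip_free (For i l p) = flip_free p"
  by (auto simp: For_def)

text \<open>Since the loop itself resets and increments the counter, the invariant has to survive
  any change of that register. The body may use the frame relative to the initial state, which
  supplies all data left alone by the loop. An iteration pays a test and an increment on top of
  \<open>T\<close>; the additive 2 pays the initialisation and the last test.\<close>

lemma halts_For:
  assumes regs: "i \<notin> writes p" "l \<notin> writes p" "2 \<notin> writes p" "i \<noteq> l" "i \<noteq> 2"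
    and s0: "regs s0 l = N" "regs s0 2 = 1" "N < 2 ^ w" "I 0 s0"
    and counter: "\<And>j s v. I j s \<Longrightarrow> I j (set_reg w i v s)"
    and step: "\<And>j s. j < N \<Longrightarrow> I j s \<Longrightarrow> frame (For i l p) s0 s \<Longrightarrow> regs s i = j \<Longrightarrow>
      halts w p s T (I (Suc j))"
    and T: "2 + N * (T + 2) \<le> U"
  shows "halts w (For i l p) s0 U (I N)"
proof -
  let ?W = "While (Less i l) (Seq p (Add i i 2))"
  have loop: "halts w ?W s (1 + (N - j) * (T + 2)) (I N)"
    if "j \<le> N" "I j s" "frame (For i l p) s0 s" "regs s i = j" for j s
    using that
  proof (induction "N - j" arbitrary: j s)
    case 0
    then have "j = N" "regs s l = N" using s0 regs by (auto simp: frame_def)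
    with 0 have "exec w ?W s 1 s" by (intro exec.WhileFalse) auto
    then show ?case using 0 \<open>j = N\<close> by (auto simp: halts_def)
  next
    case (Suc d)
    then have j: "j < N" by auto
    obtain t s1 where 1: "exec w p s t s1" "t \<le> T" "I (Suc j) s1"
      using step[OF j Suc.prems(2-4)] by (auto simp: halts_def)
    have f1: "frame (For i l p) s0 s1"
      using Suc.prems(3) by (rule frame_trans) (rule frame_mono[OF exec_frame[OF 1(1)]], auto)
    let ?s2 = "set_reg w i (regs s1 i + regs s1 2) s1"
    have i1: "regs s1 i = j" using exec_frame[OF 1(1)] regs Suc.prems by (auto simp: frame_def)
    moreover have "regs s1 2 = 1" using f1 regs s0 by (auto simp: frame_def)
    ultimately have r2: "regs ?s2 i = Suc j" using j s0 by simp
    have f2: "frame (For i l p) s0 ?s2" using f1 by (auto simp: frame_def)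
    have "halts w ?W ?s2 (1 + (N - Suc j) * (T + 2)) (I N)"
      by (rule Suc.hyps(1)) (use Suc.hyps(2) j r2 f2 counter 1 in auto)
    then obtain u s3 where 3: "exec w ?W ?s2 u s3" "u \<le> 1 + (N - Suc j) * (T + 2)" "I N s3"
      by (auto simp: halts_def)
    have b: "test_holds (Less i l) s" using Suc.prems j s0 regs by (auto simp: frame_def)
    have "exec w ?W s (1 + (t + 1) + u) s3"
      by (rule exec.WhileTrue[OF b exec.Seq[OF 1(1) exec.Add] 3(1)])
    moreover have "1 + (t + 1) + u \<le> 1 + (N - j) * (T + 2)"
    proof -
      have "N - j = Suc (N - Suc j)" using j by auto
      then show ?thesis using 1(2) 3(2) by simp
    qed
    ultimately show ?case unfolding halts_def using 3(3) by blast
  qed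
  have "halts w ?W (set_reg w i 0 s0) (1 + (N - 0) * (T + 2)) (I N)"
    by (rule loop) (use counter s0 in \<open>auto simp: frame_def\<close>)
  then obtain t s' where "exec w ?W (set_reg w i 0 s0) t s'" "t \<le> 1 + N * (T + 2)" "I N s'"
    by (auto simp: halts_def)
  then show ?thesis
    using exec.Seq[OF exec.Const, of w ?W i 0 s0 t s'] T unfolding halts_def For_def
    by (intro exI[of _ "1 + t"] exI[of _ s']) auto
qed

section \<open>Sparsity of minor-closed families\<close>

definition complete_graph :: "nat graph \<Rightarrow> bool" where
  "complete_graph G \<longleftrightarrow> is_graph G \<and> edges G = {e. e \<subseteq> verts G \<and> card e = 2}"

definition cone :: "'a \<Rightarrow> 'a graph \<Rightarrow> 'a graph" where
  "cone x G = \<lparr>verts = insert x (verts G), edges = edges G \<union> {{x, y} |y. y \<in> verts G}\<rparr>"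

text \<open>Closure under single steps and without isomorphism. In this form the property passes
  directly to the class of graphs whose cone lies in \<open>M\<close>, as the induction in Mader's
  argument demands.\<close>

definition hereditary :: "'a graph set \<Rightarrow> bool" where
  "hereditary M \<longleftrightarrow> (\<forall>G\<in>M. is_graph G \<and> (\<forall>H. is_subgraph H G \<longrightarrow> H \<in> M) \<and>
     (\<forall>H. contract_step G H \<longrightarrow> H \<in> M))"

lemma hereditaryD:
  assumes "hereditary M" "G \<in> M"
  shows "is_graph G" "is_subgraph H G \<Longrightarrow> H \<in> M" "u \<noteq> v \<Longrightarrow> {u, v} \<in> edges G \<Longrightarrow> contract u v G \<in> M"
  using assms unfolding hereditary_def contract_step_def by blast+

lemma is_graph_contract: "is_graph G \<Longrightarrow> {u, v} \<in> edges G \<Longrightarrow> u \<noteq> v \<Longrightarrow> is_graph (contract u v G)"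
  by (auto simp: is_graph_def contract_def)

lemma hereditary_minor_closed:
  assumes "\<And>G. G \<in> F \<Longrightarrow> is_graph G" "minor_closed F"
  shows "hereditary F"
proof -
  have id: "graph_iso K K" for K :: "'a graph"
    unfolding graph_iso_def by (rule exI[of _ id]) auto
  have "H \<in> F" if "G \<in> F" "is_subgraph H G" for G H
    using that assms id[of H] unfolding minor_closed_def is_minor_def
    by (metis is_subgraph_def rtranclp.rtrancl_refl)
  moreover have "H \<in> F" if "G \<in> F" "contract_step G H" for G H
  proof -
    have "is_graph H" using that(2) is_graph_contract[OF assms(1)[OF that(1)]]
      unfolding contract_step_def by blast
    moreover have "is_subgraph G G" using assms(1) that by (auto simp: is_subgraph_def)
    ultimately show ?thesis using that assms id[of H] unfolding minor_closed_def is_minor_def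
      by (metis r_into_rtranclp)
  qed
  ultimately show ?thesis using assms(1) unfolding hereditary_def by blast
qed

lemma is_graph_cone: "is_graph G \<Longrightarrow> x \<notin> verts G \<Longrightarrow> is_graph (cone x G)"
  by (auto simp: is_graph_def cone_def card_insert_if)

text \<open>The apex \<open>x\<close> is adjacent to both ends of the contracted edge, and its two
  edges to them merge into one. This makes the class of graphs with a cone in \<open>M\<close>
  closed under contraction.\<close>

lemma contract_cone:
  assumes "is_graph H" "x \<notin> verts H" "u \<noteq> v" "{u, v} \<in> edges H"
  shows "contract u v (cone x H) = cone x (contract u v H)"
proof -
  let ?f = "\<lambda>z. if z = v then u else z"
  have uv: "u \<in> verts H" "v \<in> verts H" using assms by (auto simp: is_graph_def)
  then have x: "x \<noteq> u" "x \<noteq> v" using assms by auto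
  have 1: "?f ` {x, y} = {x, ?f y}" for y using x by auto
  have 2: "card {x, y} = 2" if "y \<in> verts H" for y using that assms by (metis card_2_iff)
  have "{e'. \<exists>e\<in>edges (cone x H). e' = ?f ` e \<and> card e' = 2} =
     {e'. \<exists>e\<in>edges H. e' = ?f ` e \<and> card e' = 2} \<union> {{x, ?f y} |y. y \<in> verts H}"
    (is "?A = ?B")
  proof -
    have "?A = {e'. \<exists>e\<in>edges H. e' = ?f ` e \<and> card e' = 2} \<union>
       {e'. \<exists>y\<in>verts H. e' = ?f ` {x, y} \<and> card e' = 2}"
      unfolding cone_def by auto
    also have "{e'. \<exists>y\<in>verts H. e' = ?f ` {x, y} \<and> card e' = 2} = {{x, ?f y} |y. y \<in> verts H}"
      unfolding 1 using 2 uv by auto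
    finally show ?thesis .
  qed
  also have "{{x, ?f y} |y. y \<in> verts H} = {{x, y} |y. y \<in> verts H - {v}}"
    using uv assms(3) by auto
  finally have e: "?A = {e'. \<exists>e\<in>edges H. e' = ?f ` e \<and> card e' = 2} \<union> {{x, y} |y. y \<in> verts H - {v}}" .
  show ?thesis
    using e x unfolding contract_def cone_def by auto
qed

lemma hereditary_cone:
  assumes "hereditary M"
  shows "hereditary {H. is_graph H \<and> (\<exists>x. x \<notin> verts H \<and> cone x H \<in> M)}" (is "hereditary ?N")
proof -
  have "H \<in> ?N" if GN: "G \<in> ?N" and HG: "is_subgraph H G" for G H
  proof -
    obtain x where x: "x \<notin> verts G" "cone x G \<in> M" "is_graph G" using GN by blast
    have "x \<notin> verts H" "is_graph H" using HG x by (auto simp: is_subgraph_def)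
    moreover from this have "is_subgraph (cone x H) (cone x G)"
      using HG is_graph_cone[of H x] unfolding is_subgraph_def by (auto simp: cone_def)
    ultimately show ?thesis using x assms unfolding hereditary_def by blast
  qed
  moreover have "H \<in> ?N" if GN: "G \<in> ?N" and HG: "contract_step G H" for G H
  proof -
    obtain x where x: "x \<notin> verts G" "cone x G \<in> M" "is_graph G" using GN by blast
    obtain u v where uv: "u \<noteq> v" "{u, v} \<in> edges G" "H = contract u v G"
      using HG by (auto simp: contract_step_def)
    have "contract_step (cone x G) (cone x H)"
      unfolding uv contract_step_def using contract_cone[OF x(3,1) uv(1,2)] uv(1,2)
      by (intro exI[of _ u] exI[of _ v]) (auto simp: cone_def)
    moreover have "is_graph H" "x \<notin> verts H" using is_graph_contract[OF x(3)] uv x by (auto simp: contract_def)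
    ultimately show ?thesis using x assms unfolding hereditary_def by blast
  qed
  ultimately show ?thesis unfolding hereditary_def by blast
qed

lemma finite_edges: "is_graph G \<Longrightarrow> finite (edges G)"
  by (auto simp: is_graph_def intro: finite_subset[of _ "Pow (verts G)"])

text \<open>The loss consists of \<open>{u, v}\<close> and of one edge \<open>{v, y}\<close> for
  each common neighbour \<open>y\<close>; contraction is injective on all other edges.\<close>

lemma card_edges_contract:
  assumes "is_graph G" "{u, v} \<in> edges G" "u \<noteq> v"
  shows "card (edges G) \<le> card (edges (contract u v G)) + 1 + card {y. {u, y} \<in> edges G \<and> {v, y} \<in> edges G}"
proof -
  let ?f = "\<lambda>z. if z = v then u else z"
  let ?C = "{y. {u, y} \<in> edges G \<and> {v, y} \<in> edges G}"
  let ?D = "edges G - {{u, v}} - (\<lambda>y. {v, y}) ` ?C"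
  have fin: "finite (edges G)" using finite_edges assms by blast
  have C: "finite ?C"
    by (rule finite_subset[of _ "verts G"]) (use assms in \<open>auto simp: is_graph_def\<close>)
  have two: "\<exists>a b. e = {a, b} \<and> a \<noteq> b" if "e \<in> edges G" for e
    using that assms by (auto simp: is_graph_def card_2_iff)
  have mem: "?f ` e \<in> edges (contract u v G)" if e: "e \<in> ?D" for e
  proof -
    have eG: "e \<in> edges G" and ne: "e \<noteq> {u, v}" using e by simp_all
    obtain a b where ab: "e = {a, b}" "a \<noteq> b" using two[OF eG] by blast
    have "?f a \<noteq> ?f b" using ab ne by (simp add: doubleton_eq_iff) metis
    then have "card {?f a, ?f b} = 2" by (simp only: card_2_iff) blast
    then have "card (?f ` e) = 2" unfolding ab(1) by (simp only: image_insert image_empty)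
    then show ?thesis unfolding contract_def using eG by auto
  qed
  have inj: "inj_on ((`) ?f) ?D"
  proof (rule inj_onI)
    fix e e' assume e: "e \<in> ?D" "e' \<in> ?D" and eq: "?f ` e = ?f ` e'"
    have out: "?f ` e = e" if "v \<notin> e" for e using that by (auto simp: image_iff)
    have "in": "\<exists>y. e = {v, y} \<and> ?f ` e = {u, y} \<and> y \<noteq> u \<and> {u, y} \<notin> edges G" if e: "e \<in> ?D" "v \<in> e" for e
    proof -
      have eG: "e \<in> edges G" and ne: "e \<noteq> {u, v}" using e by blast+
      obtain y where y: "e = {v, y}" "y \<noteq> v" using two[OF eG] e(2) by (metis insertE insert_commute singletonD)
      moreover have "y \<noteq> u" using ne y(1) by (metis insert_commute)
      moreover have "{u, y} \<notin> edges G" using e(1) eG y(1) by blast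
      ultimately show ?thesis by (intro exI[of _ y]) (simp add: insert_commute)
    qed
    \<comment> \<open>An edge of \<open>?D\<close> through \<open>v\<close> is moved to a pair that
      is not an edge of \<open>G\<close>, every other edge is fixed. So the image reveals whether
      \<open>v\<close> was an end.\<close>
    have iff: "v \<in> e \<longleftrightarrow> ?f ` e \<notin> edges G" if "e \<in> ?D" for e
    proof (cases "v \<in> e")
      case True
      then show ?thesis using "in"[OF that] by metis
    next
      case False
      then show ?thesis using out[OF False] that by simp
    qed
    have both: "v \<in> e \<longleftrightarrow> v \<in> e'" unfolding iff[OF e(1)] iff[OF e(2)] eq by (rule refl)
    show "e = e'"
    proof (cases "v \<in> e")
      case True
      obtain y where y: "e = {v, y}" "?f ` e = {u, y}" "y \<noteq> u" using "in"[OF e(1) True] by blast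
      have "v \<in> e'" using both True by blast
      then obtain y' where y': "e' = {v, y'}" "?f ` e' = {u, y'}" "y' \<noteq> u" using "in"[OF e(2)] by blast
      have "{u, y} = {u, y'}" using eq unfolding y(2) y'(2) .
      then have "y = y'" using y(3) y'(3) by blast
      then show ?thesis using y(1) y'(1) by blast
    next
      case False
      then have "v \<notin> e'" using both by blast
      show ?thesis using eq unfolding out[OF False] out[OF \<open>v \<notin> e'\<close>] .
    qed
  qed
  have "card ?D \<le> card (edges (contract u v G))"
    by (rule card_inj_on_le[OF inj image_subsetI[OF mem] finite_edges[OF is_graph_contract[OF assms]]])
  moreover have "card (edges G) \<le> card ?D + 1 + card ((\<lambda>y. {v, y}) ` ?C)"
  proof -
    have "card (edges G) \<le> card (?D \<union> ({{u, v}} \<union> (\<lambda>y. {v, y}) ` ?C))"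
    proof (rule card_mono)
      show "finite (?D \<union> ({{u, v}} \<union> (\<lambda>y. {v, y}) ` ?C))" using fin C by simp
    qed blast
    also have "\<dots> \<le> card ?D + card ({{u, v}} \<union> (\<lambda>y. {v, y}) ` ?C)" by (rule card_Un_le)
    also have "card ({{u, v}} \<union> (\<lambda>y. {v, y}) ` ?C) \<le> card {{u, v}} + card ((\<lambda>y. {v, y}) ` ?C)"
      by (rule card_Un_le)
    finally show ?thesis by simp
  qed
  moreover have "card ((\<lambda>y. {v, y}) ` ?C) \<le> card ?C" by (rule card_image_le[OF C])
  ultimately show ?thesis by linarith
qed

lemma sum_degree_le:
  assumes "finite V" "finite E" "\<And>e. e \<in> E \<Longrightarrow> e \<subseteq> V \<and> card e = 2"
  shows "(\<Sum>v\<in>V. card {e \<in> E. v \<in> e}) = 2 * card E"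
proof -
  have "(\<Sum>v\<in>V. card {e \<in> E. v \<in> e}) = (\<Sum>v\<in>V. \<Sum>e\<in>E. if v \<in> e then 1 else 0)"
    using assms by (simp add: sum.If_cases Int_def)
  also have "\<dots> = (\<Sum>e\<in>E. \<Sum>v\<in>V. if v \<in> e then 1 else 0)" by (rule sum.swap)
  also have "\<dots> = (\<Sum>e\<in>E. 2)"
    using assms by (intro sum.cong) (auto simp: sum.If_cases Int_absorb1)
  finally show ?thesis by simp
qed

text \<open>Mader's argument: in a minor-minimal dense graph the two ends of every edge have many common
  neighbours, so the neighbourhood of a vertex \<open>x\<close> is dense.  The graphs whose cone lies in \<open>M\<close> form
  a hereditary class again, to which the induction hypothesis applies.\<close>

lemma dense_complete:
  assumes "hereditary M" "G \<in> M" "verts G \<noteq> {}" "card (edges G) \<ge> 2 ^ t * card (verts G)"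
  shows "\<exists>K\<in>M. complete_graph K \<and> card (verts K) = Suc t"
  using assms
proof (induction t arbitrary: M G)
  case 0
  then obtain x where x: "x \<in> verts G" by auto
  let ?K = "\<lparr>verts = {x}, edges = {}\<rparr>"
  have "is_subgraph ?K G" using x by (auto simp: is_subgraph_def is_graph_def)
  moreover have "complete_graph ?K" by (auto simp: complete_graph_def is_graph_def dest!: subset_singletonD)
  moreover have "?K \<in> M" using 0(1,2) calculation(1) unfolding hereditary_def by blast
  ultimately show ?case by (intro bexI[of _ ?K]) simp_all
next
  case (Suc t)
  define dense where "dense H \<longleftrightarrow> H \<in> M \<and> verts H \<noteq> {} \<and> 2 ^ Suc t * card (verts H) \<le> card (edges H)" for H
  \<comment> \<open>A dense member of \<open>M\<close> with the fewest vertices and edges: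
    contracting any of its edges destroys density.\<close>
  define H where "H = arg_min (\<lambda>H. card (verts H) + card (edges H)) dense"
  have HM: "K \<in> M" if "dense K" for K using that by (simp add: dense_def)
  have G: "dense G" using Suc.prems by (simp add: dense_def)
  then have H: "dense H" unfolding H_def by (rule arg_min_natI)
  have min: "card (verts H) + card (edges H) \<le> card (verts H') + card (edges H')" if "dense H'" for H'
    unfolding H_def using that by (rule arg_min_nat_le)
  have gH: "is_graph H" by (rule hereditaryD(1)[OF Suc.prems(1) HM[OF H]])
  have fin: "finite (verts H)" using gH by (auto simp: is_graph_def)
  have "card (verts H) > 0" using H fin by (auto simp: dense_def card_gt_0_iff)
  then have "0 < 2 ^ Suc t * card (verts H)" by simp
  also have "\<dots> \<le> card (edges H)" using H by (simp add: dense_def)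
  finally have "edges H \<noteq> {}" by (auto simp: card_gt_0_iff)
  then obtain e0 where e0: "e0 \<in> edges H" by blast
  \<comment> \<open>The contraction has one vertex less and is not dense, so more than
    \<open>2 ^ Suc t\<close> edges are lost. One of them is \<open>{u, v}\<close>, the others belong
    to common neighbours.\<close>
  have common: "2 ^ Suc t \<le> card {y. {u, y} \<in> edges H \<and> {v, y} \<in> edges H}"
    if e: "{u, v} \<in> edges H" "u \<noteq> v" for u v
  proof -
    let ?H = "contract u v H"
    have uv: "u \<in> verts H" "v \<in> verts H" using e gH by (auto simp: is_graph_def)
    have c: "card (verts ?H) = card (verts H) - 1" "verts ?H \<noteq> {}"
      using uv fin e by (auto simp: contract_def)
    have "?H \<in> M" by (rule hereditaryD(3)[OF Suc.prems(1) HM[OF H] e(2,1)])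
    have le: "card (edges ?H) \<le> card (edges H)"
    proof -
      have "edges ?H \<subseteq> (`) (\<lambda>x. if x = v then u else x) ` edges H" by (auto simp: contract_def)
      then show ?thesis using finite_edges[OF gH] by (meson card_image_le card_mono finite_imageI le_trans)
    qed
    have "\<not> dense ?H" using min[of ?H] c(1) le \<open>card (verts H) > 0\<close> by linarith
    then have "card (edges ?H) < 2 ^ Suc t * card (verts ?H)"
      using \<open>?H \<in> M\<close> c by (auto simp: dense_def)
    moreover have "2 ^ Suc t * card (verts ?H) + 2 ^ Suc t = 2 ^ Suc t * card (verts H)"
      using c(1) \<open>card (verts H) > 0\<close> by (metis One_nat_def Suc_pred add.commute mult_Suc_right)
    moreover have "2 ^ Suc t * card (verts H) \<le> card (edges H)" using H by (simp add: dense_def)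
    ultimately show ?thesis using card_edges_contract[OF gH e] by linarith
  qed
  obtain x y0 where xy: "e0 = {x, y0}" "x \<noteq> y0" using e0 gH by (auto simp: is_graph_def card_2_iff dest!: subsetD)
  define N where "N = {y. {x, y} \<in> edges H}"
  define E where "E = {e \<in> edges H. e \<subseteq> N}"
  let ?J = "\<lparr>verts = N, edges = E\<rparr>"
  have NV: "N \<subseteq> verts H" using gH by (auto simp: N_def is_graph_def)
  have xN: "x \<notin> N" using gH by (auto simp: N_def is_graph_def)
  have finN: "finite N" "finite E" using NV fin finite_subset finite_edges[OF gH] by (auto simp: E_def)
  have gJ: "is_graph ?J" using gH finN by (auto simp: is_graph_def E_def)
  have "is_subgraph (cone x ?J) H"
  proof -
    have "x \<in> verts H" using e0 xy gH by (auto simp: is_graph_def)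
    then have "verts (cone x ?J) \<subseteq> verts H" using NV by (simp add: cone_def)
    moreover have "edges (cone x ?J) \<subseteq> edges H" by (auto simp: cone_def E_def N_def)
    ultimately show ?thesis using is_graph_cone[OF gJ] xN by (simp add: is_subgraph_def)
  qed
  then have "cone x ?J \<in> M" by (rule hereditaryD(2)[OF Suc.prems(1) HM[OF H]])
  then have mem: "?J \<in> {H. is_graph H \<and> (\<exists>x. x \<notin> verts H \<and> cone x H \<in> M)}" using gJ xN by auto
  have deg: "2 ^ Suc t \<le> card {e \<in> E. v \<in> e}" if v: "v \<in> N" for v
  proof -
    let ?C = "{y. {x, y} \<in> edges H \<and> {v, y} \<in> edges H}"
    have "(\<lambda>y. {v, y}) ` ?C \<subseteq> {e \<in> E. v \<in> e}" using v by (auto simp: E_def N_def)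
    moreover have "inj_on (\<lambda>y. {v, y}) ?C" by (auto simp: inj_on_def doubleton_eq_iff)
    ultimately have le: "card ?C \<le> card {e \<in> E. v \<in> e}"
      using card_inj_on_le[of "\<lambda>y. {v, y}" ?C "{e \<in> E. v \<in> e}"] finN by simp
    have "{x, v} \<in> edges H" "x \<noteq> v" using v xN unfolding N_def by blast+
    from common[OF this] le show ?thesis by linarith
  qed
  \<comment> \<open>All degrees inside the neighbourhood \<open>N\<close> are at least
    \<open>2 ^ Suc t\<close>; double counting of the ends costs a factor 2, hence the exponent drops
    by one per level of the induction.\<close>
  have "(\<Sum>v\<in>N. 2 ^ Suc t) \<le> (\<Sum>v\<in>N. card {e \<in> E. v \<in> e})" by (rule sum_mono) (rule deg)
  also have "\<dots> = 2 * card E"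
    by (rule sum_degree_le) (use finN gH in \<open>auto simp: E_def is_graph_def\<close>)
  finally have "card (edges ?J) \<ge> 2 ^ t * card (verts ?J)" by (simp add: mult.commute)
  moreover have "verts ?J \<noteq> {}" using e0 xy by (auto simp: N_def)
  ultimately obtain K where K: "is_graph K" "complete_graph K" "card (verts K) = Suc t"
    and "\<exists>x. x \<notin> verts K \<and> cone x K \<in> M"
    using Suc.IH[OF hereditary_cone[OF Suc.prems(1)] mem] by blast
  then obtain z where z: "z \<notin> verts K" "cone z K \<in> M" by blast
  have "complete_graph (cone z K)"
  proof -
    have "e \<in> edges (cone z K)" if "e \<subseteq> verts (cone z K)" "card e = 2" for e
    proof -
      obtain a b where "e = {a, b}" "a \<noteq> b" using \<open>card e = 2\<close> by (auto simp: card_2_iff)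
      then show ?thesis using that K(2) by (auto simp: cone_def complete_graph_def insert_commute)
    qed
    then show ?thesis using is_graph_cone[OF K(1) z(1)] by (auto simp: complete_graph_def is_graph_def)
  qed
  moreover have "card (verts (cone z K)) = Suc (Suc t)"
    using K z by (simp add: cone_def is_graph_def)
  ultimately show ?case using z by blast
qed

text \<open>With \<open>t\<close> the order of an excluded graph \<open>H\<close>, the constant is
  \<open>2 ^ t\<close>: a denser member would put a complete graph on \<open>t + 1\<close> vertices
  into \<open>F\<close>, and this has a subgraph isomorphic to \<open>H\<close>.\<close>

lemma minor_closed_sparse:
  fixes F :: "nat graph set"
  assumes "\<And>G. G \<in> F \<Longrightarrow> is_graph G" "minor_closed F" "is_graph H" "H \<notin> F"
  shows "\<exists>c. \<forall>G\<in>F. card (edges G) \<le> c * card (verts G)"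
proof -
  define t where "t = card (verts H)"
  have "card (edges G) \<le> 2 ^ t * card (verts G)" if G: "G \<in> F" for G
  proof (rule ccontr)
    assume "\<not> ?thesis"
    moreover have "edges G = {}" if "verts G = {}" using assms(1)[OF G] that by (auto simp: is_graph_def)
    ultimately have "verts G \<noteq> {}" "2 ^ t * card (verts G) \<le> card (edges G)" by auto
    then obtain K where K: "K \<in> F" "complete_graph K" "card (verts K) = Suc t"
      using dense_complete[OF hereditary_minor_closed[OF assms(1,2)] G] by blast
    have fK: "finite (verts K)" using K(3) by (simp add: card_ge_0_finite)
    have "t \<le> card (verts K)" using K(3) by simp
    then obtain V where V: "V \<subseteq> verts K" "card V = t" "finite V"
      by (rule obtain_subset_with_card_n)
    have fH: "finite (verts H)" using assms(3) by (simp add: is_graph_def)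
    then obtain f where f: "bij_betw f V (verts H)"
      using finite_same_card_bij[OF V(3) fH] V(2) t_def by blast
    let ?S = "\<lparr>verts = V, edges = {e. e \<subseteq> V \<and> f ` e \<in> edges H}\<rparr>"
    have c2: "card e = 2" if "e \<subseteq> V" "f ` e \<in> edges H" for e
    proof -
      have "card (f ` e) = 2" using that assms(3) by (auto simp: is_graph_def)
      then show ?thesis using card_image[of f e] inj_on_subset[of f V e] f that by (simp add: bij_betw_def)
    qed
    have "is_subgraph ?S K"
      using V c2 K(2) by (auto simp: is_subgraph_def is_graph_def complete_graph_def)
    moreover have "graph_iso ?S H"
    proof -
      have "e \<in> (`) f ` edges ?S" if "e \<in> edges H" for e
      proof -
        have "e \<subseteq> f ` V" using that assms(3) f by (auto simp: is_graph_def bij_betw_def)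
        then obtain e' where "e' \<subseteq> V" "e = f ` e'" by (auto simp: subset_image_iff)
        then show ?thesis using that by auto
      qed
      then show ?thesis unfolding graph_iso_def using f by (intro exI[of _ f]) auto
    qed
    ultimately have "is_minor H K" unfolding is_minor_def using assms(3) by blast
    then show False using assms K by (auto simp: minor_closed_def)
  qed
  then show ?thesis by blast
qed

text \<open>All vertices of \<open>A\<close> are contracted into centres outside \<open>A\<close>.
  So the contractions do not interfere, and the simultaneous one arises by treating the vertices of
  \<open>A\<close> one after the other.\<close>

lemma hereditary_contract_stars:
  assumes M: "hereditary M" "G \<in> M" and "finite A"
    and A: "\<And>u. u \<in> A \<Longrightarrow> c u \<notin> A \<and> {u, c u} \<in> edges G"
  shows "\<lparr>verts = verts G - A,
      edges = {e'. \<exists>e\<in>edges G. e' = (\<lambda>x. if x \<in> A then c x else x) ` e \<and> card e' = 2}\<rparr> \<in> M"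
  using assms(3) A
proof (induction rule: finite_induct)
  case empty
  have "{e'. \<exists>e\<in>edges G. e' = (\<lambda>x. x) ` e \<and> card e' = 2} = edges G"
    using hereditaryD(1)[OF M] by (auto simp: is_graph_def)
  then show ?case using M by (cases G) simp
next
  case (insert a A)
  let ?f = "\<lambda>x. if x \<in> A then c x else x"
  let ?g = "\<lambda>x. if x \<in> insert a A then c x else x"
  let ?H = "\<lparr>verts = verts G - A, edges = {e'. \<exists>e\<in>edges G. e' = ?f ` e \<and> card e' = 2}\<rparr>"
  have ca: "c a \<notin> insert a A" "{a, c a} \<in> edges G" using insert.prems by auto
  have "u \<in> A \<Longrightarrow> c u \<notin> A \<and> {u, c u} \<in> edges G" for u using insert.prems by auto
  then have H: "?H \<in> M" using insert.IH by blast
  have ne: "c a \<noteq> a" using ca by auto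
  have e: "{c a, a} \<in> edges ?H"
    using ca insert.hyps ne by (auto intro!: bexI[of _ "{a, c a}"] simp: card_2_iff)
  have "contract (c a) a ?H = \<lparr>verts = verts G - insert a A,
      edges = {e'. \<exists>e\<in>edges G. e' = ?g ` e \<and> card e' = 2}\<rparr>"
  proof -
    let ?h = "\<lambda>x. if x = a then c a else x"
    have comp: "?h ` ?f ` e = ?g ` e" for e
      unfolding image_image by (rule image_cong) (use insert.prems insert.hyps in auto)
    have "e' \<in> edges (contract (c a) a ?H) \<longleftrightarrow> (\<exists>e\<in>edges G. e' = ?g ` e \<and> card e' = 2)" for e'
    proof
      assume "e' \<in> edges (contract (c a) a ?H)"
      then obtain e where "e \<in> edges G" "e' = ?h ` ?f ` e" "card e' = 2" by (auto simp: contract_def)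
      then show "\<exists>e\<in>edges G. e' = ?g ` e \<and> card e' = 2" using comp by metis
    next
      assume "\<exists>e\<in>edges G. e' = ?g ` e \<and> card e' = 2"
      then obtain e where e: "e \<in> edges G" "e' = ?g ` e" "card e' = 2" by blast
      \<comment> \<open>Single contractions drop loops on the way. An edge whose final image has two
        ends has two ends after every step, hence is not dropped early.\<close>
      have "card e = 2" "finite e" using e hereditaryD(1)[OF M] by (auto simp: is_graph_def card_2_iff)
      then have "card (?f ` e) \<le> 2" by (metis card_image_le)
      moreover have "card (?h ` ?f ` e) \<le> card (?f ` e)" using \<open>finite e\<close> by (intro card_image_le) auto
      ultimately have "card (?f ` e) = 2" using e comp[of e] by simp
      then have "?f ` e \<in> edges ?H" using e(1) by (simp only: graph.simps) blast
      then show "e' \<in> edges (contract (c a) a ?H)"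
        unfolding contract_def using e comp[of e] by (simp only: graph.simps) blast
    qed
    then have "edges (contract (c a) a ?H) = {e'. \<exists>e\<in>edges G. e' = ?g ` e \<and> card e' = 2}" by blast
    then show ?thesis by (auto simp: contract_def)
  qed
  then show ?case using hereditaryD(3)[OF M(1) H ne e] by simp
qed

section \<open>Coin flips\<close>

lemma prob_space_coin_flips: "prob_space coin_flips"
  unfolding coin_flips_def by (rule prob_space.prob_space_stream_space) (rule prob_space_measure_pmf)

lemma space_coin_flips [simp]: "space coin_flips = UNIV"
  by (simp add: coin_flips_def space_stream_space)

lemma sets_coin_flips: "sets coin_flips = sets (stream_space (count_space (UNIV :: bool set)))"
  unfolding coin_flips_def by (rule sets_stream_space_cong) simp

lemma measurable_coin_flips: "measurable coin_flips N = measurable (stream_space (count_space (UNIV :: bool set))) N"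
  "measurable N coin_flips = measurable N (stream_space (count_space (UNIV :: bool set)))"
  by (rule measurable_cong_sets, simp_all add: sets_coin_flips)+

lemma measurable_stake_coin [measurable]: "stake j \<in> measurable coin_flips (count_space UNIV)"
  unfolding measurable_coin_flips by (rule measurable_stake)

lemma measurable_sdrop_coin [measurable]: "sdrop j \<in> measurable coin_flips coin_flips"
  unfolding measurable_coin_flips by (rule measurable_sdrop)

lemma nn_integral_coin_flips:
  assumes [measurable]: "f \<in> borel_measurable coin_flips"
  shows "(\<integral>\<^sup>+\<omega>. f \<omega> \<partial>coin_flips) =
    (\<integral>\<^sup>+\<omega>. f (True ## \<omega>) \<partial>coin_flips) / 2 + (\<integral>\<^sup>+\<omega>. f (False ## \<omega>) \<partial>coin_flips) / 2"
proof -
  have half: "ennreal (1 / 2) = inverse 2"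
    using inverse_ennreal[of 2, symmetric] by (simp only: divide_inverse mult_1_left ennreal_numeral)
  have "(\<integral>\<^sup>+\<omega>. f \<omega> \<partial>coin_flips) =
      (\<integral>\<^sup>+b. (\<integral>\<^sup>+\<omega>. f (b ## \<omega>) \<partial>coin_flips) \<partial>measure_pmf (bernoulli_pmf (1 / 2)))"
    using prob_space.nn_integral_stream_space[OF prob_space_measure_pmf, of f "bernoulli_pmf (1 / 2)"] assms
    unfolding coin_flips_def by simp
  also have "\<dots> = (\<integral>\<^sup>+\<omega>. f (True ## \<omega>) \<partial>coin_flips) / 2 + (\<integral>\<^sup>+\<omega>. f (False ## \<omega>) \<partial>coin_flips) / 2"
    by (subst nn_integral_measure_pmf_finite)
       (auto simp: set_pmf_bernoulli UNIV_bool divide_ennreal_def half)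
  finally show ?thesis .
qed

lemma measurable_Stream_coin [measurable]: "(##) b \<in> measurable coin_flips coin_flips"
  unfolding measurable_coin_flips by (intro measurable_Stream measurable_const measurable_ident_sets) (simp_all add: sets_coin_flips)

lemma half_add: "x / 2 + x / 2 = (x :: ennreal)"
  using ennreal_divide_times[of x 2 2] ennreal_mult_divide_eq[of 2 x]
  by (simp flip: mult_2_right)

text \<open>Given the earlier flips, each prescribed flip is still fair, so every constraint costs a
  factor 1/2 although the required value may depend on the past. The induction splits off the first
  flip and passes its value on to \<open>f\<close>; therefore \<open>I\<close> and \<open>f\<close>
  are generalised.\<close>

lemma emeasure_adaptive_cylinder:
  "emeasure coin_flips {\<omega>. \<forall>i<N. i \<in> I \<longrightarrow> \<omega> !! i = f (stake i \<omega>)} = (1 / 2) ^ card (I \<inter> {..<N})"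
proof (induction N arbitrary: I f)
  case 0
  interpret prob_space coin_flips by (rule prob_space_coin_flips)
  show ?case using emeasure_space_1 by simp
next
  case (Suc N)
  define A where "A = {\<omega>. \<forall>i<Suc N. i \<in> I \<longrightarrow> \<omega> !! i = f (stake i \<omega>)}"
  define I' where "I' = {i. Suc i \<in> I}"
  define B where "B b = {\<omega>. \<forall>i<N. i \<in> I' \<longrightarrow> \<omega> !! i = f (b # stake i \<omega>)}" for b
  have meas: "A \<in> sets coin_flips"
  proof -
    have *: "A = stake (Suc N) -` {xs. length xs = Suc N \<and> (\<forall>i<Suc N. i \<in> I \<longrightarrow> xs ! i = f (take i xs))} \<inter> space coin_flips"
      by (auto simp: A_def take_stake min_def simp del: stake.simps)
    show ?thesis unfolding * by (rule measurable_sets[OF measurable_stake_coin]) simp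
  qed
  have mem: "b ## \<omega> \<in> A \<longleftrightarrow> (0 \<in> I \<longrightarrow> b = f []) \<and> \<omega> \<in> B b" for b \<omega>
    unfolding A_def B_def I'_def by (auto simp: less_Suc_eq_0_disj)
  have B: "emeasure coin_flips (B b) = (1 / 2) ^ card (I' \<inter> {..<N})" for b
    unfolding B_def by (rule Suc.IH)
  have ind: "(\<integral>\<^sup>+\<omega>. indicator A (b ## \<omega>) \<partial>coin_flips) =
      (if 0 \<in> I \<longrightarrow> b = f [] then emeasure coin_flips (B b) else 0)" for b
  proof -
    have "{\<omega>. b ## \<omega> \<in> A} \<in> sets coin_flips"
      using measurable_sets[OF measurable_Stream_coin meas, of b] by (simp add: vimage_def)
    moreover have "(\<lambda>\<omega>. indicator A (b ## \<omega>) :: ennreal) = indicator {\<omega>. b ## \<omega> \<in> A}"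
      by (auto simp: indicator_def)
    ultimately have "(\<integral>\<^sup>+\<omega>. indicator A (b ## \<omega>) \<partial>coin_flips) = emeasure coin_flips {\<omega>. b ## \<omega> \<in> A}"
      by simp
    then show ?thesis by (auto simp: mem)
  qed
  have "emeasure coin_flips A = (\<integral>\<^sup>+\<omega>. indicator A \<omega> \<partial>coin_flips)" using meas by simp
  also have "\<dots> = (\<integral>\<^sup>+\<omega>. indicator A (True ## \<omega>) \<partial>coin_flips) / 2 + (\<integral>\<^sup>+\<omega>. indicator A (False ## \<omega>) \<partial>coin_flips) / 2"
    by (rule nn_integral_coin_flips) (use meas in simp)
  also have "\<dots> = (if 0 \<in> I then 1 / 2 else 1) * (1 / 2) ^ card (I' \<inter> {..<N})"
    unfolding ind B by (cases "f []") (auto simp: half_add, simp_all add: divide_ennreal_def mult.commute)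
  also have "\<dots> = (1 / 2) ^ card (I \<inter> {..<Suc N})"
  proof -
    have "I \<inter> {..<Suc N} = (if 0 \<in> I then {0} else {}) \<union> Suc ` (I' \<inter> {..<N})"
      by (auto simp: I'_def image_iff less_Suc_eq_0_disj gr0_conv_Suc)
    moreover have "card (Suc ` (I' \<inter> {..<N})) = card (I' \<inter> {..<N})" by (rule card_image) simp
    moreover have "card ((if 0 \<in> I then {0} else {}) \<union> Suc ` (I' \<inter> {..<N})) =
        card (if 0 \<in> I then {0 :: nat} else {}) + card (Suc ` (I' \<inter> {..<N}))"
      by (rule card_Un_disjoint) auto
    ultimately show ?thesis by simp
  qed
  finally show ?case unfolding A_def .
qed

text \<open>Independence of the first \<open>N\<close> flips from the later ones, in the product
  form that splits off one round. It follows by averaging over the first flip \<open>N\<close>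
  times.\<close>

lemma nn_integral_block:
  assumes [measurable]: "h \<in> borel_measurable coin_flips"
  shows "(\<integral>\<^sup>+\<omega>. g (stake N \<omega>) * h (sdrop N \<omega>) \<partial>coin_flips) =
    (\<integral>\<^sup>+\<omega>. g (stake N \<omega>) \<partial>coin_flips) * (\<integral>\<^sup>+\<omega>. h \<omega> \<partial>coin_flips)"
proof (induction N arbitrary: g)
  case 0
  interpret prob_space coin_flips by (rule prob_space_coin_flips)
  show ?case using emeasure_space_1 by (simp add: nn_integral_cmult)
next
  case (Suc N)
  let ?H = "\<integral>\<^sup>+\<omega>. h \<omega> \<partial>coin_flips"
  have mg: "(\<lambda>\<omega>. g (stake (Suc N) \<omega>)) \<in> borel_measurable coin_flips"
    by (rule measurable_compose[OF measurable_stake_coin]) simp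
  have mh: "(\<lambda>\<omega>. h (sdrop (Suc N) \<omega>)) \<in> borel_measurable coin_flips"
    by (rule measurable_compose[OF measurable_sdrop_coin]) simp
  have "(\<integral>\<^sup>+\<omega>. g (stake (Suc N) \<omega>) * h (sdrop (Suc N) \<omega>) \<partial>coin_flips) =
     (\<integral>\<^sup>+\<omega>. g (True # stake N \<omega>) * h (sdrop N \<omega>) \<partial>coin_flips) / 2 +
     (\<integral>\<^sup>+\<omega>. g (False # stake N \<omega>) * h (sdrop N \<omega>) \<partial>coin_flips) / 2"
    by (subst nn_integral_coin_flips[OF borel_measurable_times_ennreal[OF mg mh]]) simp
  also have "\<dots> = (\<integral>\<^sup>+\<omega>. g (True # stake N \<omega>) \<partial>coin_flips) * ?H / 2 +
     (\<integral>\<^sup>+\<omega>. g (False # stake N \<omega>) \<partial>coin_flips) * ?H / 2"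
    using Suc.IH[of "\<lambda>xs. g (True # xs)"] Suc.IH[of "\<lambda>xs. g (False # xs)"] by simp
  also have "\<dots> = ((\<integral>\<^sup>+\<omega>. g (True # stake N \<omega>) \<partial>coin_flips) / 2 +
     (\<integral>\<^sup>+\<omega>. g (False # stake N \<omega>) \<partial>coin_flips) / 2) * ?H"
    by (simp add: distrib_right distrib_left divide_ennreal_def mult_ac)
  also have "\<dots> = (\<integral>\<^sup>+\<omega>. g (stake (Suc N) \<omega>) \<partial>coin_flips) * ?H"
    by (subst nn_integral_coin_flips[OF mg]) simp
  finally show ?case .
qed

section \<open>Repetition over blocks of flips and its geometric tail\<close>

definition all_bad :: "(bool list \<Rightarrow> bool) \<Rightarrow> nat \<Rightarrow> nat \<Rightarrow> bool stream \<Rightarrow> bool" where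
  "all_bad good N j \<omega> \<longleftrightarrow> (\<forall>i<j. \<not> good (stake N (sdrop (i * N) \<omega>)))"

lemma all_bad_Suc: "all_bad good N (Suc j) \<omega> \<longleftrightarrow> \<not> good (stake N \<omega>) \<and> all_bad good N j (sdrop N \<omega>)"
  by (auto simp: all_bad_def less_Suc_eq_0_disj sdrop_add)

lemma measurable_all_bad [measurable]: "Measurable.pred coin_flips (all_bad good N j)"
proof (induction j)
  case 0
  then show ?case by (simp add: all_bad_def)
next
  case (Suc j)
  have [measurable]: "Measurable.pred coin_flips (\<lambda>\<omega>. good (stake N \<omega>))"
    by (rule measurable_compose[OF measurable_stake_coin]) simp
  have [measurable]: "Measurable.pred coin_flips (\<lambda>\<omega>. all_bad good N j (sdrop N \<omega>))"
    by (rule measurable_compose[OF measurable_sdrop_coin Suc])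
  show ?case unfolding all_bad_Suc by measurable
qed

text \<open>The event \<open>all_bad good N j\<close> has probability \<open>q ^ j\<close> with
  \<open>q \<le> 1 - p\<close>, and the series of \<open>T * q ^ j\<close> sums to
  \<open>T / (1 - q)\<close>. Monotone convergence for \<open>\<tau>\<close> itself is avoided by
  bounding it pointwise by the series.\<close>

lemma expected_blocks:
  fixes T :: nat
  assumes p: "p > 0" "measure coin_flips {\<omega>. good (stake N \<omega>)} \<ge> p"
    and \<tau>: "\<And>\<omega>. \<tau> \<omega> \<le> (\<Sum>j. of_nat T * of_bool (all_bad good N j \<omega>))"
  shows "(\<integral>\<^sup>+\<omega>. \<tau> \<omega> \<partial>coin_flips) \<le> ennreal (T / p)"
proof -
  interpret prob_space coin_flips by (rule prob_space_coin_flips)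
  define q where "q = measure coin_flips {\<omega>. \<not> good (stake N \<omega>)}"
  have good: "Measurable.pred coin_flips (\<lambda>\<omega>. good (stake N \<omega>))"
    by (rule measurable_compose[OF measurable_stake_coin]) simp
  then have "{\<omega>. good (stake N \<omega>)} \<in> sets coin_flips" by (simp add: pred_def)
  from prob_compl[OF this] sets.compl_sets[OF this]
  have q: "q = 1 - measure coin_flips {\<omega>. good (stake N \<omega>)}"
    and meas: "{\<omega>. \<not> good (stake N \<omega>)} \<in> sets coin_flips"
    unfolding q_def by (simp_all add: Compl_eq_Diff_UNIV[symmetric] Collect_neg_eq)
  have q1: "0 \<le> q" "q \<le> 1 - p" using p(2) q by (simp_all add: q_def)
  have bad: "(\<integral>\<^sup>+\<omega>. of_bool (all_bad good N j \<omega>) \<partial>coin_flips) = ennreal (q ^ j)" for j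
  proof (induction j)
    case 0
    then show ?case using emeasure_space_1 by (simp add: all_bad_def)
  next
    case (Suc j)
    have "(\<integral>\<^sup>+\<omega>. of_bool (all_bad good N (Suc j) \<omega>) \<partial>coin_flips) =
       (\<integral>\<^sup>+\<omega>. of_bool (\<not> good (stake N \<omega>)) * of_bool (all_bad good N j (sdrop N \<omega>)) \<partial>coin_flips)"
      by (intro nn_integral_cong) (simp add: all_bad_Suc)
    also have "\<dots> = (\<integral>\<^sup>+\<omega>. of_bool (\<not> good (stake N \<omega>)) \<partial>coin_flips) *
        (\<integral>\<^sup>+\<omega>. of_bool (all_bad good N j \<omega>) \<partial>coin_flips)"
      by (rule nn_integral_block[where g = "\<lambda>xs. of_bool (\<not> good xs)"]) measurable
    also have "(\<integral>\<^sup>+\<omega>. of_bool (\<not> good (stake N \<omega>)) \<partial>coin_flips) =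
        (\<integral>\<^sup>+\<omega>. indicator {\<omega>. \<not> good (stake N \<omega>)} \<omega> \<partial>coin_flips)"
      by (intro nn_integral_cong) (simp add: indicator_def)
    also have "\<dots> = ennreal q" using meas by (simp add: q_def emeasure_eq_measure)
    finally show ?case using Suc q1 by (simp add: ennreal_mult')
  qed
  have "(\<integral>\<^sup>+\<omega>. \<tau> \<omega> \<partial>coin_flips) \<le> (\<integral>\<^sup>+\<omega>. (\<Sum>j. of_nat T * of_bool (all_bad good N j \<omega>)) \<partial>coin_flips)"
    by (rule nn_integral_mono) (rule \<tau>)
  also have "\<dots> = (\<Sum>j. \<integral>\<^sup>+\<omega>. of_nat T * of_bool (all_bad good N j \<omega>) \<partial>coin_flips)"
    by (rule nn_integral_suminf) measurable
  also have "\<dots> = (\<Sum>j. ennreal (T * q ^ j))"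
    using q1 by (intro suminf_cong) (simp add: nn_integral_cmult bad ennreal_mult' ennreal_of_nat_eq_real_of_nat)
  also have "\<dots> = ennreal (\<Sum>j. T * q ^ j)"
    using q1 p by (intro suminf_ennreal2) (auto intro!: summable_mult summable_geometric)
  also have "(\<Sum>j. T * q ^ j) = T / (1 - q)"
    using q1 p by (subst suminf_mult) (auto intro!: summable_geometric simp: suminf_geometric)
  also have "ennreal (T / (1 - q)) \<le> ennreal (T / p)"
    using q1 p by (intro ennreal_leI divide_left_mono) auto
  finally show ?thesis .
qed

section \<open>Orientations of bounded out-degree\<close>

fun deg :: "(nat \<times> nat) list \<Rightarrow> nat \<Rightarrow> nat" where
  "deg [] u = 0"
| "deg (e # L) u = of_bool (fst e = u) + of_bool (snd e = u) + deg L u"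

lemma deg_append: "deg (L @ L') u = deg L u + deg L' u"
  by (induction L) auto

lemma deg_le: "deg L u \<le> 2 * length L"
  by (induction L) auto

lemma deg_take_Suc:
  "j < length L \<Longrightarrow> deg (take (Suc j) L) u = deg (take j L) u + of_bool (fst (L ! j) = u) + of_bool (snd (L ! j) = u)"
  by (simp add: take_Suc_conv_app_nth deg_append)

definition core :: "nat \<Rightarrow> (nat \<times> nat) list \<Rightarrow> (nat \<times> nat) list" where
  "core D L = filter (\<lambda>e. D < deg L (fst e) \<and> D < deg L (snd e)) L"

text \<open>An end of degree at most \<open>D\<close> becomes a tail, so an edge with two such ends
  yields both arcs. Out-degrees remain bounded by \<open>D\<close>, because a vertex emits at most
  one arc per incident edge.\<close>

definition arcs_of :: "nat \<Rightarrow> (nat \<times> nat) list \<Rightarrow> nat \<times> nat \<Rightarrow> (nat \<times> nat) list" where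
  "arcs_of D L e = (if D < deg L (fst e) then [] else [e]) @ (if D < deg L (snd e) then [] else [prod.swap e])"

definition arcs :: "nat \<Rightarrow> (nat \<times> nat) list \<Rightarrow> (nat \<times> nat) list" where
  "arcs D L = concat (map (arcs_of D L) L)"

text \<open>The guard makes the recursion well-founded for arbitrary lists. For a list satisfying
  \<open>halving\<close> it fails only if the list is empty, and \<open>orient_rec\<close> removes
  it.\<close>

function orient :: "nat \<Rightarrow> (nat \<times> nat) list \<Rightarrow> (nat \<times> nat) list" where
  "orient D L = (if length (core D L) < length L then arcs D L @ orient D (core D L) else [])"
  by auto
termination by (relation "Wellfounded.measure (length \<circ> snd)") auto

declare orient.simps [simp del]

text \<open>Required of all iterates, so that the property is inherited by \<open>core D L\<close>.
  It turns the total time of the peeling rounds into a geometric sum.\<close>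

definition halving :: "nat \<Rightarrow> (nat \<times> nat) list \<Rightarrow> bool" where
  "halving D L \<longleftrightarrow> (\<forall>i. 2 * length ((core D ^^ Suc i) L) \<le> length ((core D ^^ i) L))"

lemma halvingD: "halving D L \<Longrightarrow> 2 * length (core D L) \<le> length L" "halving D L \<Longrightarrow> halving D (core D L)"
  unfolding halving_def by (metis funpow_0 funpow_simps_right(2) o_apply) (metis funpow_simps_right(2) o_apply)

lemma set_core: "set (core D L) \<subseteq> set L"
  by (auto simp: core_def)

lemma length_core: "length (core D L) \<le> length L"
  by (simp add: core_def)

lemma length_arcs_aux:
  "length (concat (map (arcs_of D L) M)) +
     2 * length (filter (\<lambda>e. D < deg L (fst e) \<and> D < deg L (snd e)) M) \<le> 2 * length M"
  by (induction M) (auto simp: arcs_of_def)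

lemma length_arcs: "length (arcs D L) + 2 * length (core D L) \<le> 2 * length L"
  using length_arcs_aux[of D L L] unfolding arcs_def core_def .

lemma length_orient: "length (orient D L) \<le> 2 * length L"
proof (induction D L rule: orient.induct)
  case (1 D L)
  then show ?case using length_arcs[of D L] by (subst orient.simps) auto
qed

section \<open>Edge lists in machine memory and peeling in linear time\<close>

definition elist :: "state \<Rightarrow> nat \<Rightarrow> nat \<Rightarrow> (nat \<times> nat) list \<Rightarrow> bool" where
  "elist s a b L \<longleftrightarrow> (\<forall>i<length L. arrays s a i = fst (L ! i) \<and> arrays s b i = snd (L ! i))"

definition ends_below :: "nat \<Rightarrow> (nat \<times> nat) list \<Rightarrow> bool" where
  "ends_below n L \<longleftrightarrow> (\<forall>e\<in>set L. fst e < n \<and> snd e < n)"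

lemma ends_below_nth: "ends_below n L \<Longrightarrow> j < length L \<Longrightarrow> fst (L ! j) < n" "ends_below n L \<Longrightarrow> j < length L \<Longrightarrow> snd (L ! j) < n"
  by (auto simp: ends_below_def)

text \<open>
  Registers 0 to 4 hold \<open>n\<close>, the number of edges, 1, 0 and the degree bound \<open>D\<close>.  Registers 5, 6, 7
  and 8 hold the lengths of the current list (arrays 7 and 8), the list being peeled (9 and 10), the
  list of arcs (11 and 12) and the list under construction (15 and 16, or 9 and 10 again during
  peeling).  Register 9 is the success flag, register 10 the last colour, and registers
  \<open>100 + 3 * s\<close>, \<open>101 + 3 * s\<close>, \<open>102 + 3 * s\<close> hold the three colours involved in stage \<open>s\<close>.
  Array 4 contains the picked neighbours, array 5 counters, array 100 the colours, array \<open>100 + 2 * j\<close>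
  the samples of stage \<open>j - 1\<close>, and array \<open>101 + 2 * s\<close> is the table of the vertices that disappeared
  in stage \<open>s\<close>.
\<close>

fun seqs :: "prog list \<Rightarrow> prog" where
  "seqs [] = Skip"
| "seqs (p # ps) = Seq p (seqs ps)"

definition env :: "nat \<Rightarrow> nat \<Rightarrow> nat \<Rightarrow> state \<Rightarrow> bool" where
  "env n m D s \<longleftrightarrow> regs s 0 = n \<and> regs s 1 = m \<and> regs s 2 = 1 \<and> regs s 3 = 0 \<and> regs s 4 = D"

lemma halts_While:
  assumes "test_holds b s \<Longrightarrow> halts w p s T Q"
    and "\<And>s'. test_holds b s \<Longrightarrow> Q s' \<Longrightarrow> frame p s s' \<Longrightarrow> halts w (While b p) s' U R"
    and "\<not> test_holds b s \<Longrightarrow> R s"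
    and "test_holds b s \<Longrightarrow> 1 + T + U \<le> V" "1 \<le> V"
  shows "halts w (While b p) s V R"
proof (cases "test_holds b s")
  case True
  obtain t s' where 1: "exec w p s t s'" "t \<le> T" "Q s'" using assms(1)[OF True] by (auto simp: halts_def)
  obtain u s'' where 2: "exec w (While b p) s' u s''" "u \<le> U" "R s''"
    using assms(2)[OF True 1(3) exec_frame[OF 1(1)]] by (auto simp: halts_def)
  show ?thesis unfolding halts_def
    using exec.WhileTrue[OF True 1(1) 2(1)] 1 2 assms(4)[OF True] by (intro exI[of _ "1 + t + u"] exI[of _ s'']) auto
next
  case False
  then show ?thesis using exec.WhileFalse[OF False] assms(3,5) unfolding halts_def by blast
qed

lemma halts_Cons:
  assumes "halts w p s T Q" "T \<le> V" "\<And>s'. Q s' \<Longrightarrow> frame p s s' \<Longrightarrow> halts w (seqs ps) s' (V - T) R"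
  shows "halts w (seqs (p # ps)) s V R"
  unfolding seqs.simps using assms(2) by (intro halts_Seq[OF assms(1,3)]) auto

lemma halts_run_Cons:
  assumes "while_free p" "cost p \<le> V" "halts w (seqs ps) (run w p s) (V - cost p) R"
  shows "halts w (seqs (p # ps)) s V R"
  by (rule halts_Cons[where T = "cost p" and Q = "\<lambda>s'. s' = run w p s"])
    (use assms in \<open>auto intro: halts_run\<close>)

lemma halts_Nil: "1 \<le> V \<Longrightarrow> R s \<Longrightarrow> halts w (seqs []) s V R"
  by (rule halts_run) auto

text \<open>Only the counters of vertices in the current list are cleared. Clearing all
  \<open>n\<close> of them in every peeling round would add a term \<open>n\<close> per round and
  spoil the geometric sum.\<close>

definition reset_deg :: prog where
  "reset_deg = For 30 6 (seqs [Load 11 9 30, Load 12 10 30, Store 5 11 3, Store 5 12 3])"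

definition count_deg :: prog where
  "count_deg = For 30 6 (seqs [Load 11 9 30, Load 12 10 30,
     Load 13 5 11, Add 13 13 2, Store 5 11 13, Load 13 5 12, Add 13 13 2, Store 5 12 13])"

definition split_list :: prog where
  "split_list = For 30 6 (seqs [Load 11 9 30, Load 12 10 30, Load 13 5 11, Load 14 5 12,
     Cond (Less 4 13) Skip (seqs [Store 11 7 11, Store 12 7 12, Add 7 7 2]),
     Cond (Less 4 14) Skip (seqs [Store 11 7 12, Store 12 7 11, Add 7 7 2]),
     Cond (Less 4 13) (Cond (Less 4 14) (seqs [Store 9 8 11, Store 10 8 12, Add 8 8 2]) Skip) Skip])"

definition peel_round :: prog where
  "peel_round = seqs [reset_deg, count_deg, Const 8 0, split_list, Move 6 8]"

definition orient_prog :: prog where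
  "orient_prog = seqs [For 30 5 (seqs [Load 11 7 30, Load 12 8 30, Store 9 30 11, Store 10 30 12]),
     Move 6 5, Const 7 0, While (Less 3 6) peel_round]"

lemma orient_prog_frame [simp]:
  "writes reset_deg = {30, 11, 12}" "stores reset_deg = {5}" "flip_free reset_deg"
  "writes count_deg = {30, 11, 12, 13}" "stores count_deg = {5}" "flip_free count_deg"
  "writes split_list = {30, 11, 12, 13, 14, 7, 8}" "stores split_list = {11, 12, 9, 10}" "flip_free split_list"
  "writes peel_round = {30, 11, 12, 13, 14, 7, 8, 6}" "stores peel_round = {5, 11, 12, 9, 10}" "flip_free peel_round"
  "writes orient_prog = {30, 11, 12, 13, 14, 7, 8, 6}" "stores orient_prog = {5, 11, 12, 9, 10}" "flip_free orient_prog"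
  unfolding orient_prog_def peel_round_def reset_deg_def count_deg_def split_list_def
  by auto

context
  fixes w n m D :: nat and L :: "(nat \<times> nat) list"
  assumes L: "ends_below n L" "n < 2 ^ w" "2 * length L < 2 ^ w"
begin

lemma lt [simp]: "j < length L \<Longrightarrow> fst (L ! j) < 2 ^ w" "j < length L \<Longrightarrow> snd (L ! j) < 2 ^ w"
  using ends_below_nth[OF L(1)] L(2) by (meson less_trans)+

lemma halts_reset_deg:
  assumes "env n m D s" "regs s 6 = length L" "elist s 9 10 L"
  shows "halts w reset_deg s (2 + 8 * length L)
    (\<lambda>s'. \<forall>e\<in>set L. arrays s' 5 (fst e) = 0 \<and> arrays s' 5 (snd e) = 0)"
proof -
  define I where "I j s' \<longleftrightarrow> (\<forall>i<j. arrays s' 5 (fst (L ! i)) = 0 \<and> arrays s' 5 (snd (L ! i)) = 0)"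
    for j and s' :: state
  have "halts w reset_deg s (2 + 8 * length L) (I (length L))"
    unfolding reset_deg_def
  proof (rule halts_For[where T = 6 and I = I], goal_cases)
    case (11 j s')
    have "arrays s' 9 = arrays s 9" "arrays s' 10 = arrays s 10" "regs s' 3 = regs s 3"
      using 11(3) by (auto simp: frame_def)
    then show ?case
      using 11 assms by (intro halts_run) (auto simp: I_def elist_def env_def less_Suc_eq)
  qed (use assms L in \<open>auto simp: I_def env_def\<close>)
  then show ?thesis by (rule halts_mono) (simp, metis I_def in_set_conv_nth)
qed

lemma halts_count_deg:
  assumes "env n m D s" "regs s 6 = length L" "elist s 9 10 L"
    and "\<forall>e\<in>set L. arrays s 5 (fst e) = 0 \<and> arrays s 5 (snd e) = 0"
  shows "halts w count_deg s (2 + 12 * length L)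
    (\<lambda>s'. \<forall>e\<in>set L. arrays s' 5 (fst e) = deg L (fst e) \<and> arrays s' 5 (snd e) = deg L (snd e))"
proof -
  define V where "V = fst ` set L \<union> snd ` set L"
  define I where "I j s' \<longleftrightarrow> (\<forall>u\<in>V. arrays s' 5 u = deg (take j L) u)"
    for j and s' :: state
  have "halts w count_deg s (2 + 12 * length L) (I (length L))"
    unfolding count_deg_def
  proof (rule halts_For[where T = 10 and I = I], goal_cases)
    case (11 j s')
    have 1: "arrays s' 9 j = fst (L ! j)" "arrays s' 10 j = snd (L ! j)" "regs s' 2 = 1"
      using 11(1,3) assms by (auto simp: frame_def elist_def env_def)
    have V: "fst (L ! j) \<in> V" "snd (L ! j) \<in> V" using 11(1) by (auto simp: V_def)
    have lt': "deg (take j L) u + 2 < 2 ^ w" for u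
    proof -
      have "deg (take j L) u \<le> 2 * j" using deg_le[of "take j L" u] 11(1) by simp
      then show ?thesis using L(3) 11(1) by linarith
    qed
    have lt: "deg (take j L) u < 2 ^ w" "Suc (deg (take j L) u) < 2 ^ w" "Suc (Suc (deg (take j L) u)) < 2 ^ w" for u
      using lt'[of u] by linarith+
    have I: "\<And>u. u \<in> V \<Longrightarrow> arrays s' 5 u = deg (take j L) u" using 11(2) by (simp add: I_def)
    show ?case
      using 11(1,4) 1 V lt by (intro halts_run) (auto simp: I_def I deg_take_Suc)
  qed (use assms L in \<open>auto simp: I_def env_def V_def\<close>)
  then show ?thesis by (rule halts_mono) (auto simp: I_def V_def)
qed

lemma halts_split_list:
  assumes "env n m D s" "regs s 6 = length L" "elist s 9 10 L" "regs s 8 = 0"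
    and cnt: "\<forall>e\<in>set L. arrays s 5 (fst e) = deg L (fst e) \<and> arrays s 5 (snd e) = deg L (snd e)"
    and out: "regs s 7 = length out" "elist s 11 12 out" "length out + 2 * length L < 2 ^ w"
  shows "halts w split_list s (2 + 27 * length L)
    (\<lambda>s'. regs s' 8 = length (core D L) \<and> elist s' 9 10 (core D L) \<and>
       regs s' 7 = length (out @ arcs D L) \<and> elist s' 11 12 (out @ arcs D L))"
proof -
  let ?P = "\<lambda>e. D < deg L (fst e) \<and> D < deg L (snd e)"
  define C where "C j = filter ?P (take j L)" for j
  define A where "A j = out @ concat (map (arcs_of D L) (take j L))" for j
  define I where "I j s' \<longleftrightarrow> regs s' 8 = length (C j) \<and> elist s' 9 10 (C j) \<and>
      (\<forall>i. j \<le> i \<longrightarrow> i < length L \<longrightarrow> arrays s' 9 i = fst (L ! i) \<and> arrays s' 10 i = snd (L ! i)) \<and>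
      regs s' 7 = length (A j) \<and> elist s' 11 12 (A j)"
    for j and s' :: state
  have "halts w split_list s (2 + 27 * length L) (I (length L))"
    unfolding split_list_def
  proof (rule halts_For[where T = 25 and I = I], goal_cases)
    case (11 j s')
    have 1: "regs s' 2 = 1" "regs s' 4 = D" "arrays s' 5 = arrays s 5"
      using 11(3) assms by (auto simp: frame_def env_def)
    have 2: "arrays s' 9 j = fst (L ! j)" "arrays s' 10 j = snd (L ! j)"
      using 11(1,2) by (auto simp: I_def)
    have 3: "arrays s 5 (fst (L ! j)) = deg L (fst (L ! j))" "arrays s 5 (snd (L ! j)) = deg L (snd (L ! j))"
      using cnt 11(1) by auto
    have 4: "deg L u < 2 ^ w" for u using deg_le[of L u] L(3) by linarith
    \<comment> \<open>The list is compacted in place. The write position never overtakes the read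
      position \<open>j\<close>, so the entries not yet read are intact.\<close>
    have cj: "length (C j) \<le> j" unfolding C_def using length_filter_le[of ?P "take j L"] 11(1) by simp
    have aj: "length (A j) \<le> length out + 2 * j"
      using length_arcs_aux[of D L "take j L"] 11(1) by (simp add: A_def)
    have 5: "Suc (length (C j)) < 2 ^ w" "Suc (length (A j)) < 2 ^ w" "Suc (Suc (length (A j))) < 2 ^ w"
      using cj aj 11(1) L(3) out(3) by linarith+
    have CS: "C (Suc j) = C j @ (if ?P (L ! j) then [L ! j] else [])"
      unfolding C_def using 11(1) by (simp add: take_Suc_conv_app_nth)
    have AS: "A (Suc j) = A j @ arcs_of D L (L ! j)"
      unfolding A_def using 11(1) by (simp add: take_Suc_conv_app_nth)
    show ?case
      using 11(1,2,4) 1 2 3 4 5 cj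
      by (intro halts_run)
        (auto simp: I_def CS AS arcs_of_def elist_def nth_append less_Suc_eq split: if_splits)
  qed (use assms L in \<open>auto simp: I_def env_def A_def C_def elist_def\<close>)
  then show ?thesis by (rule halts_mono) (auto simp: I_def A_def C_def core_def arcs_def)
qed

lemma halts_peel_round:
  assumes "env n m D s" "regs s 6 = length L" "elist s 9 10 L" "L \<noteq> []"
    and out: "regs s 7 = length out" "elist s 11 12 out" "length out + 2 * length L < 2 ^ w"
  shows "halts w peel_round s (60 * length L)
    (\<lambda>s'. regs s' 6 = length (core D L) \<and> elist s' 9 10 (core D L) \<and>
       regs s' 7 = length (out @ arcs D L) \<and> elist s' 11 12 (out @ arcs D L))"
  unfolding peel_round_def
proof (rule halts_Cons[OF halts_reset_deg[OF assms(1-3)]])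
  have l: "length L > 0" using assms by simp
  then obtain d where d: "length L = Suc d" using gr0_implies_Suc by blast
  show "2 + 8 * length L \<le> 60 * length L" using l by linarith
  fix s1 assume 1: "\<forall>e\<in>set L. arrays s1 5 (fst e) = 0 \<and> arrays s1 5 (snd e) = 0" "frame reset_deg s s1"
  have e1: "env n m D s1" "regs s1 6 = length L" "elist s1 9 10 L" "regs s1 7 = length out" "elist s1 11 12 out"
    using assms 1(2) by (auto simp: env_def elist_def frame_def)
  show "halts w (seqs [count_deg, Const 8 0, split_list, Move 6 8]) s1 (60 * length L - (2 + 8 * length L))
    (\<lambda>s'. regs s' 6 = length (core D L) \<and> elist s' 9 10 (core D L) \<and>
       regs s' 7 = length (out @ arcs D L) \<and> elist s' 11 12 (out @ arcs D L))"
  proof (rule halts_Cons[OF halts_count_deg[OF e1(1-3) 1(1)]])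
    show "2 + 12 * length L \<le> 60 * length L - (2 + 8 * length L)" using l by linarith
    fix s2 assume 2: "\<forall>e\<in>set L. arrays s2 5 (fst e) = deg L (fst e) \<and> arrays s2 5 (snd e) = deg L (snd e)"
      "frame count_deg s1 s2"
    let ?s3 = "run w (Const 8 0) s2"
    have e2: "env n m D ?s3" "regs ?s3 6 = length L" "elist ?s3 9 10 L" "regs ?s3 8 = 0"
      "\<forall>e\<in>set L. arrays ?s3 5 (fst e) = deg L (fst e) \<and> arrays ?s3 5 (snd e) = deg L (snd e)"
      "regs ?s3 7 = length out" "elist ?s3 11 12 out"
      using e1 2 by (auto simp: env_def elist_def frame_def)
    show "halts w (seqs [Const 8 0, split_list, Move 6 8]) s2 (60 * length L - (2 + 8 * length L) - (2 + 12 * length L))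
      (\<lambda>s'. regs s' 6 = length (core D L) \<and> elist s' 9 10 (core D L) \<and>
         regs s' 7 = length (out @ arcs D L) \<and> elist s' 11 12 (out @ arcs D L))"
    proof (rule halts_run_Cons, goal_cases)
      case 3
      have "length (core D L) < 2 ^ w" using length_core[of D L] L(3) by linarith
      then show ?case
        by (intro halts_Cons[OF halts_split_list[OF e2 out(3)]] halts_run_Cons halts_Nil)
          (use d in \<open>auto simp: elist_def\<close>)
    qed (use d in auto)
  qed
qed

end

lemma ends_below_core: "ends_below n L \<Longrightarrow> ends_below n (core D L)"
  using set_core by (force simp: ends_below_def)

text \<open>A round takes at most 60 steps per edge and leaves at most half of the edges. The factor
  \<open>122 = 2 * (60 + 1)\<close> absorbs the geometric sum together with the tests of the
  loop.\<close>

lemma halts_peel: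
  assumes "ends_below n L" "n < 2 ^ w" "length out + 2 * length L < 2 ^ w" "halving D L"
    and "env n m D s" "regs s 6 = length L" "elist s 9 10 L" "regs s 7 = length out" "elist s 11 12 out"
  shows "halts w (While (Less 3 6) peel_round) s (1 + 122 * length L)
    (\<lambda>s'. regs s' 7 = length (out @ orient D L) \<and> elist s' 11 12 (out @ orient D L))"
  using assms
proof (induction "length L" arbitrary: L s out rule: less_induct)
  case less
  have r: "test_holds (Less 3 6) s \<longleftrightarrow> L \<noteq> []" using less.prems by (auto simp: env_def)
  have c: "2 * length (core D L) \<le> length L" by (rule halvingD(1)[OF less.prems(4)])
  have L2: "2 * length L < 2 ^ w" using less.prems(3) by linarith
  show ?case
  proof (rule halts_While)
    assume "test_holds (Less 3 6) s"
    then have "L \<noteq> []" using r by simp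
    from halts_peel_round[OF less.prems(1,2) L2 less.prems(5-7) this less.prems(8,9,3)]
    show "halts w peel_round s (60 * length L)
       (\<lambda>s'. regs s' 6 = length (core D L) \<and> elist s' 9 10 (core D L) \<and>
       regs s' 7 = length (out @ arcs D L) \<and> elist s' 11 12 (out @ arcs D L))" .
  next
    fix s' assume "test_holds (Less 3 6) s" and f: "frame peel_round s s'" and
      Q: "regs s' 6 = length (core D L) \<and> elist s' 9 10 (core D L) \<and>
       regs s' 7 = length (out @ arcs D L) \<and> elist s' 11 12 (out @ arcs D L)"
    then have "L \<noteq> []" using r by simp
    then have l: "length (core D L) < length L" using c by (cases L) auto
    then have o: "orient D L = arcs D L @ orient D (core D L)" by (subst orient.simps) simp
    have b: "length (out @ arcs D L) + 2 * length (core D L) < 2 ^ w"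
      using length_arcs[of D L] less.prems(3) by simp
    have e: "env n m D s'" using f less.prems(5) by (auto simp: env_def frame_def)
    show "halts w (While (Less 3 6) peel_round) s' (1 + 122 * length (core D L))
      (\<lambda>s'. regs s' 7 = length (out @ orient D L) \<and> elist s' 11 12 (out @ orient D L))"
      unfolding o append_assoc[symmetric]
      by (rule less.hyps[OF l ends_below_core[OF less.prems(1)] less.prems(2) b halvingD(2)[OF less.prems(4)] e])
        (use Q in auto)
  next
    assume "\<not> test_holds (Less 3 6) s"
    then have "L = []" using r by simp
    then have "orient D L = []" by (subst orient.simps) (simp add: core_def)
    then show "regs s 7 = length (out @ orient D L) \<and> elist s 11 12 (out @ orient D L)"
      using less.prems by simp
  next
    assume "test_holds (Less 3 6) s"
    then have "length L > 0" using r by simp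
    then show "1 + 60 * length L + (1 + 122 * length (core D L)) \<le> 1 + 122 * length L"
      using c by linarith
  qed simp
qed

lemma halts_copy:
  assumes "ends_below n L" "n < 2 ^ w" "length L < 2 ^ w"
    and "env n m D s" "regs s l = length L" "elist s a b L" "l \<notin> {30, 11, 12}" "a \<notin> {c, d}" "b \<notin> {c, d}" "c \<noteq> d"
  shows "halts w (For 30 l (seqs [Load 11 a 30, Load 12 b 30, Store c 30 11, Store d 30 12])) s (2 + 7 * length L)
    (\<lambda>s'. elist s' c d L)"
proof (rule halts_mono[OF halts_For[where T = 5 and N = "length L" and U = "2 + 7 * length L"
      and I = "\<lambda>j s'. \<forall>i<j. arrays s' c i = fst (L ! i) \<and> arrays s' d i = snd (L ! i)"]], goal_cases)
  case (11 j s')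
  have 1: "arrays s' a j = fst (L ! j)" "arrays s' b j = snd (L ! j)"
    using 11(1,3) assms by (auto simp: frame_def elist_def)
  have 2: "fst (L ! j) < 2 ^ w" "snd (L ! j) < 2 ^ w"
    using ends_below_nth[OF assms(1) 11(1)] assms(2) by linarith+
  show ?case using 11(1,2,4) 1 2 assms(10) by (intro halts_run) (auto simp: less_Suc_eq)
qed (use assms in \<open>auto simp: env_def elist_def\<close>)

lemma halts_orient:
  assumes "ends_below n L" "n < 2 ^ w" "2 * length L < 2 ^ w" "halving D L"
    and "env n m D s" "regs s 5 = length L" "elist s 7 8 L"
  shows "halts w orient_prog s (10 + 130 * length L)
    (\<lambda>s'. regs s' 7 = length (orient D L) \<and> elist s' 11 12 (orient D L))"
  unfolding orient_prog_def
proof (rule halts_Cons[OF halts_copy[OF assms(1,2) _ assms(5-7)]], goal_cases)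
  case (7 s1)
  have e1: "env n m D s1" "regs s1 5 = length L" using 7(2) assms by (auto simp: env_def frame_def)
  let ?s2 = "run w (Const 7 0) (run w (Move 6 5) s1)"
  have e2: "env n m D ?s2" "regs ?s2 6 = length L" "elist ?s2 9 10 L" "regs ?s2 7 = length []" "elist ?s2 11 12 []"
    using e1 7(1) assms(3) by (auto simp: env_def elist_def)
  have l: "length [] + 2 * length L < 2 ^ w" using assms(3) by simp
  show ?case
    by (intro halts_run_Cons halts_Cons[OF halts_peel[OF assms(1,2) l assms(4) e2]] halts_Nil) auto
qed (use assms in auto)

section \<open>Choosing arcs, killing and contracting vertices\<close>

text \<open>The number \<open>r u\<close> is an index into the out-neighbours of \<open>u\<close>.
  An index out of range gives \<open>u\<close> itself, which stands for no pick at all.\<close>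

definition picked :: "(nat \<Rightarrow> nat) \<Rightarrow> (nat \<times> nat) list \<Rightarrow> nat \<Rightarrow> nat" where
  "picked r A u = (let vs = map snd (filter (\<lambda>e. fst e = u) A) in if r u < length vs then vs ! r u else u)"

lemma picked_Nil [simp]: "picked r [] u = u"
  by (simp add: picked_def)

lemma picked_snoc:
  "picked r (A @ [e]) u =
    (if fst e = u \<and> length (filter (\<lambda>e. fst e = u) A) = r u then snd e else picked r A u)"
  by (auto simp: picked_def Let_def nth_append)

lemma picked_mem: "picked r A u = u \<or> (u, picked r A u) \<in> set A"
proof -
  let ?F = "filter (\<lambda>e. fst e = u) A"
  have "(u, map snd ?F ! i) \<in> set A" if "i < length ?F" for i
  proof -
    have "?F ! i \<in> set ?F" using that by (rule nth_mem)
    then have "fst (?F ! i) = u" "?F ! i \<in> set A" by auto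
    then show ?thesis unfolding nth_map[OF that] by (metis prod.collapse)
  qed
  then show ?thesis by (auto simp: picked_def Let_def)
qed

lemma picked_less: "ends_below n A \<Longrightarrow> u < n \<Longrightarrow> picked r A u < n"
  using picked_mem[of r A u] by (auto simp: ends_below_def)

definition pick_prog :: "nat \<Rightarrow> prog" where
  "pick_prog a = seqs [For 30 0 (seqs [Store 4 30 30, Store 5 30 3]),
     For 30 7 (seqs [Load 11 11 30, Load 12 12 30, Load 13 5 11, Load 14 a 11,
       Cond (Equal 13 14) (Store 4 11 12) Skip, Add 13 13 2, Store 5 11 13])]"

lemma pick_prog_frame [simp]:
  "writes (pick_prog a) = {30, 11, 12, 13, 14}" "stores (pick_prog a) = {4, 5}" "flip_free (pick_prog a)"
  unfolding pick_prog_def by auto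

lemma halts_pick:
  assumes A: "ends_below n A" "n < 2 ^ w" "length A < 2 ^ w"
    and "env n m D s" "regs s 7 = length A" "elist s 11 12 A" "a > 50"
    and r: "\<And>u. u < n \<Longrightarrow> arrays s a u = r u" "\<And>u. u < n \<Longrightarrow> r u < 2 ^ w"
  shows "halts w (pick_prog a) s (5 + 5 * n + 11 * length A) (\<lambda>s'. \<forall>u<n. arrays s' 4 u = picked r A u)"
  unfolding pick_prog_def
proof (rule halts_Cons[OF halts_For[where T = 3 and N = n and U = "2 + 5 * n"
      and I = "\<lambda>j s'. \<forall>i<j. arrays s' 4 i = i \<and> arrays s' 5 i = 0"]], goal_cases)
  case (11 j s')
  have "regs s' 3 = 0" using 11(3) assms by (auto simp: frame_def env_def)
  then show ?case using 11(1,2,4) by (intro halts_run) (auto simp: less_Suc_eq)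
next
  case (14 s1)
  have 1: "env n m D s1" "regs s1 7 = length A" "elist s1 11 12 A" "\<And>u. u < n \<Longrightarrow> arrays s1 a u = r u"
    using 14(2) assms by (auto simp: frame_def env_def elist_def)
  let ?c = "\<lambda>j u. length (filter (\<lambda>e. fst e = u) (take j A))"
  show ?case
  proof (rule halts_Cons[OF halts_For[where T = 9 and N = "length A" and U = "2 + 11 * length A"
      and I = "\<lambda>j s'. \<forall>u<n. arrays s' 4 u = picked r (take j A) u \<and> arrays s' 5 u = ?c j u"]], goal_cases)
    case (11 j s')
    have 2: "arrays s' 11 j = fst (A ! j)" "arrays s' 12 j = snd (A ! j)" "regs s' 2 = 1"
      "\<And>u. u < n \<Longrightarrow> arrays s' a u = r u"
      using 11(1,3) 1 assms(7) by (auto simp: frame_def elist_def env_def)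
    have 3: "fst (A ! j) < n" "snd (A ! j) < n" using ends_below_nth[OF A(1) 11(1)] by auto
    then have 4: "fst (A ! j) < 2 ^ w" "snd (A ! j) < 2 ^ w" using A(2) by linarith+
    have "?c j u \<le> j" for u using length_filter_le[of "\<lambda>e. fst e = u" "take j A"] 11(1) by simp
    then have 5: "Suc (?c j u) < 2 ^ w" "?c j u < 2 ^ w" for u
      using A(3) 11(1) by (metis Suc_leI le_less_trans order_trans not_less_eq_eq, metis le_less_trans less_trans)
    have 6: "Suc (r u) < 2 ^ w" if "?c j u = r u" for u using 5(1)[of u] that by simp
    have P: "picked r (take (Suc j) A) u =
       (if fst (A ! j) = u \<and> ?c j u = r u then snd (A ! j) else picked r (take j A) u)" for u
      using 11(1) by (simp add: take_Suc_conv_app_nth picked_snoc)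
    have C: "?c (Suc j) u = ?c j u + of_bool (fst (A ! j) = u)" for u
      using 11(1) by (simp add: take_Suc_conv_app_nth)
    show ?case
      using 11(1,2,4) 2 3 4 5 6 r(2)
      by (intro halts_run) (auto simp: P C)
  next
    case 14
    show ?case using 14 by (intro halts_Nil) auto
  qed (use 1 14 A in \<open>auto simp: env_def\<close>)
qed (use assms in \<open>auto simp: env_def\<close>)

text \<open>Adjacency on the cycle of colours \<open>1, \<dots>, k\<close>; colour 0 marks discarded vertices.\<close>

definition cyc :: "nat \<Rightarrow> nat \<Rightarrow> nat \<Rightarrow> bool" where
  "cyc k a b \<longleftrightarrow> a + 1 = b \<or> b + 1 = a \<or> a = 1 \<and> b = k \<or> a = k \<and> b = 1"

definition bad :: "nat \<Rightarrow> nat \<Rightarrow> nat \<Rightarrow> bool" where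
  "bad k a b \<longleftrightarrow> a \<noteq> 0 \<and> b \<noteq> 0 \<and> \<not> cyc k a b"

text \<open>Arcs are handled in sequence with the colours current at that time, exactly as the
  program does. As colours only ever change to 0, an arc that has been handled stays harmless
  (\<open>kill_sound\<close>), and a vertex whose arcs are harmless at the outset is kept
  (\<open>kill_keep\<close>).\<close>

definition kill :: "nat \<Rightarrow> (nat \<Rightarrow> nat) \<Rightarrow> (nat \<times> nat) list \<Rightarrow> nat \<Rightarrow> nat" where
  "kill k = foldl (\<lambda>c e. if bad k (c (fst e)) (c (snd e)) then c(fst e := 0) else c)"

lemma kill_Nil [simp]: "kill k c [] = c"
  and kill_snoc: "kill k c (A @ [e]) =
    (if bad k (kill k c A (fst e)) (kill k c A (snd e)) then (kill k c A)(fst e := 0) else kill k c A)"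
  by (simp_all add: kill_def)

lemma kill_cases: "kill k c A u = c u \<or> kill k c A u = 0"
  by (induction A rule: rev_induct) (auto simp: kill_snoc)

lemma kill_le: "kill k c A u \<le> c u"
  using kill_cases[of k c A u] by auto

definition kill_prog :: "nat \<Rightarrow> prog" where
  "kill_prog k = seqs [Const 16 k, For 30 7 (seqs [Load 11 11 30, Load 12 12 30, Load 13 100 11, Load 14 100 12,
     Cond (Equal 13 3) Skip (Cond (Equal 14 3) Skip (seqs [Add 15 13 2, Cond (Equal 15 14) Skip
       (seqs [Add 15 14 2, Cond (Equal 15 13) Skip
         (Cond (Equal 13 2) (Cond (Equal 14 16) Skip (Store 100 11 3))
           (Cond (Equal 13 16) (Cond (Equal 14 2) Skip (Store 100 11 3)) (Store 100 11 3)))])]))])]"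

lemma kill_prog_frame [simp]:
  "writes (kill_prog k) = {30, 11, 12, 13, 14, 15, 16}" "stores (kill_prog k) = {100}" "flip_free (kill_prog k)"
  unfolding kill_prog_def by auto

lemma halts_kill:
  assumes A: "ends_below n A" "n < 2 ^ w" "length A < 2 ^ w" and k: "k > 1" "k + 1 < 2 ^ w"
    and "env n m D s" "regs s 7 = length A" "elist s 11 12 A"
    and c: "\<And>u. u < n \<Longrightarrow> arrays s 100 u = c u" "\<And>u. u < n \<Longrightarrow> c u \<le> k"
  shows "halts w (kill_prog k) s (5 + 30 * length A) (\<lambda>s'. \<forall>u<n. arrays s' 100 u = kill k c A u)"
  unfolding kill_prog_def
proof (rule halts_run_Cons, goal_cases)
  case 3
  let ?s = "run w (Const 16 k) s"
  show ?case
  proof (rule halts_Cons[OF halts_For[where T = 28 and N = "length A" and U = "2 + 30 * length A"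
      and I = "\<lambda>j s'. \<forall>u<n. arrays s' 100 u = kill k c (take j A) u"]], goal_cases)
    case (11 j s')
    have 2: "arrays s' 11 j = fst (A ! j)" "arrays s' 12 j = snd (A ! j)" "regs s' 2 = 1" "regs s' 3 = 0" "regs s' 16 = k"
      using 11(1,3) assms by (auto simp: frame_def elist_def env_def)
    have 3: "fst (A ! j) < n" "snd (A ! j) < n" using ends_below_nth[OF A(1) 11(1)] by auto
    then have 4: "fst (A ! j) < 2 ^ w" "snd (A ! j) < 2 ^ w" using A(2) by linarith+
    let ?K = "kill k c (take j A)"
    have 5: "?K u < 2 ^ w" "Suc (?K u) < 2 ^ w" if "u < n" for u
      using kill_le[of k c "take j A" u] c(2)[OF that] k by linarith+
    have P: "kill k c (take (Suc j) A) = (if bad k (?K (fst (A ! j))) (?K (snd (A ! j))) then ?K(fst (A ! j) := 0) else ?K)"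
      using 11(1) by (simp add: take_Suc_conv_app_nth kill_snoc)
    show ?case
      using 11(1,2,4) 2 3 4 5[OF 3(1)] 5[OF 3(2)] k
      by (intro halts_run) (auto simp: P bad_def cyc_def)
  next
    case 14
    show ?case using 14 by (intro halts_Nil) auto
  qed (use assms in \<open>auto simp: env_def\<close>)
qed auto

definition filter_prog :: prog where
  "filter_prog = seqs [Const 5 0, For 30 1 (seqs [Load 11 0 30, Load 12 1 30, Load 13 100 11, Load 14 100 12,
     Cond (Equal 13 3) Skip (Cond (Equal 14 3) Skip (seqs [Store 7 5 11, Store 8 5 12, Add 5 5 2]))])]"

lemma filter_prog_frame [simp]:
  "writes filter_prog = {30, 11, 12, 13, 14, 5}" "stores filter_prog = {7, 8}" "flip_free filter_prog"
  unfolding filter_prog_def by auto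

lemma halts_filter:
  assumes L: "ends_below n L" "n < 2 ^ w" "length L < 2 ^ w"
    and "env n (length L) D s" "elist s 0 1 L"
    and c: "\<And>u. u < n \<Longrightarrow> arrays s 100 u = c u" "\<And>u. u < n \<Longrightarrow> c u < 2 ^ w"
  shows "halts w filter_prog s (5 + 14 * length L)
    (\<lambda>s'. let L' = filter (\<lambda>e. c (fst e) \<noteq> 0 \<and> c (snd e) \<noteq> 0) L in regs s' 5 = length L' \<and> elist s' 7 8 L')"
  unfolding filter_prog_def
proof (rule halts_run_Cons, goal_cases)
  case 3
  let ?P = "\<lambda>e. c (fst e) \<noteq> 0 \<and> c (snd e) \<noteq> 0"
  define F where "F j = filter ?P (take j L)" for j
  show ?case
  proof (rule halts_Cons[OF halts_For[where T = 12 and N = "length L" and U = "2 + 14 * length L"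
      and I = "\<lambda>j s'. regs s' 5 = length (F j) \<and> elist s' 7 8 (F j)"]], goal_cases)
    case (11 j s')
    have 2: "arrays s' 0 j = fst (L ! j)" "arrays s' 1 j = snd (L ! j)" "regs s' 2 = 1" "regs s' 3 = 0"
      "\<And>u. u < n \<Longrightarrow> arrays s' 100 u = c u"
      using 11(1,3) assms by (auto simp: frame_def elist_def env_def)
    have 3: "fst (L ! j) < n" "snd (L ! j) < n" using ends_below_nth[OF L(1) 11(1)] by auto
    then have 4: "fst (L ! j) < 2 ^ w" "snd (L ! j) < 2 ^ w" using L(2) by linarith+
    have cj: "length (F j) \<le> j" unfolding F_def using length_filter_le[of ?P "take j L"] 11(1) by simp
    then have 5: "Suc (length (F j)) < 2 ^ w" using 11(1) L(3) by linarith
    have P: "F (Suc j) = F j @ (if ?P (L ! j) then [L ! j] else [])"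
      unfolding F_def using 11(1) by (simp add: take_Suc_conv_app_nth)
    show ?case
      using 11(1,2,4) 2 3 4 5 c(2)[OF 3(1)] c(2)[OF 3(2)]
      by (intro halts_run) (auto simp: P elist_def nth_append less_Suc_eq split: if_splits)
  next
    case 14
    show ?case using 14 by (intro halts_Nil) (auto simp: Let_def F_def)
  qed (use assms in \<open>auto simp: env_def elist_def F_def\<close>)
qed auto

section \<open>Contraction of an edge list without creating parallel edges\<close>

definition snoc_new :: "'a \<Rightarrow> 'a list \<Rightarrow> 'a list" where
  "snoc_new x xs = (if x \<in> set xs then xs else xs @ [x])"

lemma set_snoc_new [simp]: "set (snoc_new x xs) = insert x (set xs)"
  by (auto simp: snoc_new_def)

lemma length_snoc_new: "length (snoc_new x xs) \<le> Suc (length xs)"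
  by (simp add: snoc_new_def)

lemma distinct_snoc_new: "distinct xs \<Longrightarrow> distinct (snoc_new x xs)"
  by (simp add: snoc_new_def)

text \<open>Array 13 holds the multiples of \<open>n\<close>, so that cell \<open>x * n + y\<close> of a table can be addressed
  without multiplication.  Array 14 is never initialised: its entry for a pair is only trusted if the
  list does contain the pair at that position.\<close>

definition row_table :: "nat \<Rightarrow> state \<Rightarrow> bool" where
  "row_table n s \<longleftrightarrow> (\<forall>v<n. arrays s 13 v = v * n)"

definition indexed :: "nat \<Rightarrow> state \<Rightarrow> (nat \<times> nat) list \<Rightarrow> bool" where
  "indexed n s N \<longleftrightarrow> regs s 8 = length N \<and> elist s 15 16 N \<and> ends_below n N \<and>
     (\<forall>i<length N. arrays s 14 (fst (N ! i) * n + snd (N ! i)) = i)"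

lemma code_inj:
  assumes "x * n + y = x' * n + y'" "y < n" "y' < (n :: nat)"
  shows "x = x' \<and> y = y'"
proof -
  have "(x * n + y) mod n = (x' * n + y') mod n" "(x * n + y) div n = (x' * n + y') div n"
    using assms(1) by simp_all
  then show ?thesis using assms(2,3) by simp
qed

lemma code_less:
  assumes "x < n" "y < (n :: nat)"
  shows "x * n + y < n * n"
proof -
  have "Suc x * n \<le> n * n" using assms(1) by (intro mult_le_mono1) simp
  then show ?thesis using assms(2) by simp
qed

definition insert_prog :: prog where
  "insert_prog = seqs [Load 19 14 18, Const 20 0,
     Cond (Less 19 8) (seqs [Load 21 15 19,
       Cond (Equal 21 11) (seqs [Load 21 16 19, Cond (Equal 21 12) (Const 20 1) Skip]) Skip]) Skip,
     Cond (Equal 20 3) (seqs [Store 15 8 11, Store 16 8 12, Store 14 18 8, Add 8 8 2]) Skip]"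

lemma insert_prog_frame [simp]:
  "writes insert_prog = {19, 20, 21, 8}" "stores insert_prog = {14, 15, 16}" "flip_free insert_prog"
  "while_free insert_prog" "cost insert_prog = 17"
  unfolding insert_prog_def by auto

lemma run_insert:
  assumes N: "indexed n s N" "n < 2 ^ w" "Suc (length N) < 2 ^ w" and w: "w > 0"
    and s: "regs s 2 = 1" "regs s 3 = 0" "regs s 11 = x" "regs s 12 = y" "regs s 18 = x * n + y"
    and xy: "x < n" "y < n"
  shows "indexed n (run w insert_prog s) (snoc_new (x, y) N)"
proof (cases "(x, y) \<in> set N")
  case True
  then obtain i where i: "i < length N" "N ! i = (x, y)" by (auto simp: in_set_conv_nth)
  have "arrays s 14 (x * n + y) = i" "arrays s 15 i = x" "arrays s 16 i = y"
    using N(1) i by (auto simp: indexed_def elist_def)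
  moreover have "i < 2 ^ w" "x < 2 ^ w" "y < 2 ^ w" "1 < (2 :: nat) ^ w" using i xy N(2,3) w by auto
  ultimately show ?thesis
    using True i N(1) s w by (simp add: insert_prog_def snoc_new_def indexed_def elist_def)
next
  case False
  define p where "p = arrays s 14 (x * n + y) mod 2 ^ w"
  have lt: "fst (N ! i) < 2 ^ w" "snd (N ! i) < 2 ^ w" if "i < length N" for i
    using N(1,2) that ends_below_nth[of n N i] by (auto simp: indexed_def)
  have p: "\<not> (arrays s 15 p = x \<and> arrays s 16 p = y)" if "p < length N"
    using False N(1) that nth_mem[OF that] by (auto simp: indexed_def elist_def prod_eq_iff)
  have p': "arrays s 15 p mod 2 ^ w = arrays s 15 p" "arrays s 16 p mod 2 ^ w = arrays s 16 p" if "p < length N"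
    using N(1) lt[OF that] that by (auto simp: indexed_def elist_def)
  have new: "fst (N ! i) * n + snd (N ! i) \<noteq> x * n + y" if "i < length N" for i
    using code_inj[of "fst (N ! i)" n "snd (N ! i)" x y] ends_below_nth[of n N i] N(1) that xy(2) False nth_mem[OF that]
    by (auto simp: indexed_def prod_eq_iff)
  have r: "run w insert_prog s = run w (seqs [Store 15 8 11, Store 16 8 12, Store 14 18 8, Add 8 8 2])
      (run w (seqs [Load 19 14 18, Const 20 0,
     Cond (Less 19 8) (seqs [Load 21 15 19,
       Cond (Equal 21 11) (seqs [Load 21 16 19, Cond (Equal 21 12) (Const 20 1) Skip]) Skip]) Skip]) s)"
    using s p p' N(1) by (auto simp: insert_prog_def p_def[symmetric] indexed_def)
  show ?thesis
    unfolding r using s N False xy new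
    by (auto simp: snoc_new_def indexed_def elist_def nth_append less_Suc_eq ends_below_def)
qed

text \<open>The edge is turned so that an end of the vanishing colour \<open>m\<close> comes first.
  A vertex of colour \<open>m\<close> whose pick misses the class \<open>t\<close> simply disappears
  with its edges. A new edge always has its end of colour \<open>t\<close> first, so parallel new
  edges are equal as ordered pairs and \<open>snoc_new\<close> detects them.\<close>

definition merge_edge :: "(nat \<Rightarrow> nat) \<Rightarrow> (nat \<Rightarrow> nat) \<Rightarrow> nat \<Rightarrow> nat \<Rightarrow> nat \<Rightarrow> (nat \<times> nat) list \<Rightarrow> nat \<times> nat \<Rightarrow> (nat \<times> nat) list" where
  "merge_edge c pk m t p N e = (case if c (snd e) = m then prod.swap e else e of (u, v) \<Rightarrow>
     if c u = m then if c v = p \<and> c (pk u) = t then snoc_new (pk u, v) N else N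
     else snoc_new (u, v) N)"

definition merge :: "(nat \<Rightarrow> nat) \<Rightarrow> (nat \<Rightarrow> nat) \<Rightarrow> nat \<Rightarrow> nat \<Rightarrow> nat \<Rightarrow> (nat \<times> nat) list \<Rightarrow> (nat \<times> nat) list" where
  "merge c pk m t p = foldl (merge_edge c pk m t p) []"

lemma merge_Nil [simp]: "merge c pk m t p [] = []"
  and merge_snoc: "merge c pk m t p (L @ [e]) = merge_edge c pk m t p (merge c pk m t p L) e"
  by (simp_all add: merge_def)

text \<open>Deleting the middle vertex \<open>u\<close> of the path \<open>x u y\<close> produces the edge \<open>x y\<close>.\<close>

definition middle :: "(nat \<Rightarrow> nat) \<Rightarrow> (nat \<Rightarrow> nat) \<Rightarrow> nat \<Rightarrow> nat \<Rightarrow> nat \<Rightarrow> (nat \<times> nat) list \<Rightarrow> nat \<Rightarrow> nat \<Rightarrow> nat \<Rightarrow> bool" where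
  "middle c pk m t p L x y u \<longleftrightarrow> c u = m \<and> pk u = x \<and> c x = t \<and> c y = p \<and> ((u, y) \<in> set L \<or> (y, u) \<in> set L)"

lemma middle_append: "middle c pk m t p (L @ L') x y u \<longleftrightarrow> middle c pk m t p L x y u \<or> middle c pk m t p L' x y u"
  by (auto simp: middle_def)

text \<open>Because of \<open>m \<noteq> p\<close>, an edge between the classes \<open>m\<close> and
  \<open>p\<close> has exactly one end that can be the contracted one. This is why the test of a
  single orientation in \<open>merge_edge\<close> agrees with the unordered adjacency in
  \<open>middle\<close>.\<close>

lemma set_merge:
  assumes "m \<noteq> p"
  shows "set (merge c pk m t p L) =
    {e \<in> set L. c (fst e) \<noteq> m \<and> c (snd e) \<noteq> m} \<union> {(x, y) |x y. \<exists>u. middle c pk m t p L x y u}"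
proof (induction L rule: rev_induct)
  case Nil
  then show ?case by (auto simp: middle_def)
next
  case (snoc e L)
  obtain a b where e: "e = (a, b)" by fastforce
  obtain u v where uv: "(if c b = m then (b, a) else (a, b)) = (u, v)" by fastforce
  have mid: "middle c pk m t p [(a, b)] x y z \<longleftrightarrow>
      c u = m \<and> c v = p \<and> c (pk u) = t \<and> x = pk u \<and> y = v \<and> z = u" for x y z
    using uv assms by (auto simp: middle_def split: if_splits)
  have keep: "c a \<noteq> m \<and> c b \<noteq> m \<longleftrightarrow> c u \<noteq> m" "c u \<noteq> m \<Longrightarrow> (u, v) = (a, b)"
    using uv by (auto split: if_splits)
  have M: "merge c pk m t p (L @ [e]) = (if c u = m then if c v = p \<and> c (pk u) = t
      then snoc_new (pk u, v) (merge c pk m t p L) else merge c pk m t p L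
     else snoc_new (u, v) (merge c pk m t p L))"
    unfolding merge_snoc merge_edge_def e by (simp only: snd_conv swap_simp uv prod.case)
  have S: "set (merge c pk m t p (L @ [e])) = set (merge c pk m t p L) \<union>
     {e' \<in> {(a, b)}. c (fst e') \<noteq> m \<and> c (snd e') \<noteq> m} \<union> {(x, y) |x y. \<exists>z. middle c pk m t p [(a, b)] x y z}"
    unfolding M mid using keep by auto
  show ?case unfolding S snoc.IH middle_append unfolding e by auto
qed

lemma merge_edge_cases: "merge_edge c pk m t p N e = N \<or> (\<exists>x. merge_edge c pk m t p N e = snoc_new x N)"
proof -
  obtain u v where "(if c (snd e) = m then prod.swap e else e) = (u, v)" by fastforce
  then show ?thesis by (simp add: merge_edge_def) metis
qed

lemma length_merge: "length (merge c pk m t p L) \<le> length L"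
proof (induction L rule: rev_induct)
  case (snoc e L)
  from merge_edge_cases[of c pk m t p "merge c pk m t p L" e] show ?case
  proof (elim disjE exE)
    fix x assume "merge_edge c pk m t p (merge c pk m t p L) e = snoc_new x (merge c pk m t p L)"
    then show ?thesis
      using snoc.IH length_snoc_new[of x "merge c pk m t p L"] by (simp add: merge_snoc)
  qed (use snoc.IH in \<open>simp add: merge_snoc\<close>)
qed simp

lemma distinct_merge: "distinct (merge c pk m t p L)"
proof (induction L rule: rev_induct)
  case (snoc e L)
  then show ?case
    using merge_edge_cases[of c pk m t p "merge c pk m t p L" e] distinct_snoc_new
    unfolding merge_snoc by metis
qed simp

lemma ends_below_merge:
  assumes "ends_below n L" "\<And>u. u < n \<Longrightarrow> pk u < n" "m \<noteq> p"
  shows "ends_below n (merge c pk m t p L)"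
proof -
  have L: "a < n" "b < n" if "(a, b) \<in> set L" for a b using assms(1) that by (force simp: ends_below_def)+
  show ?thesis unfolding ends_below_def set_merge[OF assms(3)] middle_def using L assms(2) by auto
qed

definition fetch_edge :: "nat \<Rightarrow> prog" where
  "fetch_edge rm = seqs [Load 11 7 30, Load 12 8 30, Load 13 100 11, Load 14 100 12,
     Cond (Equal 14 rm) (seqs [Move 15 11, Move 11 12, Move 12 15, Move 15 13, Move 13 14, Move 14 15]) Skip]"

definition replace_edge :: "nat \<Rightarrow> nat \<Rightarrow> nat \<Rightarrow> nat \<Rightarrow> prog" where
  "replace_edge rm rt rp a = Cond (Equal 13 rm)
     (Cond (Equal 14 rp) (seqs [Load 16 4 11, Load 17 100 16,
        Cond (Equal 17 rt) (Seq (seqs [Load 18 13 16, Add 18 18 12, Store a 18 11, Move 11 16]) insert_prog) Skip]) Skip)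
     (Seq (seqs [Load 18 13 11, Add 18 18 12]) insert_prog)"

definition merge_body :: "nat \<Rightarrow> nat \<Rightarrow> nat \<Rightarrow> nat \<Rightarrow> prog" where
  "merge_body rm rt rp a = Seq (fetch_edge rm) (replace_edge rm rt rp a)"

definition merge_prog :: "nat \<Rightarrow> nat \<Rightarrow> nat \<Rightarrow> nat \<Rightarrow> prog" where
  "merge_prog rm rt rp a = seqs [Const 8 0, For 30 5 (merge_body rm rt rp a),
     For 30 8 (seqs [Load 11 15 30, Load 12 16 30, Store 7 30 11, Store 8 30 12]), Move 5 8]"

lemma merge_prog_frame [simp]:
  "writes (fetch_edge rm) = {11, 12, 13, 14, 15}" "stores (fetch_edge rm) = {}" "flip_free (fetch_edge rm)"
  "writes (replace_edge rm rt rp a) = {11, 16, 17, 18, 19, 20, 21, 8}"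
  "stores (replace_edge rm rt rp a) = {14, 15, 16, a}" "flip_free (replace_edge rm rt rp a)"
  "writes (merge_body rm rt rp a) = {11, 12, 13, 14, 15, 16, 17, 18, 19, 20, 21, 8}"
  "stores (merge_body rm rt rp a) = {14, 15, 16, a}" "flip_free (merge_body rm rt rp a)"
  "writes (merge_prog rm rt rp a) = {11, 12, 13, 14, 15, 16, 17, 18, 19, 20, 21, 8, 30, 5}"
  "stores (merge_prog rm rt rp a) = {14, 15, 16, a, 7, 8}" "flip_free (merge_prog rm rt rp a)"
  "while_free (merge_body rm rt rp a)" "cost (merge_body rm rt rp a) \<le> 45"
  unfolding merge_prog_def merge_body_def fetch_edge_def replace_edge_def by (simp_all add: insert_commute)

lemma run_fetch_edge:
  assumes "arrays s 7 (regs s 30) = x" "arrays s 8 (regs s 30) = y" "x < 2 ^ w" "y < 2 ^ w"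
    and "arrays s 100 x = c x" "arrays s 100 y = c y" "c x < 2 ^ w" "c y < 2 ^ w"
    and "regs s rm = m" "rm > 50"
    and "(if c y = m then (y, x) else (x, y)) = (u, v)"
  shows "regs (run w (fetch_edge rm) s) 11 = u" "regs (run w (fetch_edge rm) s) 12 = v"
    "regs (run w (fetch_edge rm) s) 13 = c u" "regs (run w (fetch_edge rm) s) 14 = c v"
  using assms by (auto simp: fetch_edge_def split: if_splits)

lemma run_loop_free_frame: "while_free p \<Longrightarrow> frame p s (run w p s)"
  using exec_run exec_frame by blast

lemma run_replace_edge:
  assumes s: "regs s 11 = u" "regs s 12 = v" "regs s 13 = c u" "regs s 14 = c v" "regs s 2 = 1" "regs s 3 = 0"
    "row_table n s" "\<And>u. u < n \<Longrightarrow> arrays s 100 u = c u" "\<And>u. u < n \<Longrightarrow> arrays s 4 u = pk u"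
    "regs s rm = m" "regs s rt = t" "regs s rp = p"
    and regs: "rm > 50" "rt > 50" "rp > 50" "a > 50" "a \<noteq> 100"
    and bounds: "u < n" "v < n" "pk u < n" "c (pk u) < 2 ^ w" "n * n < 2 ^ w" "n < 2 ^ w" "w > 0" "Suc (length N) < 2 ^ w"
    and N: "indexed n s N"
  defines "s' \<equiv> run w (replace_edge rm rt rp a) s"
  shows "indexed n s' (if c u = m then if c v = p \<and> c (pk u) = t then snoc_new (pk u, v) N else N else snoc_new (u, v) N)"
    and "arrays s' a = (if c u = m \<and> c v = p \<and> c (pk u) = t then (arrays s a)(pk u * n + v := u) else arrays s a)"
proof -
  have row: "arrays s 13 x = x * n" if "x < n" for x using s(7) that by (simp add: row_table_def)
  have lt: "x * n + v < 2 ^ w" "x * n < 2 ^ w" "x < 2 ^ w" if "x < n" for x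
    using code_less[OF that bounds(2)] bounds(5,6) that by linarith+
  have frame_a: "arrays (run w insert_prog s1) a = arrays s1 a" for s1
    using run_loop_free_frame[of insert_prog s1 w] regs by (auto simp: frame_def)
  have "indexed n s' (if c u = m then if c v = p \<and> c (pk u) = t then snoc_new (pk u, v) N else N else snoc_new (u, v) N) \<and>
    arrays s' a = (if c u = m \<and> c v = p \<and> c (pk u) = t then (arrays s a)(pk u * n + v := u) else arrays s a)"
  proof (cases "c u = m")
    case False
    let ?s = "run w (seqs [Load 18 13 11, Add 18 18 12]) s"
    have r: "s' = run w insert_prog ?s" using False s by (simp add: s'_def replace_edge_def)
    have "indexed n ?s N" using N by (simp add: indexed_def elist_def)
    then have "indexed n s' (snoc_new (u, v) N)"
      unfolding r using s lt[OF bounds(1)] bounds by (intro run_insert) (auto simp: row[OF bounds(1)])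
    moreover have "arrays s' a = arrays s a" unfolding r frame_a by simp
    ultimately show ?thesis using False by simp
  next
    case True
    show ?thesis
    proof (cases "c v = p \<and> c (pk u) = t")
      case True
      let ?s = "run w (seqs [Load 16 4 11, Load 17 100 16, Load 18 13 16, Add 18 18 12, Store a 18 11, Move 11 16]) s"
      have r: "s' = run w insert_prog ?s"
        using True \<open>c u = m\<close> s regs bounds lt[OF bounds(3)] by (simp add: s'_def replace_edge_def)
      have "indexed n ?s N" using N regs by (simp add: indexed_def elist_def)
      then have "indexed n s' (snoc_new (pk u, v) N)"
        unfolding r using s regs lt[OF bounds(3)] bounds by (intro run_insert) (auto simp: row[OF bounds(3)])
      moreover have "arrays s' a = (arrays s a)(pk u * n + v := u)"
        unfolding r frame_a using s regs lt[OF bounds(3)] bounds by (simp add: row[OF bounds(3)])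
      ultimately show ?thesis using True \<open>c u = m\<close> by simp
    next
      case False
      let ?s = "if c v = p then run w (seqs [Load 16 4 11, Load 17 100 16]) s else s"
      have r: "s' = ?s"
        using False True s regs bounds lt[OF bounds(3)] by (auto simp: s'_def replace_edge_def)
      have "indexed n ?s N" using N by (simp add: indexed_def elist_def)
      then show ?thesis using False True r by simp
    qed
  qed
  then show "indexed n s' (if c u = m then if c v = p \<and> c (pk u) = t then snoc_new (pk u, v) N else N else snoc_new (u, v) N)"
    and "arrays s' a = (if c u = m \<and> c v = p \<and> c (pk u) = t then (arrays s a)(pk u * n + v := u) else arrays s a)"
    by blast+
qed

text \<open>The cell of array \<open>a\<close> for a new edge remembers a vertex whose contraction
  produced it. Several vertices may produce the same edge and overwrite the cell, but each of them
  serves equally well for lifting a cycle, so only membership in \<open>middle\<close> is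
  asserted.\<close>

lemma halts_merge:
  assumes L: "ends_below n L" "n < 2 ^ w" "n * n < 2 ^ w" "length L + 1 < 2 ^ w"
    and s: "env n e D s" "regs s 5 = length L" "elist s 7 8 L" "row_table n s"
      "\<And>u. u < n \<Longrightarrow> arrays s 100 u = c u" "\<And>u. u < n \<Longrightarrow> arrays s 4 u = pk u"
      "regs s rm = m" "regs s rt = t" "regs s rp = p"
    and regs: "rm > 50" "rt > 50" "rp > 50" "a > 50" "a \<noteq> 100"
    and c: "\<And>u. u < n \<Longrightarrow> c u < 2 ^ w" "\<And>u. u < n \<Longrightarrow> pk u < n" and "m \<noteq> p"
  defines "M \<equiv> merge c pk m t p L"
  shows "halts w (merge_prog rm rt rp a) s (10 + 60 * length L)
    (\<lambda>s'. regs s' 5 = length M \<and> elist s' 7 8 M \<and>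
      (\<forall>x y u. middle c pk m t p L x y u \<longrightarrow> middle c pk m t p L x y (arrays s' a (x * n + y))))"
  unfolding merge_prog_def
proof (rule halts_run_Cons, goal_cases)
  case 3
  define mg where "mg j = merge c pk m t p (take j L)" for j
  define I where "I j s' \<longleftrightarrow> indexed n s' (mg j) \<and>
     (\<forall>x y u. middle c pk m t p (take j L) x y u \<longrightarrow> middle c pk m t p (take j L) x y (arrays s' a (x * n + y)))"
    for j and s' :: state
  have w: "w > 0" using L(4) by (cases w) auto
  show ?case
  proof (rule halts_Cons[OF halts_For[where T = 45 and N = "length L" and U = "2 + 47 * length L" and I = I]], goal_cases)
    case (11 j s')
    have 1: "env n e D s'" "elist s' 7 8 L" "row_table n s'"
      "\<And>u. u < n \<Longrightarrow> arrays s' 100 u = c u" "\<And>u. u < n \<Longrightarrow> arrays s' 4 u = pk u"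
      "regs s' rm = m" "regs s' rt = t" "regs s' rp = p"
      using 11(3) s regs by (auto simp: frame_def env_def elist_def row_table_def)
    have 3: "fst (L ! j) < n" "snd (L ! j) < n" using ends_below_nth[OF L(1) 11(1)] by auto
    have 4: "arrays s' 7 (regs s' 30) = fst (L ! j)" "arrays s' 8 (regs s' 30) = snd (L ! j)"
      using 1(2) 11(1,4) by (auto simp: elist_def)
    obtain u v where uv: "(if c (snd (L ! j)) = m then (snd (L ! j), fst (L ! j)) else (fst (L ! j), snd (L ! j))) = (u, v)"
      by fastforce
    let ?s = "run w (fetch_edge rm) s'"
    have 5: "regs ?s 11 = u" "regs ?s 12 = v" "regs ?s 13 = c u" "regs ?s 14 = c v"
      using run_fetch_edge[where c = c, OF 4 less_trans[OF 3(1) L(2)] less_trans[OF 3(2) L(2)] 1(4)[OF 3(1)] 1(4)[OF 3(2)]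
        c(1)[OF 3(1)] c(1)[OF 3(2)] 1(6) regs(1) uv] by blast+
    have "frame (fetch_edge rm) s' ?s" by (rule run_loop_free_frame) (simp add: fetch_edge_def)
    then have 6: "regs ?s 2 = 1" "regs ?s 3 = 0" "row_table n ?s" "\<And>u. u < n \<Longrightarrow> arrays ?s 100 u = c u"
      "\<And>u. u < n \<Longrightarrow> arrays ?s 4 u = pk u" "regs ?s rm = m" "regs ?s rt = t" "regs ?s rp = p"
      "arrays ?s a = arrays s' a" "indexed n ?s (mg j)"
      using 1 regs 11(2) by (auto simp: frame_def env_def row_table_def I_def indexed_def elist_def)
    have uvn: "u < n" "v < n" using uv 3 by (auto split: if_splits)
    have "length (mg j) \<le> j" unfolding mg_def using length_merge[of c pk m t p "take j L"] 11(1) by simp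
    then have lm: "Suc (length (mg j)) < 2 ^ w" using 11(1) L(4) by linarith
    have R: "indexed n (run w (replace_edge rm rt rp a) ?s)
        (if c u = m then if c v = p \<and> c (pk u) = t then snoc_new (pk u, v) (mg j) else mg j else snoc_new (u, v) (mg j))"
      "arrays (run w (replace_edge rm rt rp a) ?s) a =
        (if c u = m \<and> c v = p \<and> c (pk u) = t then (arrays ?s a)(pk u * n + v := u) else arrays ?s a)"
      using run_replace_edge(1)[where c = c and pk = pk, OF 5 6(1-8) regs uvn c(2)[OF uvn(1)] c(1)[OF c(2)[OF uvn(1)]] L(3,2) w lm 6(10)] run_replace_edge(2)[where c = c and pk = pk, OF 5 6(1-8) regs uvn c(2)[OF uvn(1)] c(1)[OF c(2)[OF uvn(1)]] L(3,2) w lm 6(10)] by simp_all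
    have T: "take (Suc j) L = take j L @ [L ! j]" using 11(1) by (simp add: take_Suc_conv_app_nth)
    obtain a0 b0 where ab: "L ! j = (a0, b0)" by fastforce
    have uv': "(if c b0 = m then (b0, a0) else (a0, b0)) = (u, v)" using uv by (simp only: ab fst_conv snd_conv)
    have mgS: "mg (Suc j) = (if c u = m then if c v = p \<and> c (pk u) = t then snoc_new (pk u, v) (mg j) else mg j else snoc_new (u, v) (mg j))"
      unfolding mg_def T merge_snoc merge_edge_def ab by (simp only: swap_simp snd_conv uv' prod.case)
    have midS: "middle c pk m t p (take (Suc j) L) x y z \<longleftrightarrow> middle c pk m t p (take j L) x y z \<or>
        (c u = m \<and> c v = p \<and> c (pk u) = t \<and> x = pk u \<and> y = v \<and> z = u)" for x y z
      unfolding T middle_append ab using uv' \<open>m \<noteq> p\<close> by (auto simp: middle_def split: if_splits)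
    have "I (Suc j) (run w (merge_body rm rt rp a) s')"
    proof -
      let ?s' = "run w (merge_body rm rt rp a) s'"
      have r: "?s' = run w (replace_edge rm rt rp a) ?s" by (simp add: merge_body_def)
      have "middle c pk m t p (take (Suc j) L) x y (arrays ?s' a (x * n + y))"
        if mid: "middle c pk m t p (take (Suc j) L) x y z" for x y z
      proof (cases "c u = m \<and> c v = p \<and> c (pk u) = t \<and> x = pk u \<and> y = v")
        case True
        then have "arrays ?s' a (x * n + y) = u" unfolding r R(2) by simp
        then show ?thesis unfolding midS using True by simp
      next
        case False
        then have m1: "middle c pk m t p (take j L) x y z" using mid midS by blast
        then have "(z, y) \<in> set L \<or> (y, z) \<in> set L" unfolding middle_def using in_set_takeD by metis
        then have "y < n" using L(1) unfolding ends_below_def by force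
        then have eq: "arrays ?s' a (x * n + y) = arrays s' a (x * n + y)"
          unfolding r R(2) 6(9) using False code_inj[of x n y "pk u" v] uvn(2) by auto
        have "middle c pk m t p (take j L) x y (arrays s' a (x * n + y))"
          using m1 11(2) unfolding I_def by blast
        then show ?thesis unfolding eq midS by (rule disjI1)
      qed
      moreover have "indexed n ?s' (mg (Suc j))" unfolding r mgS by (rule R(1))
      ultimately show ?thesis unfolding I_def by blast
    qed
    then show ?case by (intro halts_run) auto
  next
    case (14 s1)
    have M: "mg (length L) = M" by (simp add: mg_def M_def)
    have 1: "env n e D s1" using 14(2) s by (auto simp: frame_def env_def)
    have 2: "elist s1 15 16 M" "regs s1 8 = length M" "ends_below n M"
      using 14(1) M by (auto simp: I_def indexed_def)
    have lM: "length M \<le> length L" unfolding M_def by (rule length_merge)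
    then have 3: "length M < 2 ^ w" using L(4) by linarith
    show ?case
    proof (rule halts_Cons[OF halts_copy[OF 2(3) L(2) 3 1 2(2,1)]], goal_cases)
      case (6 s2)
      have "arrays s2 a = arrays s1 a" "regs s2 8 = length M" using 6(2) regs 2 by (auto simp: frame_def)
      then show ?case
        using 14(1) 6(1) lM 3 by (intro halts_run_Cons halts_Nil) (auto simp: I_def elist_def)
    qed (use lM in auto)
  qed (use s regs L in \<open>auto simp: env_def I_def mg_def indexed_def elist_def ends_below_def middle_def\<close>)
qed auto

section \<open>Detection, recovery and sampling\<close>

text \<open>Each vertex has a single pick, yet three edges must be certified. One is enumerated as
  the arc from \<open>p\<close> to \<open>q\<close>, the second is the pick \<open>z\<close> of
  \<open>q\<close>, and the third is the pick of whichever of \<open>p\<close> and \<open>z\<close>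
  is the tail of the remaining arc.\<close>

definition triangle :: "(nat \<Rightarrow> nat) \<Rightarrow> (nat \<Rightarrow> nat) \<Rightarrow> nat \<times> nat \<Rightarrow> bool" where
  "triangle c pk e \<longleftrightarrow> (let z = pk (snd e) in c z \<noteq> c (fst e) \<and> c z \<noteq> c (snd e) \<and> (pk (fst e) = z \<or> pk z = fst e))"

definition triangle_prog :: prog where
  "triangle_prog = seqs [Const 9 0, For 30 7 (seqs [Load 11 11 30, Load 12 12 30, Load 16 4 12,
     Load 13 100 11, Load 14 100 12, Load 17 100 16, Load 18 4 11, Load 19 4 16,
     Cond (Equal 17 13) Skip (Cond (Equal 17 14) Skip
       (Cond (Equal 18 16) (seqs [Store 2 13 11, Store 2 14 12, Store 2 17 16, Const 9 1])
         (Cond (Equal 19 11) (seqs [Store 2 13 11, Store 2 14 12, Store 2 17 16, Const 9 1]) Skip)))])]"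

lemma triangle_prog_frame [simp]:
  "writes triangle_prog = {30, 11, 12, 16, 13, 14, 17, 18, 19, 9}" "stores triangle_prog = {2}" "flip_free triangle_prog"
  unfolding triangle_prog_def by auto

text \<open>Here \<open>S\<close> is the content of the output array, indexed by colours: the cycle
  is kept as a map from colours to vertices, which recovery extends colour by colour.\<close>

definition holds_triangle :: "(nat \<Rightarrow> nat) \<Rightarrow> (nat \<Rightarrow> nat) \<Rightarrow> (nat \<Rightarrow> nat) \<Rightarrow> nat \<times> nat \<Rightarrow> bool" where
  "holds_triangle c pk S e \<longleftrightarrow> triangle c pk e \<and> S (c (fst e)) = fst e \<and> S (c (snd e)) = snd e \<and> S (c (pk (snd e))) = pk (snd e)"

lemma halts_triangle:
  assumes A: "ends_below n A" "n < 2 ^ w" "length A < 2 ^ w" and w: "w > 0"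
    and s: "env n m D s" "regs s 7 = length A" "elist s 11 12 A"
      "\<And>u. u < n \<Longrightarrow> arrays s 100 u = c u" "\<And>u. u < n \<Longrightarrow> arrays s 4 u = pk u"
    and c: "\<And>u. u < n \<Longrightarrow> c u < 2 ^ w" "\<And>u. u < n \<Longrightarrow> pk u < n" "\<And>e. e \<in> set A \<Longrightarrow> c (fst e) \<noteq> c (snd e)"
  shows "halts w triangle_prog s (5 + 22 * length A) (\<lambda>s'.
    regs s' 9 = of_bool (\<exists>e\<in>set A. triangle c pk e) \<and>
    ((\<exists>e\<in>set A. triangle c pk e) \<longrightarrow> (\<exists>e\<in>set A. holds_triangle c pk (arrays s' 2) e)))"
  unfolding triangle_prog_def
proof (rule halts_run_Cons, goal_cases)
  case 3
  define I where "I j s' \<longleftrightarrow> regs s' 9 = of_bool (\<exists>e\<in>set (take j A). triangle c pk e) \<and>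
    ((\<exists>e\<in>set (take j A). triangle c pk e) \<longrightarrow> (\<exists>e\<in>set (take j A). holds_triangle c pk (arrays s' 2) e))"
    for j and s' :: state
  show ?case
  proof (rule halts_Cons[OF halts_For[where T = 20 and N = "length A" and U = "2 + 22 * length A" and I = I]], goal_cases)
    case (11 j s')
    have 2: "arrays s' 11 j = fst (A ! j)" "arrays s' 12 j = snd (A ! j)"
      "\<And>u. u < n \<Longrightarrow> arrays s' 100 u = c u" "\<And>u. u < n \<Longrightarrow> arrays s' 4 u = pk u"
      using 11(1,3) s by (auto simp: frame_def elist_def env_def)
    define p where "p = fst (A ! j)"
    define q where "q = snd (A ! j)"
    have pq: "p < n" "q < n" "c p \<noteq> c q" unfolding p_def q_def using ends_below_nth[OF A(1) 11(1)] c(3) 11(1) by auto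
    have lt: "x < 2 ^ w" "c x < 2 ^ w" if "x < n" for x using that A(2) c(1) by auto
    have T: "set (take (Suc j) A) = insert (p, q) (set (take j A))"
      using 11(1) by (auto simp: take_Suc_conv_app_nth p_def q_def)
    let ?b = "seqs [Load 11 11 30, Load 12 12 30, Load 16 4 12,
     Load 13 100 11, Load 14 100 12, Load 17 100 16, Load 18 4 11, Load 19 4 16,
     Cond (Equal 17 13) Skip (Cond (Equal 17 14) Skip
       (Cond (Equal 18 16) (seqs [Store 2 13 11, Store 2 14 12, Store 2 17 16, Const 9 1])
         (Cond (Equal 19 11) (seqs [Store 2 13 11, Store 2 14 12, Store 2 17 16, Const 9 1]) Skip)))]"
    note facts = 2(1,2)[folded p_def q_def] 2(3)[OF pq(1)] 2(3)[OF pq(2)] 2(4)[OF pq(1)] 2(4)[OF pq(2)]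
      2(3)[OF c(2)[OF pq(2)]] 2(4)[OF c(2)[OF pq(2)]] lt[OF pq(1)] lt[OF pq(2)] lt[OF c(2)[OF pq(2)]] lt[OF c(2)[OF pq(1)]]
      lt[OF c(2)[OF c(2)[OF pq(2)]]] 11(4)
    have "I (Suc j) (run w ?b s')"
    proof (cases "triangle c pk (p, q)")
      case True
      then have "regs (run w ?b s') 9 = 1" "holds_triangle c pk (arrays (run w ?b s') 2) (p, q)"
        using w pq(3) facts by (auto simp: triangle_def holds_triangle_def Let_def)
      then show ?thesis unfolding I_def T using True by auto
    next
      case False
      then have "regs (run w ?b s') 9 = regs s' 9" "arrays (run w ?b s') 2 = arrays s' 2"
        using facts by (auto simp: triangle_def Let_def)
      moreover have "\<not> holds_triangle c pk S (p, q)" for S using False by (simp add: holds_triangle_def)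
      ultimately show ?thesis using 11(2) False unfolding I_def T by auto
    qed
    then show ?case by (intro halts_run) auto
  next
    case 14
    show ?case using 14 by (intro halts_Nil) (auto simp: I_def)
  qed (use s A in \<open>auto simp: env_def I_def\<close>)
qed auto

section \<open>Recovery of the contracted vertices, and sampling\<close>

definition recover_step :: "nat \<Rightarrow> prog" where
  "recover_step i = seqs [Load 11 2 (101 + 3 * i), Load 12 2 (102 + 3 * i), Load 13 13 11, Add 13 13 12,
     Load 14 (101 + 2 * i) 13, Store 2 (100 + 3 * i) 14]"

text \<open>Stages are undone from the last to the first: the vertices of the two colours consulted
  in stage \<open>i\<close> may themselves have been restored from later stages.\<close>

primrec recover_prog :: "nat \<Rightarrow> prog" where
  "recover_prog 0 = Skip"
| "recover_prog (Suc i) = Seq (recover_step i) (recover_prog i)"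

lemma recover_prog_frame [simp]:
  "writes (recover_step i) = {11, 12, 13, 14}" "stores (recover_step i) = {2}" "flip_free (recover_step i)"
  "while_free (recover_step i)" "cost (recover_step i) = 7"
  by (auto simp: recover_step_def)

lemma recover_prog_frame' [simp]:
  "r \<noteq> 11 \<Longrightarrow> r \<noteq> 12 \<Longrightarrow> r \<noteq> 13 \<Longrightarrow> r \<noteq> 14 \<Longrightarrow> r \<notin> writes (recover_prog i)"
  "a \<noteq> 2 \<Longrightarrow> a \<notin> stores (recover_prog i)" "flip_free (recover_prog i)"
  "while_free (recover_prog i)" "cost (recover_prog i) = 7 * i + 1"
  by (induction i) auto

text \<open>The predicate \<open>P i\<close> says what the map from colours to vertices satisfies
  before stage \<open>i\<close>. It is instantiated with \<open>coloured_cycle X\<close>, and its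
  backward step with \<open>coloured_cycle_backward\<close>.\<close>

lemma run_recover:
  assumes s: "row_table n s" "\<And>i. i < j \<Longrightarrow> regs s (100 + 3 * i) = m i \<and> regs s (101 + 3 * i) = t i \<and> regs s (102 + 3 * i) = p i"
    "\<And>i. i < j \<Longrightarrow> arrays s (101 + 2 * i) = mid i"
    and P: "\<And>i S. i < j \<Longrightarrow> P (Suc i) S \<Longrightarrow> S (t i) < n \<and> S (p i) < n \<and> mid i (S (t i) * n + S (p i)) < n \<and>
      P i (S(m i := mid i (S (t i) * n + S (p i))))"
    and w: "n < 2 ^ w" "n * n < 2 ^ w" and "P j (arrays s 2)"
  shows "P 0 (arrays (run w (recover_prog j) s) 2)"
  using s P \<open>P j (arrays s 2)\<close>
proof (induction j arbitrary: s)
  case (Suc j)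
  let ?s = "run w (recover_step j) s"
  let ?S = "arrays s 2"
  have f: "frame (recover_step j) s ?s" by (rule run_loop_free_frame) simp
  have 1: "?S (t j) < n" "?S (p j) < n" "mid j (?S (t j) * n + ?S (p j)) < n"
    "P j (?S(m j := mid j (?S (t j) * n + ?S (p j))))"
    using Suc.prems(4)[OF lessI Suc.prems(5)] by blast+
  have 2: "?S (t j) * n < 2 ^ w" "?S (t j) * n + ?S (p j) < 2 ^ w" "?S (t j) < 2 ^ w" "?S (p j) < 2 ^ w"
    "mid j (?S (t j) * n + ?S (p j)) < 2 ^ w"
    using code_less[OF 1(1,2)] w 1 by linarith+
  have 3: "arrays s 13 (?S (t j)) = ?S (t j) * n" using Suc.prems(1) 1(1) by (simp add: row_table_def)
  have 4: "regs s (100 + 3 * j) = m j" "regs s (101 + 3 * j) = t j" "regs s (102 + 3 * j) = p j" "arrays s (101 + 2 * j) = mid j"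
    using Suc.prems(2,3)[of j] by auto
  have "arrays ?s 2 = ?S(m j := mid j (?S (t j) * n + ?S (p j)))"
    using 2 3 4 by (simp add: recover_step_def)
  then have "P j (arrays ?s 2)" using 1(4) by simp
  moreover have "row_table n ?s" using Suc.prems(1) f by (simp add: row_table_def frame_def)
  moreover have "regs ?s (100 + 3 * i) = m i \<and> regs ?s (101 + 3 * i) = t i \<and> regs ?s (102 + 3 * i) = p i"
    "arrays ?s (101 + 2 * i) = mid i" if "i < j" for i
    using f Suc.prems(2,3)[of i] that by (auto simp: frame_def)
  ultimately show ?case using Suc.IH[of ?s] Suc.prems(4) by (simp add: less_SucI)
qed simp

text \<open>Reads \<open>q\<close> flips; every value between 0 and \<open>q\<close> is the index of the last success for some
  outcome.  Values above \<open>cap\<close> are replaced by 0.\<close>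

primrec last_success :: "nat \<Rightarrow> nat \<Rightarrow> bool stream \<Rightarrow> nat" where
  "last_success cap 0 \<omega> = 0"
| "last_success cap (Suc q) \<omega> = (if \<omega> !! q then (if Suc q \<le> cap then Suc q else 0) else last_success cap q \<omega>)"

lemma last_success_le: "last_success cap q \<omega> \<le> cap"
  by (induction q) auto

primrec draw :: "nat \<Rightarrow> nat \<Rightarrow> prog" where
  "draw cap 0 = Const 11 0"
| "draw cap (Suc q) = Seq (draw cap q) (seqs [Flip 12, Cond (Equal 12 2) (Const 11 (if Suc q \<le> cap then Suc q else 0)) Skip])"

lemma draw_frame [simp]:
  "r \<noteq> 11 \<Longrightarrow> r \<noteq> 12 \<Longrightarrow> r \<notin> writes (draw cap q)" "stores (draw cap q) = {}" "while_free (draw cap q)" "cost (draw cap q) = 1 + 4 * q"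
  by (induction q) auto

lemma run_draw:
  assumes "regs s 2 = 1" "cap < 2 ^ w" "w > 0"
  shows "regs (run w (draw cap q) s) 11 = last_success cap q (tape s) \<and> tape (run w (draw cap q) s) = sdrop q (tape s) \<and>
    regs (run w (draw cap q) s) 2 = 1"
proof (induction q)
  case (Suc q)
  have "(1 :: nat) mod 2 ^ w = 1" using assms(3) by (cases w) auto
  then show ?case using Suc assms by (auto simp: sdrop_simps)
qed (use assms in simp)

text \<open>The register 13 makes the loop run up to \<open>n\<close> inclusive. The index
  \<open>n\<close> is no vertex; in a stage its sample decides which of the last two colours
  disappears.\<close>

definition fill :: "nat \<Rightarrow> nat \<Rightarrow> nat \<Rightarrow> prog" where
  "fill a cap q = seqs [Add 13 0 2, For 30 13 (Seq (draw cap q) (Store a 30 11))]"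

lemma fill_frame [simp]:
  "r \<noteq> 11 \<Longrightarrow> r \<noteq> 12 \<Longrightarrow> r \<noteq> 13 \<Longrightarrow> r \<noteq> 30 \<Longrightarrow> r \<notin> writes (fill a cap q)"
  "stores (fill a cap q) = {a}"
  unfolding fill_def by auto

lemma halts_fill:
  assumes "env n m D s" "cap < 2 ^ w" "w > 0" "n + 1 < 2 ^ w"
  shows "halts w (fill a cap q) s (10 + (n + 1) * (5 + 4 * q)) (\<lambda>s'.
    (\<forall>v\<le>n. arrays s' a v = last_success cap q (sdrop (v * q) (tape s))) \<and> tape s' = sdrop ((n + 1) * q) (tape s))"
  unfolding fill_def
proof (rule halts_run_Cons, goal_cases)
  case 3
  let ?s = "run w (Add 13 0 2) s"
  define I where "I j s' \<longleftrightarrow> (\<forall>v<j. arrays s' a v = last_success cap q (sdrop (v * q) (tape s))) \<and> tape s' = sdrop (j * q) (tape s)"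
    for j and s' :: state
  show ?case
  proof (rule halts_Cons[OF halts_For[where T = "2 + 4 * q" and N = "n + 1" and U = "2 + (n + 1) * (4 + 4 * q)" and I = I]], goal_cases)
    case (11 j s')
    have r: "regs s' 2 = 1" using 11(3) assms by (auto simp: frame_def env_def)
    have f: "frame (draw cap q) s' (run w (draw cap q) s')" by (rule run_loop_free_frame) simp
    then have "regs (run w (draw cap q) s') 30 = j" "arrays (run w (draw cap q) s') = arrays s'"
      using 11(4) by (auto simp: frame_def)
    moreover have "tape (run w (draw cap q) s') = sdrop (j * q + q) (tape s)"
      using run_draw[OF r assms(2,3), of q] 11(2) by (simp add: I_def sdrop_add)
    ultimately show ?case
      using run_draw[OF r assms(2,3), of q] 11(2)
      by (intro halts_run) (auto simp: I_def less_Suc_eq add.commute)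
  next
    case (14 s')
    have "(n + 1) * (4 + 4 * q) \<le> (n + 1) * (5 + 4 * q)" by (intro mult_le_mono2) simp
    then have "1 \<le> 10 + (n + 1) * (5 + 4 * q) - cost (Add 13 0 2) - (2 + (n + 1) * (4 + 4 * q))"
      by (simp only: cost.simps)
    then show ?case using 14 by (intro halts_Nil) (simp_all add: I_def less_Suc_eq_le)
  qed (use assms in \<open>auto simp: env_def I_def algebra_simps\<close>)
qed auto

primrec sample_prog :: "(nat \<Rightarrow> nat) \<Rightarrow> nat \<Rightarrow> nat \<Rightarrow> prog" where
  "sample_prog cap q 0 = Skip"
| "sample_prog cap q (Suc j) = Seq (sample_prog cap q j) (fill (100 + 2 * j) (cap j) q)"

definition sample :: "(nat \<Rightarrow> nat) \<Rightarrow> nat \<Rightarrow> nat \<Rightarrow> bool stream \<Rightarrow> nat \<Rightarrow> nat \<Rightarrow> nat" where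
  "sample cap q n \<omega> j v = last_success (cap j) q (sdrop ((j * (n + 1) + v) * q) \<omega>)"

lemma sample_prog_frame [simp]:
  "r \<noteq> 11 \<Longrightarrow> r \<noteq> 12 \<Longrightarrow> r \<noteq> 13 \<Longrightarrow> r \<noteq> 30 \<Longrightarrow> r \<notin> writes (sample_prog cap q j)"
  "stores (sample_prog cap q j) = (\<lambda>i. 100 + 2 * i) ` {..<j}"
  by (induction j) (simp_all add: lessThan_Suc Un_commute)

lemma halts_sample:
  assumes "env n m D s" "\<And>j. j < J \<Longrightarrow> cap j < 2 ^ w" "w > 0" "n + 1 < 2 ^ w"
  shows "halts w (sample_prog cap q J) s (1 + J * (10 + (n + 1) * (5 + 4 * q))) (\<lambda>s'.
    (\<forall>j<J. \<forall>v\<le>n. arrays s' (100 + 2 * j) v = sample cap q n (tape s) j v) \<and> tape s' = sdrop (J * (n + 1) * q) (tape s))"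
  using assms(2)
proof (induction J)
  case 0
  show ?case by (intro halts_run) auto
next
  case (Suc J)
  show ?case unfolding sample_prog.simps
  proof (rule halts_Seq[where U = "10 + (n + 1) * (5 + 4 * q)", OF Suc.IH], goal_cases)
    case (2 s')
    have "env n m D s'" using 2(2) assms(1) by (auto simp: frame_def env_def)
    moreover have "cap J < 2 ^ w" using Suc.prems by simp
    ultimately show ?case
    proof (rule halts_mono[OF halts_fill[OF _ _ assms(3,4)] order_refl], goal_cases)
      case (1 s'')
      have a: "arrays s'' (100 + 2 * j) = arrays s' (100 + 2 * j)" if "j < J" for j
        using frame_arrays[OF 1(2)] that by simp
      show ?case
      proof (intro conjI allI impI)
        fix j v assume "j < Suc J" "v \<le> n"
        then show "arrays s'' (100 + 2 * j) v = sample cap q n (tape s) j v"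
          using 1(1) 2(1) a by (cases "j = J") (auto simp: sample_def sdrop_add algebra_simps)
      next
        show "tape s'' = sdrop (Suc J * (n + 1) * q) (tape s)"
          using 1(1) 2(1) by (auto simp: sdrop_add algebra_simps)
      qed
    qed
  qed (use Suc.prems in auto)
qed

section \<open>Correctness of the contractions\<close>

definition eset :: "(nat \<times> nat) list \<Rightarrow> nat set set" where
  "eset L = (\<lambda>e. {fst e, snd e}) ` set L"

definition simple :: "(nat \<times> nat) list \<Rightarrow> bool" where
  "simple L \<longleftrightarrow> distinct (map (\<lambda>e. {fst e, snd e}) L)"

lemma eset_mem: "{u, v} \<in> eset L \<longleftrightarrow> (u, v) \<in> set L \<or> (v, u) \<in> set L"
  unfolding eset_def by (force simp: doubleton_eq_iff)

lemma eset_mono: "set L \<subseteq> set L' \<Longrightarrow> eset L \<subseteq> eset L'"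
  by (auto simp: eset_def)

lemma card_eset: "simple L \<Longrightarrow> card (eset L) = length L"
  unfolding simple_def eset_def by (metis distinct_card length_map set_map)

lemma simple_filter: "simple L \<Longrightarrow> simple (filter P L)"
  by (simp add: simple_def distinct_map_filter)

lemma kill_sound: "e \<in> set A \<Longrightarrow> \<not> bad k (kill k c A (fst e)) (kill k c A (snd e))"
  by (induction A rule: rev_induct) (auto simp: kill_snoc bad_def)

lemma kill_keep: "(\<And>v. (u, v) \<in> set A \<Longrightarrow> \<not> bad k (c u) (c v)) \<Longrightarrow> kill k c A u = c u"
proof (induction A rule: rev_induct)
  case (snoc e A)
  then have u: "kill k c A u = c u" by simp
  show ?case
  proof (cases "fst e = u")
    case True
    then have "\<not> bad k (c u) (c (snd e))" using snoc.prems[of "snd e"] by (cases e) auto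
    moreover have "kill k c A (snd e) = c (snd e) \<or> kill k c A (snd e) = 0" by (rule kill_cases)
    ultimately have "\<not> bad k (c u) (kill k c A (snd e))" by (auto simp: bad_def)
    then show ?thesis using True u by (simp add: kill_snoc)
  next
    case False
    then show ?thesis using u by (simp add: kill_snoc)
  qed
qed simp

lemma set_arcs: "(u, v) \<in> set (arcs D L) \<Longrightarrow> (u, v) \<in> set L \<or> (v, u) \<in> set L"
  by (auto simp: arcs_def arcs_of_def split: if_splits)

lemma set_orient: "(u, v) \<in> set (orient D L) \<Longrightarrow> (u, v) \<in> set L \<or> (v, u) \<in> set L"
proof (induction D L rule: orient.induct)
  case (1 D L)
  then have "(u, v) \<in> set (arcs D L @ orient D (core D L))" "length (core D L) < length L"
    by (subst (asm) orient.simps; simp split: if_splits)+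
  then show ?case using 1(1) set_arcs[of u v D L] set_core[of D L] by auto
qed

lemma orient_rec: "halving D L \<Longrightarrow> orient D L = arcs D L @ orient D (core D L)"
proof -
  assume h: "halving D L"
  show ?thesis
  proof (cases "L = []")
    case True
    have "orient D [] = []" by (subst orient.simps) (simp add: core_def)
    then show ?thesis using True by (simp add: arcs_def core_def)
  next
    case False
    then have "length (core D L) < length L" using halvingD(1)[OF h] by (cases L) auto
    then show ?thesis by (subst orient.simps) simp
  qed
qed

lemma orient_complete: "halving D L \<Longrightarrow> (u, v) \<in> set L \<Longrightarrow> (u, v) \<in> set (orient D L) \<or> (v, u) \<in> set (orient D L)"
proof (induction "length L" arbitrary: L rule: less_induct)
  case less
  have l: "length (core D L) < length L" using halvingD(1)[OF less.prems(1)] less.prems(2) by (cases L) auto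
  show ?case
  proof (cases "D < deg L u \<and> D < deg L v")
    case True
    then have "(u, v) \<in> set (core D L)" using less.prems(2) by (simp add: core_def)
    then show ?thesis
      using less.hyps[OF l halvingD(2)[OF less.prems(1)]] unfolding orient_rec[OF less.prems(1)] by auto
  next
    case False
    then have "(u, v) \<in> set (arcs D L) \<or> (v, u) \<in> set (arcs D L)"
      using less.prems(2) unfolding arcs_def arcs_of_def by force
    then show ?thesis unfolding orient_rec[OF less.prems(1)] by auto
  qed
qed

lemma arcs_out_aux: "length (filter (\<lambda>e. fst e = u) (concat (map (arcs_of D L) M))) \<le> (if D < deg L u then 0 else deg M u)"
  by (induction M) (auto simp: arcs_of_def)

text \<open>A vertex of degree at most \<open>D\<close> emits all its arcs in the current round and
  does not occur in the core any more. A vertex of larger degree emits nothing in this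
  round.\<close>

lemma orient_out: "halving D L \<Longrightarrow> length (filter (\<lambda>e. fst e = u) (orient D L)) \<le> D"
proof (induction "length L" arbitrary: L rule: less_induct)
  case less
  note R = orient_rec[OF less.prems]
  show ?case
  proof (cases "L = []")
    case True
    have "orient D [] = []" by (subst orient.simps) (simp add: core_def)
    then show ?thesis using True by simp
  next
    case False
    then have l: "length (core D L) < length L" using halvingD(1)[OF less.prems] by (cases L) auto
    have a: "length (filter (\<lambda>e. fst e = u) (arcs D L)) \<le> (if D < deg L u then 0 else deg L u)"
      unfolding arcs_def by (rule arcs_out_aux)
    show ?thesis
    proof (cases "D < deg L u")
      case True
      then show ?thesis using a less.hyps[OF l halvingD(2)[OF less.prems]] unfolding R by simp
    next
      case False
      have "filter (\<lambda>e. fst e = u) (orient D (core D L)) = []"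
      proof (rule ccontr)
        assume "\<not> ?thesis"
        then obtain v where "(u, v) \<in> set (orient D (core D L))" by (auto simp: filter_empty_conv)
        then have "(u, v) \<in> set (core D L) \<or> (v, u) \<in> set (core D L)" by (rule set_orient)
        then show False using False by (auto simp: core_def)
      qed
      then show ?thesis using a False unfolding R by simp
    qed
  qed
qed

text \<open>The index \<open>i\<close> is the same for all \<open>r\<close>, so prescribing the one
  value \<open>r u = i\<close> forces the pick, whatever is drawn elsewhere.\<close>

lemma picked_exists:
  assumes "(u, v) \<in> set A" "length (filter (\<lambda>e. fst e = u) A) \<le> D"
  shows "\<exists>i<D. \<forall>r. r u = i \<longrightarrow> picked r A u = v"
proof -
  let ?F = "filter (\<lambda>e. fst e = u) A"
  have "(u, v) \<in> set ?F" using assms by simp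
  then obtain i where i: "i < length ?F" "?F ! i = (u, v)" by (meson in_set_conv_nth)
  then have "picked r A u = v" if "r u = i" for r using that by (simp add: picked_def Let_def)
  then show ?thesis using i assms(2) by (intro exI[of _ i]) auto
qed

lemma ends_below_orient: "ends_below n L \<Longrightarrow> ends_below n (orient D L)"
proof -
  assume L: "ends_below n L"
  have "u < n \<and> v < n" if "(u, v) \<in> set (orient D L)" for u v
    using set_orient[OF that] L by (auto simp: ends_below_def)
  then show ?thesis by (auto simp: ends_below_def)
qed

text \<open>The cycle \<open>1, ..., K - 1, x\<close>. The label \<open>x\<close> is separate
  because, depending on the choices made, the last remaining colour can be any of the larger
  ones.\<close>

definition colour_cycle :: "nat \<Rightarrow> nat \<Rightarrow> nat set set" where
  "colour_cycle K x = {{i, i + 1} |i. 1 \<le> i \<and> i + 1 < K} \<union> {{K - 1, x}, {x, 1}}"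

text \<open>Deleting \<open>x\<close> joins \<open>K - 1\<close> to 1, deleting \<open>K - 1\<close>
  joins \<open>x\<close> to \<open>K - 2\<close>; either way the colours
  \<open>1, ..., K - 2\<close> and \<open>t\<close> remain. By \<open>4 \<le> K\<close> the colours
  \<open>t\<close> and \<open>p\<close> were not adjacent before, which tells new edges from old
  ones. This fails for a triangle, where the contractions stop.\<close>

lemma colour_cycle_step:
  assumes K: "4 \<le> K" "K \<le> x" and mtp: "m = x \<and> t = K - 1 \<and> p = 1 \<or> m = K - 1 \<and> t = x \<and> p = K - 2"
  shows "colour_cycle (K - 1) t = {e \<in> colour_cycle K x. m \<notin> e} \<union> {{t, p}}"
    and "{t, p} \<notin> colour_cycle K x" "{m, t} \<in> colour_cycle K x" "{m, p} \<in> colour_cycle K x"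
    and "{m, b} \<in> colour_cycle K x \<Longrightarrow> b = t \<or> b = p" and "m \<noteq> t" "m \<noteq> p" "t \<noteq> p"
proof -
  obtain J where J: "K = J + 4" using K(1) by (metis add.commute le_Suc_ex)
  have A: "{{i, i + 1} |i. 1 \<le> i \<and> i + 1 < K} = {{i, i + 1} |i. 1 \<le> i \<and> i + 1 < K - 1} \<union> {{K - 2, K - 1}}" (is "?L = ?R")
  proof (intro set_eqI iffI)
    fix e assume "e \<in> ?L"
    then obtain i where i: "e = {i, i + 1}" "1 \<le> i" "i + 1 < K" by blast
    show "e \<in> ?R"
    proof (cases "i + 1 < K - 1")
      case False
      then have "i = K - 2" "i + 1 = K - 1" using i by auto
      then show ?thesis using i by simp
    qed (use i in blast)
  next
    fix e assume "e \<in> ?R"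
    then show "e \<in> ?L"
    proof
      assume "e \<in> {{K - 2, K - 1}}"
      moreover have "K - 1 = K - 2 + 1" "1 \<le> K - 2" "K - 2 + 1 < K" using J by auto
      ultimately show ?thesis by (intro CollectI exI[of _ "K - 2"]) simp
    qed force
  qed
  have small: "x \<notin> e" "K - 1 \<notin> e" "{} \<noteq> e" if "e \<in> {{i, i + 1} |i. 1 \<le> i \<and> i + 1 < K - 1}" for e
    using that K by auto
  show "colour_cycle (K - 1) t = {e \<in> colour_cycle K x. m \<notin> e} \<union> {{t, p}}"
    using mtp
  proof
    assume m: "m = x \<and> t = K - 1 \<and> p = 1"
    have "{e \<in> colour_cycle K x. m \<notin> e} = {{i, i + 1} |i. 1 \<le> i \<and> i + 1 < K - 1} \<union> {{K - 2, K - 1}}"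
      unfolding colour_cycle_def A using small(1) m K by auto
    then show ?thesis unfolding colour_cycle_def using m J by (auto simp: insert_commute)
  next
    assume m: "m = K - 1 \<and> t = x \<and> p = K - 2"
    have "{e \<in> colour_cycle K x. m \<notin> e} = {{i, i + 1} |i. 1 \<le> i \<and> i + 1 < K - 1} \<union> {{x, 1}}"
      unfolding colour_cycle_def A using small(2) m K by auto
    then show ?thesis unfolding colour_cycle_def using m J by (auto simp: insert_commute)
  qed
  show "{m, t} \<in> colour_cycle K x" "{m, p} \<in> colour_cycle K x"
    using mtp J unfolding colour_cycle_def A by (auto simp: insert_commute)
  show "{t, p} \<notin> colour_cycle K x" using mtp J K unfolding colour_cycle_def by (auto simp: doubleton_eq_iff)
  show "b = t \<or> b = p" if "{m, b} \<in> colour_cycle K x"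
    using that mtp J K unfolding colour_cycle_def by (auto simp: doubleton_eq_iff)
  show "m \<noteq> t" "m \<noteq> p" "t \<noteq> p" using mtp J K by auto
qed

locale contraction =
  fixes k D n :: nat and es :: "(nat \<times> nat) list"
begin

definition col :: "(nat \<Rightarrow> nat \<Rightarrow> nat) \<Rightarrow> nat \<Rightarrow> nat" where
  "col X = kill k (X 0) (orient D es)"

definition start :: "(nat \<Rightarrow> nat \<Rightarrow> nat) \<Rightarrow> (nat \<times> nat) list" where
  "start X = filter (\<lambda>e. col X (fst e) \<noteq> 0 \<and> col X (snd e) \<noteq> 0) es"

text \<open>After stage \<open>s\<close> the remaining colours form the cycle \<open>1, \<dots>, k - s - 1, x\<close>, where \<open>x\<close> is the
  second component.  The flip stored at index \<open>n\<close> decides which of the last two colours disappears.\<close>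

primrec stage :: "(nat \<Rightarrow> nat \<Rightarrow> nat) \<Rightarrow> nat \<Rightarrow> (nat \<times> nat) list \<times> nat" where
  "stage X 0 = (start X, k)"
| "stage X (Suc s) = (case stage X s of (L, x) \<Rightarrow>
     let pk = picked (X (Suc s)) (orient D L) in
     if X (Suc s) n = 0 then (merge (col X) pk x (k - s - 1) 1 L, k - s - 1)
     else (merge (col X) pk (k - s - 1) x (k - s - 2) L, x))"

definition cur where "cur X s = fst (stage X s)"
definition top_col where "top_col X s = snd (stage X s)"
definition picks where "picks X s = picked (X (Suc s)) (orient D (cur X s))"
definition gone where "gone X s = (if X (Suc s) n = 0 then top_col X s else k - s - 1)"
definition kept where "kept X s = (if X (Suc s) n = 0 then k - s - 1 else top_col X s)"
definition far where "far X s = (if X (Suc s) n = 0 then 1 else k - s - 2)"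

lemma stage_0 [simp]: "cur X 0 = start X" "top_col X 0 = k"
  by (simp_all add: cur_def top_col_def)

lemma stage_Suc:
  "cur X (Suc s) = merge (col X) (picks X s) (gone X s) (kept X s) (far X s) (cur X s)"
  "top_col X (Suc s) = kept X s"
  by (simp_all add: cur_def top_col_def picks_def gone_def kept_def far_def Let_def split: prod.splits)

text \<open>Stage \<open>s\<close> is determined by the samples with index at most \<open>s\<close>.
  Therefore the samples wanted next may be prescribed in terms of the outcome of the stages so
  far.\<close>

lemma stage_cong: "(\<And>i. i \<le> s \<Longrightarrow> X i = X' i) \<Longrightarrow> stage X s = stage X' s"
proof (induction s)
  case 0
  then have "col X = col X'" by (simp add: col_def)
  then show ?case by (simp add: start_def)
next
  case (Suc s)
  then have "stage X s = stage X' s" "X (Suc s) = X' (Suc s)" "col X = col X'" by (simp_all add: col_def)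
  then show ?case by (simp only: stage.simps)
qed

definition coloured_cycle :: "(nat \<Rightarrow> nat \<Rightarrow> nat) \<Rightarrow> nat \<Rightarrow> (nat \<Rightarrow> nat) \<Rightarrow> bool" where
  "coloured_cycle X s S \<longleftrightarrow> (\<forall>a b. {a, b} \<in> colour_cycle (k - s) (top_col X s) \<longrightarrow>
     {S a, S b} \<in> eset (cur X s) \<and> col X (S a) = a)"

end

section \<open>Sparsity at every stage, and lifting of coloured cycles\<close>

locale contraction_graph = contraction +
  fixes F :: "nat graph set" and G :: "nat graph" and d :: nat
  assumes F: "hereditary F" "G \<in> F" "\<And>H. H \<in> F \<Longrightarrow> card (edges H) \<le> d * card (verts H)"
    and G: "verts G = {..<n}" "edges G = eset es" "simple es"
    and D: "4 * d \<le> D" "k \<le> D" and k: "3 \<le> k"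
begin

text \<open>The vertex set is left open: lists record edges only, while deletions and contractions
  change the vertices. Membership in \<open>F\<close> still bounds the number of edges on any vertex
  subset, as subgraphs belong to \<open>F\<close> too.\<close>

definition embedded :: "(nat \<times> nat) list \<Rightarrow> bool" where
  "embedded L \<longleftrightarrow> simple L \<and> (\<exists>V. \<lparr>verts = V, edges = eset L\<rparr> \<in> F)"

lemma embedded_es: "embedded es"
proof -
  have "\<lparr>verts = verts G, edges = edges G\<rparr> = G" by (cases G) simp
  then show ?thesis unfolding embedded_def using F G by metis
qed

lemma embedded_filter:
  assumes "embedded L"
  shows "embedded (filter P L)"
proof -
  obtain V where V: "\<lparr>verts = V, edges = eset L\<rparr> \<in> F" "simple L" using assms by (auto simp: embedded_def)
  have g: "is_graph \<lparr>verts = V, edges = eset L\<rparr>" using hereditaryD(1)[OF F(1) V(1)] .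
  have sub: "eset (filter P L) \<subseteq> eset L" by (rule eset_mono) auto
  have "is_graph \<lparr>verts = V, edges = eset (filter P L)\<rparr>" using g sub unfolding is_graph_def by auto
  then have "is_subgraph \<lparr>verts = V, edges = eset (filter P L)\<rparr> \<lparr>verts = V, edges = eset L\<rparr>"
    using sub by (simp add: is_subgraph_def)
  then have "\<lparr>verts = V, edges = eset (filter P L)\<rparr> \<in> F" by (rule hereditaryD(2)[OF F(1) V(1)])
  then show ?thesis unfolding embedded_def using simple_filter[OF V(2)] by blast
qed

lemma sum_deg: "finite W \<Longrightarrow> (\<Sum>v\<in>W. deg L v) \<le> 2 * length L"
proof (induction L)
  case (Cons e L)
  have "(\<Sum>v\<in>W. of_bool (a = v)) \<le> (1 :: nat)" for a
    using Cons.prems by (auto simp: of_bool_def sum.delta)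
  from add_mono[OF this[of "fst e"] this[of "snd e"]]
  have "(\<Sum>v\<in>W. of_bool (fst e = v)) + (\<Sum>v\<in>W. of_bool (snd e = v)) \<le> (2 :: nat)" by simp
  moreover have "(\<Sum>v\<in>W. deg (e # L) v) =
      (\<Sum>v\<in>W. of_bool (fst e = v)) + (\<Sum>v\<in>W. of_bool (snd e = v)) + (\<Sum>v\<in>W. deg L v)"
    by (simp add: sum.distrib)
  ultimately show ?case using Cons.IH[OF Cons.prems] by simp
qed simp

text \<open>Let \<open>?W\<close> be the set of vertices of degree above \<open>D\<close>. The core
  is a graph on \<open>?W\<close>, so it has at most \<open>d * card ?W\<close> edges, and counting
  ends gives \<open>D * card ?W \<le> 2 * length L\<close>. The condition
  \<open>4 * d \<le> D\<close> yields the factor 1/2.\<close>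

lemma embedded_core:
  assumes L: "embedded L"
  shows "2 * length (core D L) \<le> length L"
proof -
  let ?W = "{v. D < deg L v}"
  have W: "?W \<subseteq> fst ` set L \<union> snd ` set L"
  proof
    fix v assume "v \<in> ?W"
    then have "0 < deg L v" by simp
    then show "v \<in> fst ` set L \<union> snd ` set L" by (induction L) (auto split: if_splits)
  qed
  have fin: "finite ?W" by (rule finite_subset[OF W]) simp
  have C: "embedded (core D L)" unfolding core_def by (rule embedded_filter[OF L])
  then obtain V where V: "\<lparr>verts = V, edges = eset (core D L)\<rparr> \<in> F" "simple (core D L)"
    by (auto simp: embedded_def)
  have g: "is_graph \<lparr>verts = V, edges = eset (core D L)\<rparr>" using hereditaryD(1)[OF F(1) V(1)] .
  let ?H = "\<lparr>verts = V \<inter> ?W, edges = eset (core D L)\<rparr>"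
  have "is_graph ?H" using g by (auto simp: is_graph_def eset_def core_def)
  then have "is_subgraph ?H \<lparr>verts = V, edges = eset (core D L)\<rparr>" by (auto simp: is_subgraph_def)
  then have "?H \<in> F" by (rule hereditaryD(2)[OF F(1) V(1)])
  then have "length (core D L) \<le> d * card (V \<inter> ?W)" using F(3)[of ?H] card_eset[OF V(2)] by simp
  also have "\<dots> \<le> d * card ?W" using fin by (intro mult_le_mono2 card_mono) auto
  finally have "4 * length (core D L) \<le> 4 * d * card ?W" by simp
  also have "\<dots> \<le> (\<Sum>v\<in>?W. D)" using D(1) by (simp add: mult.commute)
  also have "\<dots> \<le> (\<Sum>v\<in>?W. deg L v)" by (rule sum_mono) simp
  also have "\<dots> \<le> 2 * length L" by (rule sum_deg[OF fin])
  finally show ?thesis by simp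
qed

lemma embedded_halving: "embedded L \<Longrightarrow> halving D L"
proof -
  assume L: "embedded L"
  have "embedded ((core D ^^ i) L)" for i
    by (induction i) (use L embedded_filter in \<open>simp_all add: core_def[abs_def]\<close>)
  then show ?thesis unfolding halving_def using embedded_core by simp
qed

text \<open>The new edges lie in the graph obtained by contracting every vertex of colour
  \<open>m\<close> into its pick of colour \<open>t\<close>. The hypothesis \<open>old\<close> keeps
  new edges, which join the colours \<open>t\<close> and \<open>p\<close>, apart from inherited
  ones; among new edges the colours fix the order of the ends. Hence no edge is listed
  twice.\<close>

lemma embedded_merge:
  assumes L: "embedded L" and mtp: "m \<noteq> t" "m \<noteq> p" "t \<noteq> p"
    and pk: "\<And>u. pk u = u \<or> {u, pk u} \<in> eset L"
    and old: "\<And>u v. (u, v) \<in> set L \<Longrightarrow> {c u, c v} \<noteq> {t, p}"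
  shows "embedded (merge c pk m t p L)"
proof -
  obtain V where V: "\<lparr>verts = V, edges = eset L\<rparr> \<in> F" "simple L" using L by (auto simp: embedded_def)
  have g: "is_graph \<lparr>verts = V, edges = eset L\<rparr>" using hereditaryD(1)[OF F(1) V(1)] .
  let ?M = "merge c pk m t p L"
  define A where "A = {u \<in> V. c u = m \<and> c (pk u) = t}"
  let ?f = "\<lambda>x. if x \<in> A then pk x else x"
  have "finite A" using g by (simp add: A_def is_graph_def)
  moreover have "pk u \<notin> A \<and> {u, pk u} \<in> eset L" if "u \<in> A" for u
    using that pk[of u] mtp(1) by (auto simp: A_def)
  ultimately have H: "\<lparr>verts = V - A, edges = {e'. \<exists>e\<in>eset L. e' = ?f ` e \<and> card e' = 2}\<rparr> \<in> F" (is "?H \<in> F")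
    using hereditary_contract_stars[OF F(1) V(1), of A pk] by simp
  have sub: "eset ?M \<subseteq> edges ?H"
  proof
    fix e assume "e \<in> eset ?M"
    then obtain x y where e: "e = {x, y}" "(x, y) \<in> set ?M" by (auto simp: eset_def)
    from e(2) consider "(x, y) \<in> set L" "c x \<noteq> m" "c y \<noteq> m" | u where "middle c pk m t p L x y u"
      unfolding set_merge[OF mtp(2)] by auto
    then show "e \<in> edges ?H"
    proof cases
      case 1
      then have "{x, y} \<in> eset L" by (simp add: eset_mem)
      moreover from this have "card {x, y} = 2" using g by (auto simp: is_graph_def)
      moreover have "?f ` {x, y} = {x, y}" using 1 by (auto simp: A_def)
      ultimately show ?thesis using e(1) by (auto intro!: bexI[of _ "{x, y}"])
    next
      case 2
      then have u: "{u, y} \<in> eset L" "c u = m" "pk u = x" "c x = t" "c y = p" by (auto simp: middle_def eset_mem)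
      then have "u \<in> V" using g by (auto simp: is_graph_def)
      then have "?f ` {u, y} = {x, y}" using u mtp by (auto simp: A_def)
      moreover have "card {x, y} = 2" using u mtp by (auto simp: card_2_iff)
      ultimately show ?thesis using e(1) u(1) by (auto intro!: bexI[of _ "{u, y}"])
    qed
  qed
  have gH: "is_graph ?H" using hereditaryD(1)[OF F(1) H] .
  then have "is_graph \<lparr>verts = V - A, edges = eset ?M\<rparr>" using sub unfolding is_graph_def by auto
  then have "is_subgraph \<lparr>verts = V - A, edges = eset ?M\<rparr> ?H" using sub by (simp add: is_subgraph_def)
  then have "\<lparr>verts = V - A, edges = eset ?M\<rparr> \<in> F" by (rule hereditaryD(2)[OF F(1) H])
  moreover have "simple ?M"
    unfolding simple_def distinct_map
  proof (intro conjI inj_onI)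
    show "distinct ?M" by (rule distinct_merge)
    fix e e' assume e: "e \<in> set ?M" "e' \<in> set ?M" and eq: "{fst e, snd e} = {fst e', snd e'}"
    have inj: "inj_on (\<lambda>e. {fst e, snd e}) (set L)" using V(2) by (simp add: simple_def distinct_map)
    have kinds: "e \<in> set L \<and> {c (fst e), c (snd e)} \<noteq> {t, p} \<or> c (fst e) = t \<and> c (snd e) = p" if "e \<in> set ?M" for e
      using that old[of "fst e" "snd e"] unfolding set_merge[OF mtp(2)] by (auto simp: middle_def)
    have "{c (fst e), c (snd e)} = {c (fst e'), c (snd e')}" using eq by (auto simp: doubleton_eq_iff)
    then consider "e \<in> set L" "e' \<in> set L" | "c (fst e) = t" "c (snd e) = p" "c (fst e') = t" "c (snd e') = p"
      using kinds[OF e(1)] kinds[OF e(2)] by metis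
    then show "e = e'"
    proof cases
      case 1
      then show ?thesis using inj eq by (simp add: inj_on_def)
    next
      case 2
      then have "fst e = fst e'" "snd e = snd e'" using eq mtp(3) by (auto simp: doubleton_eq_iff)
      then show ?thesis by (rule prod_eqI)
    qed
  qed
  ultimately show ?thesis unfolding embedded_def by blast
qed

lemma ends_below_es: "ends_below n es"
proof -
  have "is_graph G" by (rule hereditaryD(1)[OF F(1,2)])
  then have "eset es \<subseteq> {e. e \<subseteq> {..<n} \<and> card e = 2}" using G(1,2) by (simp add: is_graph_def)
  moreover have "{u, v} \<in> eset es" if "(u, v) \<in> set es" for u v using that by (simp add: eset_mem)
  ultimately have "{u, v} \<subseteq> {..<n}" if "(u, v) \<in> set es" for u v using that by blast
  then show ?thesis by (auto simp: ends_below_def)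
qed

context
  fixes X :: "nat \<Rightarrow> nat \<Rightarrow> nat"
  assumes X0: "\<And>v. X 0 v \<le> k"
begin

lemma col_le: "col X v \<le> k"
  unfolding col_def using kill_le X0 le_trans by blast

lemma start_colours: "(u, v) \<in> set es \<Longrightarrow> col X u \<noteq> 0 \<Longrightarrow> col X v \<noteq> 0 \<Longrightarrow> {col X u, col X v} \<in> colour_cycle k k"
proof -
  assume e: "(u, v) \<in> set es" and nz: "col X u \<noteq> 0" "col X v \<noteq> 0"
  have "cyc k (col X u) (col X v) \<or> cyc k (col X v) (col X u)"
    using orient_complete[OF embedded_halving[OF embedded_es] e] kill_sound[of _ "orient D es" k "X 0"] nz
    unfolding col_def bad_def by fastforce
  then have c: "cyc k (col X u) (col X v)" by (auto simp: cyc_def)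
  have step: "{a, b} \<in> colour_cycle k k" if "a + 1 = b" "a \<noteq> 0" "b \<le> k" for a b
  proof (cases "b = k")
    case True
    then have "a = k - 1" using that by simp
    then show ?thesis using True by (simp add: colour_cycle_def)
  next
    case False
    then have "\<exists>i. {a, b} = {i, i + 1} \<and> 1 \<le> i \<and> i + 1 < k" using that by (intro exI[of _ a]) auto
    then show ?thesis by (simp add: colour_cycle_def)
  qed
  show ?thesis
    using c step[of "col X u" "col X v"] step[of "col X v" "col X u"] nz col_le[of u] col_le[of v]
    unfolding cyc_def by (auto simp: insert_commute) (auto simp: colour_cycle_def insert_commute)
qed

text \<open>Colours are computed once and for all: a contracted vertex takes over the name of its
  pick and thereby its colour. So the restriction on the colours of edges passes through
  \<open>set_merge\<close>.\<close>

lemma stage_invariant: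
  assumes "s + 3 \<le> k"
  shows "embedded (cur X s) \<and> ends_below n (cur X s) \<and> length (cur X s) \<le> length es \<and>
    k - s \<le> top_col X s \<and> top_col X s \<le> k \<and>
    (\<forall>(u, v)\<in>set (cur X s). {col X u, col X v} \<in> colour_cycle (k - s) (top_col X s))"
  using assms
proof (induction s)
  case 0
  have "embedded (start X)" unfolding start_def by (rule embedded_filter[OF embedded_es])
  moreover have "ends_below n (start X)" using ends_below_es by (auto simp: start_def ends_below_def)
  moreover have "length (start X) \<le> length es" by (simp add: start_def)
  moreover have "\<forall>(u, v)\<in>set (start X). {col X u, col X v} \<in> colour_cycle k k"
    using start_colours by (auto simp: start_def)
  ultimately show ?case by simp
next
  case (Suc s)
  define L where "L = cur X s"
  define x where "x = top_col X s"
  define K where "K = k - s"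
  define m where "m = gone X s"
  define t where "t = kept X s"
  define p where "p = far X s"
  have IH: "embedded L" "ends_below n L" "length L \<le> length es" "K \<le> x" "x \<le> k"
    "\<And>u v. (u, v) \<in> set L \<Longrightarrow> {col X u, col X v} \<in> colour_cycle K x"
    using Suc by (auto simp: L_def x_def K_def)
  have K: "4 \<le> K" "k - Suc s = K - 1" using Suc.prems by (auto simp: K_def)
  have mtp: "m = x \<and> t = K - 1 \<and> p = 1 \<or> m = K - 1 \<and> t = x \<and> p = K - 2"
    by (simp add: m_def t_def p_def gone_def kept_def far_def x_def K_def)
  note cs = colour_cycle_step[OF K(1) IH(4) mtp]
  have S: "cur X (Suc s) = merge (col X) (picks X s) m t p L" "top_col X (Suc s) = t"
    by (simp_all add: stage_Suc m_def t_def p_def L_def)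
  have pk: "picks X s u = u \<or> {u, picks X s u} \<in> eset L" for u
    using picked_mem[of "X (Suc s)" "orient D L" u] set_orient[of u _ D L]
    by (auto simp: picks_def L_def eset_mem)
  have pkn: "picks X s u < n" if "u < n" for u
    using picked_less[OF ends_below_orient[OF IH(2)] that] by (simp add: picks_def L_def)
  have old: "{col X u, col X v} \<noteq> {t, p}" if "(u, v) \<in> set L" for u v
    using IH(6)[OF that] cs(2) by metis
  have "embedded (cur X (Suc s))" unfolding S by (rule embedded_merge[OF IH(1) cs(6-8) pk old])
  moreover have "ends_below n (cur X (Suc s))" unfolding S by (rule ends_below_merge[OF IH(2) pkn cs(7)])
  moreover have "length (cur X (Suc s)) \<le> length es" unfolding S using length_merge le_trans IH(3) by blast
  moreover have "k - Suc s \<le> t" "t \<le> k" using mtp IH(4,5) K by auto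
  moreover have "{col X u, col X v} \<in> colour_cycle (K - 1) t" if "(u, v) \<in> set (cur X (Suc s))" for u v
    using that IH(6)[of u v] unfolding S set_merge[OF cs(7)] cs(1) middle_def by auto
  ultimately show ?case unfolding S(2) K(2) by auto
qed

lemma picks_edge: "picks X s u = u \<or> {u, picks X s u} \<in> eset (cur X s)"
  using picked_mem[of "X (Suc s)" "orient D (cur X s)" u] set_orient[of u _ D "cur X s"]
  by (auto simp: picks_def eset_mem)

lemma stage_step:
  assumes s: "s + 4 \<le> k"
  defines "m \<equiv> gone X s" and "t \<equiv> kept X s" and "p \<equiv> far X s"
  shows "colour_cycle (k - Suc s) t = {e \<in> colour_cycle (k - s) (top_col X s). m \<notin> e} \<union> {{t, p}}"
    and "{t, p} \<notin> colour_cycle (k - s) (top_col X s)"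
    and "{m, t} \<in> colour_cycle (k - s) (top_col X s)" "{m, p} \<in> colour_cycle (k - s) (top_col X s)"
    and "{m, b} \<in> colour_cycle (k - s) (top_col X s) \<Longrightarrow> b = t \<or> b = p" "m \<noteq> t" "m \<noteq> p" "t \<noteq> p"
proof -
  have 1: "4 \<le> k - s" "k - s \<le> top_col X s" "k - Suc s = k - s - 1" using s stage_invariant[of s] by auto
  have 2: "m = top_col X s \<and> t = k - s - 1 \<and> p = 1 \<or> m = k - s - 1 \<and> t = top_col X s \<and> p = k - s - 2"
    by (simp add: m_def t_def p_def gone_def kept_def far_def)
  note cs = colour_cycle_step[OF 1(1,2) 2]
  show "colour_cycle (k - Suc s) t = {e \<in> colour_cycle (k - s) (top_col X s). m \<notin> e} \<union> {{t, p}}"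
    and "{t, p} \<notin> colour_cycle (k - s) (top_col X s)"
    and "{m, t} \<in> colour_cycle (k - s) (top_col X s)" "{m, p} \<in> colour_cycle (k - s) (top_col X s)"
    and "{m, b} \<in> colour_cycle (k - s) (top_col X s) \<Longrightarrow> b = t \<or> b = p" "m \<noteq> t" "m \<noteq> p" "t \<noteq> p"
    using cs unfolding 1(3) by blast+
qed

text \<open>The cycle edge with the colours \<open>t\<close> and \<open>p\<close> cannot be
  inherited, as these colours were not adjacent before. So it stems from a vertex \<open>u\<close>
  of the vanished colour that picked \<open>S t\<close> and is adjacent to \<open>S p\<close>, and
  inserting \<open>u\<close> restores the longer cycle. Any recorded middle vertex will do.\<close>

lemma coloured_cycle_backward:
  assumes s: "s + 4 \<le> k" and S: "coloured_cycle X (Suc s) S"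
    and mid: "\<And>x y u. middle (col X) (picks X s) (gone X s) (kept X s) (far X s) (cur X s) x y u \<Longrightarrow>
      middle (col X) (picks X s) (gone X s) (kept X s) (far X s) (cur X s) x y (mid x y)"
  shows "S (kept X s) < n \<and> S (far X s) < n \<and> mid (S (kept X s)) (S (far X s)) < n \<and>
    coloured_cycle X s (S(gone X s := mid (S (kept X s)) (S (far X s))))"
proof -
  define m where "m = gone X s"
  define t where "t = kept X s"
  define p where "p = far X s"
  define u where "u = mid (S t) (S p)"
  note st = stage_step[OF s, folded m_def t_def p_def]
  have inv: "embedded (cur X s)" "ends_below n (cur X s)"
    "\<And>u v. (u, v) \<in> set (cur X s) \<Longrightarrow> {col X u, col X v} \<in> colour_cycle (k - s) (top_col X s)"
    using stage_invariant[of s] s by auto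
  have bn: "a < n \<and> b < n" if "{a, b} \<in> eset (cur X s)" for a b
    using that inv(2) by (auto simp: eset_mem ends_below_def)
  have C: "{S a, S b} \<in> eset (cur X (Suc s)) \<and> col X (S a) = a" if "{a, b} \<in> colour_cycle (k - Suc s) t" for a b
    using S that unfolding coloured_cycle_def stage_Suc(2) t_def by blast
  have C': "col X (S b) = b" if "{a, b} \<in> colour_cycle (k - Suc s) t" for a b
    using C[of b a] that by (simp add: insert_commute)
  have new: "(a, b) \<in> set (cur X s) \<or> (\<exists>z. middle (col X) (picks X s) m t p (cur X s) a b z)"
    if "(a, b) \<in> set (cur X (Suc s))" for a b
    using that unfolding stage_Suc(1) m_def[symmetric] t_def[symmetric] p_def[symmetric] set_merge[OF st(7)] by auto
  have tp: "{t, p} \<in> colour_cycle (k - Suc s) t" unfolding st(1) by simp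
  have ct: "col X (S t) = t" "col X (S p) = p" using C[OF tp] C'[OF tp] by auto
  have "(S t, S p) \<in> set (cur X (Suc s)) \<or> (S p, S t) \<in> set (cur X (Suc s))" using C[OF tp] by (simp add: eset_mem)
  then obtain z where "middle (col X) (picks X s) m t p (cur X s) (S t) (S p) z"
  proof
    assume "(S t, S p) \<in> set (cur X (Suc s))"
    then show ?thesis using new[of "S t" "S p"] inv(3)[of "S t" "S p"] ct st(2) that by metis
  next
    assume "(S p, S t) \<in> set (cur X (Suc s))"
    then have "\<exists>z. middle (col X) (picks X s) m t p (cur X s) (S p) (S t) z"
      using new[of "S p" "S t"] inv(3)[of "S p" "S t"] ct st(2) by (metis insert_commute)
    then show ?thesis using ct st(8) by (auto simp: middle_def)
  qed
  then have u: "middle (col X) (picks X s) m t p (cur X s) (S t) (S p) u"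
    using mid unfolding u_def m_def t_def p_def by blast
  then have up: "{u, S p} \<in> eset (cur X s)" and cu: "col X u = m" and pu: "picks X s u = S t"
    by (auto simp: middle_def eset_mem)
  have ut: "{u, S t} \<in> eset (cur X s)"
    using picks_edge[of s u] pu cu ct(1) st(6) by metis
  have "coloured_cycle X s (S(m := u))"
    unfolding coloured_cycle_def
  proof (intro allI impI)
    fix a b assume ab: "{a, b} \<in> colour_cycle (k - s) (top_col X s)"
    let ?S = "S(m := u)"
    show "{?S a, ?S b} \<in> eset (cur X s) \<and> col X (?S a) = a"
    proof (cases "a = m \<or> b = m")
      case True
      then consider "a = m" "b = t \<or> b = p" | "b = m" "a = t \<or> a = p"
        using ab st(5)[of b] st(5)[of a] by (metis insert_commute)
      then show ?thesis using ut up cu ct st(6,7) by cases (auto simp: insert_commute)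
    next
      case False
      then have ab': "{a, b} \<in> colour_cycle (k - Suc s) t" unfolding st(1) using ab by auto
      have not_tp: "{a, b} \<noteq> {t, p}" using ab st(2) by metis
      have "(S a, S b) \<in> set (cur X (Suc s)) \<or> (S b, S a) \<in> set (cur X (Suc s))" using C[OF ab'] by (simp add: eset_mem)
      then have "{S a, S b} \<in> eset (cur X s)"
        using new[of "S a" "S b"] new[of "S b" "S a"] C[OF ab'] C'[OF ab'] not_tp
        unfolding eset_mem middle_def by (metis insert_commute)
      then show ?thesis using False C[OF ab'] by simp
    qed
  qed
  then show ?thesis using bn[OF ut] bn[OF up] unfolding u_def m_def t_def p_def by blast
qed

text \<open>Only the pick of the one vertex \<open>S (gone X s)\<close> matters. Edges that avoid
  the vanishing colour are kept no matter what the other vertices pick.\<close>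

lemma coloured_cycle_forward:
  assumes s: "s + 4 \<le> k" and S: "coloured_cycle X s S" and pick: "picks X s (S (gone X s)) = S (kept X s)"
  shows "coloured_cycle X (Suc s) S"
  unfolding coloured_cycle_def
proof (intro allI impI)
  fix a b assume ab: "{a, b} \<in> colour_cycle (k - Suc s) (top_col X (Suc s))"
  note st = stage_step[OF s]
  have C: "{S a, S b} \<in> eset (cur X s) \<and> col X (S a) = a \<and> col X (S b) = b"
    if "{a, b} \<in> colour_cycle (k - s) (top_col X s)" for a b
    using S that unfolding coloured_cycle_def by (metis insert_commute)
  have tp: "middle (col X) (picks X s) (gone X s) (kept X s) (far X s) (cur X s) (S (kept X s)) (S (far X s)) (S (gone X s))"
    using C[OF st(3)] C[OF st(4)] pick by (auto simp: middle_def eset_mem)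
  have tpe: "{S (kept X s), S (far X s)} \<in> eset (cur X (Suc s))"
    unfolding eset_mem stage_Suc(1) set_merge[OF st(7)] using tp by blast
  show "{S a, S b} \<in> eset (cur X (Suc s)) \<and> col X (S a) = a"
  proof (cases "{a, b} = {kept X s, far X s}")
    case True
    then show ?thesis using tpe C[OF st(3)] C[OF st(4)] by (auto simp: doubleton_eq_iff insert_commute)
  next
    case False
    then have ab': "{a, b} \<in> colour_cycle (k - s) (top_col X s)" "gone X s \<noteq> a" "gone X s \<noteq> b"
      using ab unfolding stage_Suc(2) st(1) by auto
    then have "{S a, S b} \<in> eset (cur X (Suc s))"
      using C[OF ab'(1)] unfolding eset_mem stage_Suc(1) set_merge[OF st(7)] by auto
    then show ?thesis using C[OF ab'(1)] by simp
  qed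
qed

end

end

section \<open>Coloured cycles as induced cycles, and conversely\<close>

lemma colour_cycle_3: "colour_cycle 3 x = {{1, 2}, {2, x}, {x, 1}}"
proof -
  have "{{i, i + 1} |i. 1 \<le> i \<and> i + 1 < 3} = {{1, 2 :: nat}}" (is "?A = ?B")
  proof (intro set_eqI iffI)
    fix e assume "e \<in> ?A"
    then obtain i where i: "e = {i, i + 1}" "1 \<le> i" "i + 1 < 3" by blast
    then have "i = 1" by simp
    then show "e \<in> ?B" using i(1) by (simp add: numeral_2_eq_2)
  qed (auto intro!: exI[of _ "1 :: nat"])
  then show ?thesis by (auto simp: colour_cycle_def)
qed

lemma colour_cycle_mem:
  assumes "3 \<le> k" "1 \<le> a" "a \<le> k"
  shows "\<exists>b. {a, b} \<in> colour_cycle k k"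
proof (cases "a = k")
  case True
  then show ?thesis by (auto simp: colour_cycle_def)
next
  case False
  show ?thesis
  proof (cases "a + 1 = k")
    case True
    then have "{a, k} = {k - 1, k}" using assms by auto
    then show ?thesis by (auto simp: colour_cycle_def)
  next
    case False
    then have "{a, a + 1} \<in> colour_cycle k k" using \<open>a \<noteq> k\<close> assms unfolding colour_cycle_def by force
    then show ?thesis by blast
  qed
qed

lemma colour_cycle_le:
  assumes "3 \<le> k" "{a, b} \<in> colour_cycle k k"
  shows "a \<in> {1..k} \<and> b \<in> {1..k}"
  using assms by (auto simp: colour_cycle_def doubleton_eq_iff)

text \<open>Colour \<open>k\<close> plays the role of the vertex 0 of \<open>cycle_graph k\<close>.\<close>

lemma colour_cycle_mod:
  assumes "3 \<le> k"
  shows "colour_cycle k k = {{if i = 0 then k else i, if (i + 1) mod k = 0 then k else (i + 1) mod k} |i. i < k}" (is "_ = ?R")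
proof (intro set_eqI iffI)
  fix e assume "e \<in> colour_cycle k k"
  then consider i where "e = {i, i + 1}" "1 \<le> i" "i + 1 < k" | "e = {k - 1, k}" | "e = {k, 1}"
    unfolding colour_cycle_def by blast
  then show "e \<in> ?R"
  proof cases
    case (1 i)
    then show ?thesis by (intro CollectI exI[of _ i]) simp
  next
    case 2
    then show ?thesis using assms by (intro CollectI exI[of _ "k - 1"]) simp
  next
    case 3
    then show ?thesis using assms by (intro CollectI exI[of _ 0]) simp
  qed
next
  fix e assume "e \<in> ?R"
  then obtain i where i: "e = {if i = 0 then k else i, if (i + 1) mod k = 0 then k else (i + 1) mod k}" "i < k" by blast
  consider "i = 0" | "i = k - 1" "i \<noteq> 0" | "i + 1 < k" "1 \<le> i" using i(2) by linarith
  then show "e \<in> colour_cycle k k"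
  proof cases
    case 1
    then show ?thesis using i assms by (simp add: colour_cycle_def)
  next
    case 2
    then have "i + 1 = k" using i(2) by simp
    then have "e = {k - 1, k}" using i(1) 2 by simp
    then show ?thesis by (simp add: colour_cycle_def)
  next
    case 3
    then have "e = {i, i + 1}" using i(1) by simp
    then show ?thesis using 3 unfolding colour_cycle_def by blast
  qed
qed

context contraction_graph
begin

text \<open>The colouring is a left inverse of \<open>S\<close>, which makes \<open>S\<close>
  injective. A chord would be an edge between surviving vertices of non-adjacent colours, which
  \<open>start_colours\<close> forbids.\<close>

lemma coloured_cycle_induced:
  assumes X0: "\<And>v. X 0 v \<le> k" and S: "coloured_cycle X 0 S"
  shows "induced_cycle G k (S ` {1..k})"
proof -
  define h where "h i = (if i = 0 then k else i)" for i :: nat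
  have P: "{S a, S b} \<in> eset (start X) \<and> col X (S a) = a" if "{a, b} \<in> colour_cycle k k" for a b
    using S that unfolding coloured_cycle_def by simp
  have C: "col X (S a) = a" if "1 \<le> a" "a \<le> k" for a
    using colour_cycle_mem[OF k that] P by blast
  have inj: "inj_on S {1..k}" by (rule inj_on_inverseI[of _ "col X"]) (use C in auto)
  have h: "bij_betw h {..<k} {1..k}"
    unfolding bij_betw_def
  proof
    show "inj_on h {..<k}" by (auto simp: inj_on_def h_def)
    show "h ` {..<k} = {1..k}"
    proof (intro set_eqI iffI)
      fix x assume "x \<in> {1..k}"
      then show "x \<in> h ` {..<k}" by (cases "x = k") (auto simp: h_def image_iff intro: bexI[of _ 0] bexI[of _ x])
    qed (use k in \<open>auto simp: h_def\<close>)
  qed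
  have sub: "S ` {1..k} \<subseteq> {..<n}"
  proof
    fix v assume "v \<in> S ` {1..k}"
    then obtain a where a: "v = S a" "1 \<le> a" "a \<le> k" by auto
    then obtain b where "{S a, S b} \<in> eset (start X)" using colour_cycle_mem[OF k] P by blast
    moreover have "ends_below n (start X)" using ends_below_es by (auto simp: start_def ends_below_def)
    ultimately show "v \<in> {..<n}" using a by (auto simp: eset_mem ends_below_def)
  qed
  have start: "{u, v} \<in> eset (start X) \<longleftrightarrow> {u, v} \<in> eset es \<and> col X u \<noteq> 0 \<and> col X v \<noteq> 0" for u v
    unfolding eset_mem start_def by auto
  have E: "{S a, S b} \<in> eset es \<longleftrightarrow> {a, b} \<in> colour_cycle k k" if ab: "a \<in> {1..k}" "b \<in> {1..k}" for a b
  proof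
    assume "{a, b} \<in> colour_cycle k k"
    then show "{S a, S b} \<in> eset es" using P start by blast
  next
    assume "{S a, S b} \<in> eset es"
    then have "(S a, S b) \<in> set es \<or> (S b, S a) \<in> set es" by (simp add: eset_mem)
    then have "{col X (S a), col X (S b)} \<in> colour_cycle k k"
      using start_colours[where X = X, OF X0, of "S a" "S b"] start_colours[where X = X, OF X0, of "S b" "S a"] C ab by (auto simp: insert_commute)
    then show "{a, b} \<in> colour_cycle k k" using C ab by auto
  qed
  have gG: "edges G \<subseteq> {e. e \<subseteq> verts G \<and> card e = 2}" using hereditaryD(1)[OF F(1,2)] by (simp add: is_graph_def)
  have edges: "{e \<in> edges G. e \<subseteq> S ` {1..k}} = (\<lambda>e. (S \<circ> h) ` e) ` edges (cycle_graph k)"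
  proof -
    have "{e \<in> edges G. e \<subseteq> S ` {1..k}} = (`) S ` colour_cycle k k"
    proof (intro set_eqI iffI)
      fix e assume e: "e \<in> {e \<in> edges G. e \<subseteq> S ` {1..k}}"
      then have "card e = 2" using gG by blast
      then obtain x y where "e = {x, y}" by (auto simp: card_2_iff)
      then obtain a b where ab: "e = {S a, S b}" "a \<in> {1..k}" "b \<in> {1..k}" using e by auto
      then have "{a, b} \<in> colour_cycle k k" using E e G(2) by auto
      moreover have "e = S ` {a, b}" using ab(1) by simp
      ultimately show "e \<in> (`) S ` colour_cycle k k" by blast
    next
      fix e assume "e \<in> (`) S ` colour_cycle k k"
      then obtain e' where e': "e' \<in> colour_cycle k k" "e = S ` e'" by blast
      then obtain a b where ab: "e' = {a, b}" unfolding colour_cycle_def by blast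
      have "a \<in> {1..k}" "b \<in> {1..k}" using colour_cycle_le[OF k, of a b] e'(1) ab by simp_all
      then show "e \<in> {e \<in> edges G. e \<subseteq> S ` {1..k}}" using E e' ab G(2) by auto
    qed
    also have "colour_cycle k k = (`) h ` edges (cycle_graph k)"
      unfolding colour_cycle_mod[OF k] cycle_graph_def graph.simps setcompr_eq_image image_image
      by (simp only: image_insert image_empty h_def)
    finally show ?thesis by (simp add: image_image image_comp)
  qed
  have bij: "bij_betw (S \<circ> h) {..<k} (S ` {1..k})"
    using bij_betw_trans[OF h] inj_on_imp_bij_betw[OF inj] by blast
  have "graph_iso (cycle_graph k) (induced_subgraph G (S ` {1..k}))"
    unfolding graph_iso_def induced_subgraph_def using bij edges
    by (intro exI[of _ "S \<circ> h"]) (simp add: cycle_graph_def)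
  moreover have "card (S ` {1..k}) = k" using card_image[OF inj] by simp
  ultimately show ?thesis unfolding induced_cycle_def using sub G(1) by simp
qed

text \<open>A vertex is discarded only on account of its out-neighbours, of which it has at most
  \<open>D\<close>, whereas its degree is unbounded. So it is enough to prescribe the colours on the
  cycle and its out-neighbourhood \<open>W\<close>, with 0 off the cycle.\<close>

lemma induced_cycle_coloured:
  assumes C: "induced_cycle G k C"
  obtains S W \<rho> where "S ` {1..k} = C" "C \<subseteq> {..<n}" "W \<subseteq> {..<n}" "card W \<le> k + k * D" "\<And>v. \<rho> v \<le> k"
    "\<And>X. (\<And>v. v \<in> W \<Longrightarrow> X 0 v = \<rho> v) \<Longrightarrow> coloured_cycle X 0 S"
proof -
  define h where "h i = (if i = k then 0 else i)" for i :: nat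
  obtain f where f: "bij_betw f {..<k} C" "{e \<in> edges G. e \<subseteq> C} = (\<lambda>e. f ` e) ` edges (cycle_graph k)"
    using C unfolding induced_cycle_def graph_iso_def induced_subgraph_def by (auto simp: cycle_graph_def)
  have Cn: "C \<subseteq> {..<n}" "card C = k" using C G(1) by (auto simp: induced_cycle_def)
  then have finC: "finite C" by (metis finite_lessThan finite_subset)
  define S where "S = f \<circ> h"
  have hb: "bij_betw h {1..k} {..<k}"
    unfolding bij_betw_def
  proof
    show "inj_on h {1..k}" by (auto simp: inj_on_def h_def)
    show "h ` {1..k} = {..<k}"
    proof (intro set_eqI iffI)
      fix x assume "x \<in> {..<k}"
      then show "x \<in> h ` {1..k}" using k
        by (cases "x = 0") (auto simp: h_def image_iff intro: bexI[of _ k] bexI[of _ x])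
    qed (use k in \<open>auto simp: h_def\<close>)
  qed
  have S: "bij_betw S {1..k} C" unfolding S_def by (rule bij_betw_trans[OF hb f(1)])
  have SC: "S ` {1..k} = C" and inj: "inj_on S {1..k}" using S by (auto simp: bij_betw_def)
  have cyc_edges: "(`) h ` colour_cycle k k = edges (cycle_graph k)"
  proof -
    have hh: "h (if (i + 1) mod k = 0 then k else (i + 1) mod k) = (i + 1) mod k" "h (if i = 0 then k else i) = i" if "i < k" for i
    proof -
      have "(i + 1) mod k < k" using k by simp
      then have "(i + 1) mod k \<noteq> k" by linarith
      then show "h (if (i + 1) mod k = 0 then k else (i + 1) mod k) = (i + 1) mod k" "h (if i = 0 then k else i) = i"
        using that by (simp_all add: h_def)
    qed
    show ?thesis
      unfolding colour_cycle_mod[OF k] cycle_graph_def graph.simps setcompr_eq_image image_image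
    proof (rule image_cong)
      fix i assume "i \<in> {i. i < k}"
      then have "i < k" by simp
      show "h ` {if i = 0 then k else i, if (i + 1) mod k = 0 then k else (i + 1) mod k} = {i, (i + 1) mod k}"
        by (simp only: image_insert image_empty hh[OF \<open>i < k\<close>])
    qed simp
  qed
  have edges: "{e \<in> edges G. e \<subseteq> C} = (`) S ` colour_cycle k k"
    unfolding f(2) cyc_edges[symmetric] by (simp add: S_def image_image image_comp)
  define g where "g = inv_into {1..k} S"
  have gS: "g (S a) = a" if "a \<in> {1..k}" for a unfolding g_def using inv_into_f_f[OF inj that] .
  have Sg: "S (g v) = v \<and> g v \<in> {1..k}" if "v \<in> C" for v
    using that SC unfolding g_def by (metis f_inv_into_f inv_into_into)
  define out where "out = orient D es"
  define W where "W = C \<union> (\<Union>u\<in>C. {v. (u, v) \<in> set out})"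
  define \<rho> where "\<rho> v = (if v \<in> C then g v else 0)" for v
  have h_es: "halving D es" by (rule embedded_halving[OF embedded_es])
  have nb: "finite {v. (u, v) \<in> set out} \<and> card {v. (u, v) \<in> set out} \<le> D" for u
  proof -
    have "{v. (u, v) \<in> set out} = snd ` set (filter (\<lambda>e. fst e = u) out)" by force
    then have "card {v. (u, v) \<in> set out} \<le> length (filter (\<lambda>e. fst e = u) out)" "finite {v. (u, v) \<in> set out}"
      by (metis card_image_le card_length le_trans List.finite_set, simp)
    then show ?thesis using orient_out[OF h_es, of u] by (simp add: out_def)
  qed
  have "card W \<le> card C + card (\<Union>u\<in>C. {v. (u, v) \<in> set out})" unfolding W_def by (rule card_Un_le)
  also have "card (\<Union>u\<in>C. {v. (u, v) \<in> set out}) \<le> (\<Sum>u\<in>C. card {v. (u, v) \<in> set out})"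
    by (rule card_UN_le[OF finC])
  also have "\<dots> \<le> (\<Sum>u\<in>C. D)" by (rule sum_mono) (use nb in blast)
  finally have cardW: "card W \<le> k + k * D" using Cn by simp
  have "v < n" if "(u, v) \<in> set out" for u v
    using ends_below_orient[OF ends_below_es, of D] that by (force simp: out_def ends_below_def)
  then have Wn: "W \<subseteq> {..<n}" using Cn(1) by (auto simp: W_def)
  have \<rho>k: "\<rho> v \<le> k" for v using Sg[of v] by (auto simp: \<rho>_def)
  have "coloured_cycle X 0 S" if X: "\<And>v. v \<in> W \<Longrightarrow> X 0 v = \<rho> v" for X
  proof -
    have XC: "X 0 u = g u" if "u \<in> C" for u using X[of u] that by (simp add: W_def \<rho>_def)
    have colC: "col X u = g u" if u: "u \<in> C" for u
    proof -
      have "\<not> bad k (X 0 u) (X 0 v)" if "(u, v) \<in> set (orient D es)" for v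
      proof (cases "v \<in> C")
        case True
        have "(u, v) \<in> set es \<or> (v, u) \<in> set es" using set_orient[OF that] .
        then have "{u, v} \<in> edges G" using G(2) by (simp add: eset_mem)
        then have "{u, v} \<in> (`) S ` colour_cycle k k" using edges u True by blast
        then obtain e where e: "e \<in> colour_cycle k k" "{u, v} = S ` e" by blast
        then obtain a b where ab: "e = {a, b}" unfolding colour_cycle_def by blast
        have abk: "a \<in> {1..k}" "b \<in> {1..k}" using colour_cycle_le[OF k, of a b] e(1) ab by simp_all
        have "{g u, g v} = {a, b}" using e(2) ab gS abk by (auto simp: doubleton_eq_iff)
        then have "{g u, g v} \<in> colour_cycle k k" using e ab by simp
        then have "cyc k (g u) (g v)" using k unfolding colour_cycle_def cyc_def by (auto simp: doubleton_eq_iff)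
        then show ?thesis using XC u True by (simp add: bad_def)
      next
        case False
        then have "X 0 v = 0" using X[of v] u that by (auto simp: W_def out_def \<rho>_def)
        then show ?thesis by (simp add: bad_def)
      qed
      then have "col X u = X 0 u" unfolding col_def by (rule kill_keep)
      then show ?thesis using XC u by simp
    qed
    show ?thesis unfolding coloured_cycle_def
    proof (intro allI impI)
      fix a b assume "{a, b} \<in> colour_cycle (k - 0) (top_col X 0)"
      then have ab: "{a, b} \<in> colour_cycle k k" by simp
      then have abk: "a \<in> {1..k}" "b \<in> {1..k}" using colour_cycle_le[OF k, of a b] by simp_all
      then have "S a \<in> C" "S b \<in> C" using SC by auto
      then have c: "col X (S a) = a" "col X (S b) = b" using colC gS abk by auto
      have "S ` {a, b} \<in> {e \<in> edges G. e \<subseteq> C}" unfolding edges using ab by blast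
      then have "{S a, S b} \<in> eset es" using G(2) by simp
      then have "{S a, S b} \<in> eset (start X)" using c abk unfolding eset_mem start_def by auto
      then show "{S a, S b} \<in> eset (cur X 0) \<and> col X (S a) = a" using c by simp
    qed
  qed
  from that[OF SC Cn(1) Wn cardW \<rho>k this] show ?thesis .
qed

text \<open>The program checks only that the three colours differ. Since edges carry just the three
  pairs of \<open>colour_cycle 3 x\<close>, pairwise adjacent vertices with different colours show
  all of 1, 2 and \<open>x\<close>.\<close>

lemma triangle_coloured_cycle:
  assumes X0: "\<And>v. X 0 v \<le> k"
    and e: "e \<in> set (orient D (cur X (k - 3)))" "holds_triangle (col X) (picks X (k - 3)) S e"
  shows "coloured_cycle X (k - 3) S"
proof -
  define s where "s = k - 3"
  define x where "x = top_col X s"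
  have K: "k - s = 3" using k by (simp add: s_def)
  have inv: "embedded (cur X s)" "3 \<le> x" "\<And>u v. (u, v) \<in> set (cur X s) \<Longrightarrow> {col X u, col X v} \<in> colour_cycle 3 x"
    using stage_invariant[where X = X, OF X0, of s] k K by (auto simp: s_def x_def)
  have cols: "{col X u, col X v} \<in> {{1, 2}, {2, x}, {x, 1}}" if "{u, v} \<in> eset (cur X s)" for u v
    using that inv(3)[of u v] inv(3)[of v u] unfolding eset_mem colour_cycle_3 by (auto simp: insert_commute)
  obtain p q where pq: "e = (p, q)" by fastforce
  define z where "z = picks X s q"
  have h: "col X z \<noteq> col X p" "col X z \<noteq> col X q" "picks X s p = z \<or> picks X s z = p"
    "S (col X p) = p" "S (col X q) = q" "S (col X z) = z"
    using e(2) pq by (auto simp: holds_triangle_def triangle_def Let_def z_def s_def)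
  have E1: "{p, q} \<in> eset (cur X s)" using set_orient e(1) pq by (auto simp: eset_mem s_def)
  have E2: "{q, z} \<in> eset (cur X s)" using picks_edge[where X = X, OF X0, of s q] h(2) z_def by metis
  have E3: "{p, z} \<in> eset (cur X s)"
    using h(3)
  proof
    assume "picks X s p = z" then show ?thesis using picks_edge[where X = X, OF X0, of s p] h(1) by metis
  next
    assume "picks X s z = p" then show ?thesis using picks_edge[where X = X, OF X0, of s z] h(1) by (metis insert_commute)
  qed
  have C: "{col X p, col X q} \<in> {{1, 2}, {2, x}, {x, 1}}" "{col X q, col X z} \<in> {{1, 2}, {2, x}, {x, 1}}"
    "{col X p, col X z} \<in> {{1, 2}, {2, x}, {x, 1}}" using cols E1 E2 E3 by blast+
  have all: "{1, 2, x} \<subseteq> {col X p, col X q, col X z}" using C h(1,2) inv(2) by (auto simp: doubleton_eq_iff)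
  have D: "S (col X p) = p \<and> S (col X q) = q \<and> S (col X z) = z" using h by blast
  show ?thesis
    unfolding coloured_cycle_def s_def[symmetric] K x_def[symmetric]
  proof (intro allI impI)
    fix a b assume "{a, b} \<in> colour_cycle 3 x"
    then have ab: "a \<in> {1, 2, x}" "b \<in> {1, 2, x}" "a \<noteq> b" using inv(2) unfolding colour_cycle_3 by (auto simp: doubleton_eq_iff)
    define T where "T = {p, q, z}"
    have T: "S (col X v) = v" if "v \<in> T" for v using that h(4-6) by (auto simp: T_def)
    have E: "{u, v} \<in> eset (cur X s)" if "u \<in> T" "v \<in> T" "u \<noteq> v" for u v
      using that E1 E2 E3 by (auto simp: T_def insert_commute)
    have "a \<in> col X ` T" "b \<in> col X ` T" using all ab(1,2) by (auto simp: T_def)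
    then obtain u v where uv: "u \<in> T" "v \<in> T" "a = col X u" "b = col X v" by blast
    have "u \<noteq> v" using uv ab(3) by blast
    then show "{S a, S b} \<in> eset (cur X s) \<and> col X (S a) = a"
      using E[OF uv(1,2)] T[OF uv(1)] T[OF uv(2)] uv(3,4) by simp
  qed
qed

end

section \<open>Samples that preserve or detect a given coloured cycle\<close>

context contraction_graph
begin

text \<open>\<open>\<rho>\<close> prescribes the samples of stage \<open>s\<close> at the cycle vertices (and the flip stored at \<open>n\<close>) such
  that the coloured cycle survives the stage, or is detected if only three colours are left.\<close>

definition advances :: "(nat \<Rightarrow> nat) \<Rightarrow> (nat \<Rightarrow> nat \<Rightarrow> nat) \<Rightarrow> nat \<Rightarrow> (nat \<Rightarrow> nat) \<Rightarrow> bool" where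
  "advances S X s \<rho> \<longleftrightarrow> (\<forall>v. \<rho> v \<le> D) \<and> (\<forall>X'. (\<forall>i\<le>s. X' i = X i) \<longrightarrow>
     (\<forall>v\<in>insert n (S ` {1..k}). X' (Suc s) v = \<rho> v) \<longrightarrow>
     (if s + 4 \<le> k then coloured_cycle X' (Suc s) S
      else \<exists>e\<in>set (orient D (cur X' s)). triangle (col X') (picks X' s) e))"

text \<open>Three vertices joined pairwise by arcs always contain a directed path through all of
  them. Its middle vertex and the tail of the closing arc are the two vertices whose picks have to
  be guessed.\<close>

lemma triangle_path:
  assumes tot: "R u v \<or> R v u" "R v w \<or> R w v" "R w u \<or> R u w"
  obtains p q z where "R p q" "R q z" "R p z \<or> R z p" "{p, q, z} = {u, v, w}"
proof -
  have "\<exists>p q z. R p q \<and> R q z \<and> (R p z \<or> R z p) \<and> {p, q, z} = {u, v, w}"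
  proof (cases "R u v")
    case True
    show ?thesis
    proof (cases "R v w")
      case True
      then show ?thesis using \<open>R u v\<close> tot by (intro exI[of _ u] exI[of _ v] exI[of _ w]) auto
    next
      case False
      then have wv: "R w v" using tot by blast
      show ?thesis
      proof (cases "R w u")
        case True
        then show ?thesis using \<open>R u v\<close> wv by (intro exI[of _ w] exI[of _ u] exI[of _ v]) auto
      next
        case False
        then have "R u w" using tot by blast
        then show ?thesis using \<open>R u v\<close> wv by (intro exI[of _ u] exI[of _ w] exI[of _ v]) auto
      qed
    qed
  next
    case False
    then have vu: "R v u" using tot by blast
    show ?thesis
    proof (cases "R u w")
      case True
      then show ?thesis using vu tot by (intro exI[of _ v] exI[of _ u] exI[of _ w]) auto
    next
      case False
      then have wu: "R w u" using tot by blast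
      show ?thesis
      proof (cases "R v w")
        case True
        then show ?thesis using vu wu by (intro exI[of _ v] exI[of _ w] exI[of _ u]) auto
      next
        case False
        then have "R w v" using tot by blast
        then show ?thesis using vu wu by (intro exI[of _ w] exI[of _ v] exI[of _ u]) auto
      qed
    qed
  qed
  then show ?thesis using that by blast
qed

text \<open>The arc between the vertices of the last two colours decides: its tail must vanish,
  which fixes the value at \<open>n\<close>, and the index of its head among the out-neighbours is
  below \<open>D\<close>. In the last stage \<open>triangle_path\<close> names two distinct vertices
  with prescribed picks.\<close>

lemma advances_exists:
  assumes X0: "\<And>v. X 0 v \<le> k" and s: "s + 3 \<le> k" and S: "coloured_cycle X s S"
  shows "\<exists>\<rho>. advances S X s \<rho>"
proof -
  define x where "x = top_col X s"
  define A where "A = orient D (cur X s)"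
  have inv: "embedded (cur X s)" "ends_below n (cur X s)" "k - s \<le> x" "x \<le> k"
    using stage_invariant[where X = X, OF X0 s] by (auto simp: x_def)
  have h: "halving D (cur X s)" by (rule embedded_halving[OF inv(1)])
  have out: "length (filter (\<lambda>e. fst e = u) A) \<le> D" for u unfolding A_def by (rule orient_out[OF h])
  have S': "{S a, S b} \<in> eset (cur X s) \<and> col X (S a) = a \<and> col X (S b) = b" if "{a, b} \<in> colour_cycle (k - s) x" for a b
    using S that unfolding coloured_cycle_def x_def by (metis insert_commute)
  have arc: "(S a, S b) \<in> set A \<or> (S b, S a) \<in> set A" if "{a, b} \<in> colour_cycle (k - s) x" for a b
    using S'[OF that] orient_complete[OF h] unfolding A_def eset_mem by metis
  have Sn: "S a < n \<and> S b < n" if "{a, b} \<in> colour_cycle (k - s) x" for a b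
    using S'[OF that] inv(2) by (auto simp: eset_mem ends_below_def)
  have same: "cur X' s = cur X s" "top_col X' s = x" "col X' = col X" "coloured_cycle X' s S"
      "picks X' s = picked (X' (Suc s)) A" "X' 0 v \<le> k"
    if X': "\<forall>i\<le>s. X' i = X i" for X' v
  proof -
    have st: "stage X' s = stage X s" by (rule stage_cong) (use X' in auto)
    then show 1: "cur X' s = cur X s" "top_col X' s = x" by (simp_all add: cur_def top_col_def x_def)
    show 2: "col X' = col X" using X' by (simp add: col_def)
    show "coloured_cycle X' s S" using S unfolding coloured_cycle_def 1 2 x_def .
    show "picks X' s = picked (X' (Suc s)) A" by (simp add: picks_def A_def 1)
    show "X' 0 v \<le> k" using X0 X' by simp
  qed
  show ?thesis
  proof (cases "s + 4 \<le> k")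
    case True
    define a where "a = k - s - 1"
    have ax: "{a, x} \<in> colour_cycle (k - s) x" by (simp add: colour_cycle_def a_def)
    have rng: "a \<in> {1..k}" "x \<in> {1..k}" using True inv(3,4) by (auto simp: a_def)
    from arc[OF ax] show ?thesis
    proof
      assume "(S a, S x) \<in> set A"
      then obtain i where i: "i < D" "\<And>r. r (S a) = i \<Longrightarrow> picked r A (S a) = S x"
        using picked_exists[OF _ out] by blast
      show ?thesis
      proof (intro exI[of _ "\<lambda>v. if v = n then 1 else if v = S a then i else 0"], unfold advances_def if_P[OF True], intro conjI allI impI)
        show "(if v = n then 1 else if v = S a then i else 0) \<le> D" for v using i k D by auto
        fix X' assume X': "\<forall>i\<le>s. X' i = X i"
          and r: "\<forall>v\<in>insert n (S ` {1..k}). X' (Suc s) v = (if v = n then 1 else if v = S a then i else 0)"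
        have "X' (Suc s) n = 1" "X' (Suc s) (S a) = i" using r rng Sn[OF ax] by auto
        then have "gone X' s = a" "kept X' s = x" "picks X' s (S a) = S x"
          using same(2,5)[OF X'] i(2) by (simp_all add: gone_def kept_def a_def)
        then show "coloured_cycle X' (Suc s) S"
          using coloured_cycle_forward[where X = X', OF same(6)[OF X'] True same(4)[OF X']] by simp
      qed
    next
      assume "(S x, S a) \<in> set A"
      then obtain i where i: "i < D" "\<And>r. r (S x) = i \<Longrightarrow> picked r A (S x) = S a"
        using picked_exists[OF _ out] by blast
      show ?thesis
      proof (intro exI[of _ "\<lambda>v. if v = n then 0 else if v = S x then i else 0"], unfold advances_def if_P[OF True], intro conjI allI impI)
        show "(if v = n then 0 else if v = S x then i else 0) \<le> D" for v using i k D by auto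
        fix X' assume X': "\<forall>i\<le>s. X' i = X i"
          and r: "\<forall>v\<in>insert n (S ` {1..k}). X' (Suc s) v = (if v = n then 0 else if v = S x then i else 0)"
        have "X' (Suc s) n = 0" "X' (Suc s) (S x) = i" using r rng Sn[OF ax] by auto
        then have "gone X' s = x" "kept X' s = a" "picks X' s (S x) = S a"
          using same(2,5)[OF X'] i(2) by (simp_all add: gone_def kept_def a_def)
        then show "coloured_cycle X' (Suc s) S"
          using coloured_cycle_forward[where X = X', OF same(6)[OF X'] True same(4)[OF X']] by simp
      qed
    qed
  next
    case False
    then have K: "k - s = 3" using s by simp
    have e: "{1, 2} \<in> colour_cycle (k - s) x" "{2, x} \<in> colour_cycle (k - s) x" "{x, 1} \<in> colour_cycle (k - s) x"
      unfolding K colour_cycle_3 by auto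
    obtain p q z where pqz: "(p, q) \<in> set A" "(q, z) \<in> set A" "(p, z) \<in> set A \<or> (z, p) \<in> set A" "{p, q, z} = {S 1, S 2, S x}"
      using triangle_path[of "\<lambda>u v. (u, v) \<in> set A", OF arc[OF e(1)] arc[OF e(2)] arc[OF e(3)]] by metis
    have cols: "col X (S 1) = 1" "col X (S 2) = 2" "col X (S x) = x" using S' e by blast+
    have x3: "3 \<le> x" using inv(3) K by simp
    have "card {S 1, S 2, S x} = 3"
    proof -
      have "col X (S 1) \<noteq> col X (S 2)" "col X (S 1) \<noteq> col X (S x)" "col X (S 2) \<noteq> col X (S x)"
        unfolding cols using x3 by simp_all
      then have "S 1 \<noteq> S 2" "S 1 \<noteq> S x" "S 2 \<noteq> S x" by metis+
      then show ?thesis by simp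
    qed
    then have "card {p, q, z} = 3" unfolding pqz(4) .
    then have dist: "p \<noteq> q" "p \<noteq> z" "q \<noteq> z" by (auto simp: card_insert_if split: if_splits)
    have sub: "{p, q, z} \<subseteq> S ` {1..k}" using pqz(4) inv(4) x3 k by auto
    have "{p, q, z} \<subseteq> {..<n}" unfolding pqz(4) using Sn[OF e(1)] Sn[OF e(2)] by auto
    then have lt: "p < n" "q < n" "z < n" by auto
    have cinj: "col X u \<noteq> col X v" if "u \<in> {p, q, z}" "v \<in> {p, q, z}" "u \<noteq> v" for u v
      using that cols x3 unfolding pqz(4) by auto
    obtain i where i: "i < D" "\<And>r. r q = i \<Longrightarrow> picked r A q = z" using picked_exists[OF pqz(2) out] by blast
    obtain j y y' where j: "j < D" "\<And>r. r y = j \<Longrightarrow> picked r A y = y'" and y: "y = p \<and> y' = z \<or> y = z \<and> y' = p"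
      using pqz(3) picked_exists[OF _ out] by metis
    show ?thesis
    proof (intro exI[of _ "\<lambda>v. if v = q then i else if v = y then j else 0"], unfold advances_def if_not_P[OF False], intro conjI allI impI)
      show "(if v = q then i else if v = y then j else 0) \<le> D" for v using i j by auto
      fix X' assume X': "\<forall>i\<le>s. X' i = X i"
        and r: "\<forall>v\<in>insert n (S ` {1..k}). X' (Suc s) v = (if v = q then i else if v = y then j else 0)"
      have "X' (Suc s) q = i" using r sub by auto
      moreover have "X' (Suc s) y = j" using r sub y dist by auto
      ultimately have "picks X' s q = z" "picks X' s y = y'" using i(2) j(2) same(5)[OF X'] by simp_all
      then have "triangle (col X') (picks X' s) (p, q)"
        using y cinj[of z p] cinj[of z q] dist unfolding same(3)[OF X'] by (auto simp: triangle_def)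
      then show "\<exists>e\<in>set (orient D (cur X' s)). triangle (col X') (picks X' s) e"
        using pqz(1) unfolding same(1)[OF X'] A_def by blast
    qed
  qed
qed

text \<open>A fixed \<open>\<rho>\<close> for each outcome of the earlier stages. The default 0
  covers outcomes for which no suitable \<open>\<rho>\<close> exists, and keeps the values at most
  \<open>D\<close>.\<close>

definition choice :: "(nat \<Rightarrow> nat) \<Rightarrow> (nat \<Rightarrow> nat \<Rightarrow> nat) \<Rightarrow> nat \<Rightarrow> nat \<Rightarrow> nat" where
  "choice S X s = (if \<exists>\<rho>. advances S X s \<rho> then SOME \<rho>. advances S X s \<rho> else (\<lambda>_. 0))"

lemma choice_le: "choice S X s v \<le> D"
proof (cases "\<exists>\<rho>. advances S X s \<rho>")
  case True
  then have "advances S X s (choice S X s)" unfolding choice_def by (simp add: someI_ex)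
  then show ?thesis unfolding advances_def by blast
qed (simp add: choice_def)

lemma choice_cong:
  assumes "\<And>i. i \<le> s \<Longrightarrow> X i = X' i"
  shows "choice S X s = choice S X' s"
proof -
  have "(\<forall>i\<le>s. Y i = X i) \<longleftrightarrow> (\<forall>i\<le>s. Y i = X' i)" for Y using assms by metis
  then have "advances S X s = advances S X' s" unfolding advances_def fun_eq_iff by presburger
  then show ?thesis by (simp add: choice_def)
qed

lemma choice_detects:
  assumes X0: "\<And>v. X 0 v \<le> k" and S: "coloured_cycle X 0 S"
    and ch: "\<And>s v. s + 3 \<le> k \<Longrightarrow> v \<in> insert n (S ` {1..k}) \<Longrightarrow> X (Suc s) v = choice S X s v"
  shows "\<exists>e\<in>set (orient D (cur X (k - 3))). triangle (col X) (picks X (k - 3)) e"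
proof -
  have adv: "if s + 4 \<le> k then coloured_cycle X (Suc s) S
      else \<exists>e\<in>set (orient D (cur X s)). triangle (col X) (picks X s) e"
    if "s + 3 \<le> k" "coloured_cycle X s S" for s
  proof -
    have "\<exists>\<rho>. advances S X s \<rho>" by (rule advances_exists[where X = X, OF X0 that])
    then have "advances S X s (choice S X s)" unfolding choice_def by (simp add: someI_ex)
    then show ?thesis using ch[OF that(1)] unfolding advances_def by blast
  qed
  have "coloured_cycle X s S" if "s + 3 \<le> k" for s
    using that
  proof (induction s)
    case (Suc s)
    then show ?case using adv[of s] by simp
  qed (use S in simp)
  then show ?thesis using adv[of "k - 3"] k by simp
qed

end

section \<open>One round of the algorithm\<close>

context contraction
begin

definition stage_prog :: "nat \<Rightarrow> prog" where
  "stage_prog s = seqs [orient_prog, pick_prog (102 + 2 * s), Load 17 (102 + 2 * s) 0,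
     Cond (Equal 17 3)
       (seqs [Move (100 + 3 * s) 10, Const (101 + 3 * s) (k - s - 1), Const (102 + 3 * s) 1])
       (seqs [Const (100 + 3 * s) (k - s - 1), Move (101 + 3 * s) 10, Const (102 + 3 * s) (k - s - 2)]),
     merge_prog (100 + 3 * s) (101 + 3 * s) (102 + 3 * s) (101 + 2 * s), Move 10 (101 + 3 * s)]"

text \<open>Stages are separated arithmetically: samples occupy the even array numbers from 100 on,
  recovery tables the odd ones, and the colour registers of different stages are disjoint
  triples.\<close>

lemma stage_prog_frame [simp]:
  "r < 100 \<Longrightarrow> r \<notin> {5, 6, 7, 8, 10, 11, 12, 13, 14, 15, 16, 17, 18, 19, 20, 21, 30} \<Longrightarrow> r \<notin> writes (stage_prog s)"
  "i < s \<Longrightarrow> 100 + 3 * i \<notin> writes (stage_prog s)" "i < s \<Longrightarrow> 101 + 3 * i \<notin> writes (stage_prog s)"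
  "i < s \<Longrightarrow> 102 + 3 * i \<notin> writes (stage_prog s)"
  "a < 100 \<Longrightarrow> a \<notin> {4, 5, 7, 8, 9, 10, 11, 12, 14, 15, 16} \<Longrightarrow> a \<notin> stores (stage_prog s)"
  "100 + 2 * i \<notin> stores (stage_prog s)" "i < s \<Longrightarrow> 101 + 2 * i \<notin> stores (stage_prog s)"
  "flip_free (stage_prog s)"
  unfolding stage_prog_def by (auto simp: orient_prog_frame pick_prog_frame merge_prog_frame) presburger+

primrec stages_prog :: "nat \<Rightarrow> prog" where
  "stages_prog 0 = Skip"
| "stages_prog (Suc s) = Seq (stages_prog s) (stage_prog s)"

text \<open>Only the cells of pairs produced in stage \<open>i\<close> are constrained, so the
  tables may hold arbitrary leftovers of earlier rounds elsewhere.\<close>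

definition mids :: "(nat \<Rightarrow> nat \<Rightarrow> nat) \<Rightarrow> nat \<Rightarrow> (nat \<Rightarrow> nat) \<Rightarrow> bool" where
  "mids X i f \<longleftrightarrow> (\<forall>x y u. middle (col X) (picks X i) (gone X i) (kept X i) (far X i) (cur X i) x y u \<longrightarrow>
     middle (col X) (picks X i) (gone X i) (kept X i) (far X i) (cur X i) x y (f (x * n + y)))"

definition at_stage :: "(nat \<Rightarrow> nat \<Rightarrow> nat) \<Rightarrow> nat \<Rightarrow> state \<Rightarrow> bool" where
  "at_stage X s st \<longleftrightarrow> env n (length es) D st \<and> row_table n st \<and> (\<forall>u<n. arrays st 100 u = col X u) \<and>
     (\<forall>j v. 1 \<le> j \<longrightarrow> j + 2 \<le> k \<longrightarrow> v \<le> n \<longrightarrow> arrays st (100 + 2 * j) v = X j v) \<and>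
     regs st 5 = length (cur X s) \<and> elist st 7 8 (cur X s) \<and> regs st 10 = top_col X s \<and>
     (\<forall>i<s. regs st (100 + 3 * i) = gone X i \<and> regs st (101 + 3 * i) = kept X i \<and> regs st (102 + 3 * i) = far X i \<and>
       mids X i (arrays st (101 + 2 * i)))"

end

locale contraction_run = contraction_graph +
  fixes w :: nat
  assumes w: "n + 2 < 2 ^ w" "n * n + 2 < 2 ^ w" "2 * length es + 2 < 2 ^ w" "D + 2 < 2 ^ w" "k + 2 < 2 ^ w"
begin

lemma w_pos: "w > 0"
  using w(5) by (cases w) auto

lemma halts_orient_cur:
  assumes X0: "\<And>v. X 0 v \<le> k" and s: "s + 3 \<le> k" and st: "at_stage X s st"
  shows "halts w orient_prog st (10 + 130 * length es)
    (\<lambda>st'. regs st' 7 = length (orient D (cur X s)) \<and> elist st' 11 12 (orient D (cur X s)))"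
proof -
  have inv: "embedded (cur X s)" "ends_below n (cur X s)" "length (cur X s) \<le> length es"
    using stage_invariant[where X = X, OF X0 s] by auto
  have "2 * length (cur X s) < 2 ^ w" "n < 2 ^ w" using w inv(3) by auto
  moreover have "env n (length es) D st" "regs st 5 = length (cur X s)" "elist st 7 8 (cur X s)"
    using st by (auto simp: at_stage_def)
  ultimately have "halts w orient_prog st (10 + 130 * length (cur X s))
    (\<lambda>st'. regs st' 7 = length (orient D (cur X s)) \<and> elist st' 11 12 (orient D (cur X s)))"
    using embedded_halving[OF inv(1)] inv(2) by (intro halts_orient)
  then show ?thesis by (rule halts_mono) (use inv(3) in auto)
qed

lemma halts_stage:
  assumes X: "\<And>v. X 0 v \<le> k" "\<And>j v. X j v \<le> D" and s: "s + 4 \<le> k" and st: "at_stage X s st"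
  shows "halts w (stage_prog s) st (50 + 5 * n + 212 * length es) (at_stage X (Suc s))"
  unfolding stage_prog_def
proof (rule halts_Cons[OF halts_orient_cur[where X = X, OF X(1) _ st]], goal_cases)
  case (3 s1)
  define L where "L = cur X s"
  have inv: "embedded L" "ends_below n L" "length L \<le> length es" "top_col X s \<le> k"
    using stage_invariant[where X = X and s = s, OF X(1)] s by (auto simp: L_def)
  have bo: "ends_below n (orient D L)" by (rule ends_below_orient[OF inv(2)])
  have lo: "length (orient D L) \<le> 2 * length es" using length_orient[of D L] inv(3) by linarith
  have 1: "at_stage X s s1" "regs s1 7 = length (orient D L)" "elist s1 11 12 (orient D L)"
    using 3 st by (auto simp: at_stage_def frame_def env_def row_table_def elist_def L_def)
  have A: "arrays s1 (100 + 2 * j) v = X j v" if "1 \<le> j" "j + 2 \<le> k" "v \<le> n" for j v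
    using 1(1) that unfolding at_stage_def by blast
  then have r: "arrays s1 (102 + 2 * s) u = X (Suc s) u" if "u \<le> n" for u
    using s that A[of "Suc s" u] by simp
  have Xw: "X j v < 2 ^ w" for j v using X(2)[of j v] w(4) by linarith
  have ss: "s + 3 \<le> k" using s by simp
  show ?case
  proof (rule halts_Cons[OF halts_pick[where A = "orient D L" and r = "X (Suc s)" and n = n and m = "length es" and D = D]], goal_cases)
    case (11 s2)
    have 2: "at_stage X s s2" "\<forall>u<n. arrays s2 4 u = picks X s u"
      using 11 1 by (auto simp: at_stage_def frame_def env_def row_table_def elist_def L_def picks_def)
    let ?set = "Cond (Equal 17 3)
       (seqs [Move (100 + 3 * s) 10, Const (101 + 3 * s) (k - s - 1), Const (102 + 3 * s) 1])
       (seqs [Const (100 + 3 * s) (k - s - 1), Move (101 + 3 * s) 10, Const (102 + 3 * s) (k - s - 2)])"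
    let ?s3 = "run w ?set (run w (Load 17 (102 + 2 * s) 0) s2)"
    have f3: "frame (Seq (Load 17 (102 + 2 * s) 0) ?set) s2 ?s3"
      using run_loop_free_frame[of "Seq (Load 17 (102 + 2 * s) 0) ?set" s2 w] by simp
    have "arrays s2 (102 + 2 * s) n = X (Suc s) n" using r 11(2) by (auto simp: frame_def)
    moreover have "regs s2 0 = n" "regs s2 3 = 0" "regs s2 10 = top_col X s" using 2(1) by (auto simp: at_stage_def env_def)
    moreover have "top_col X s < 2 ^ w" "k - s - 1 < 2 ^ w" "k - s - 2 < 2 ^ w" "1 < (2 :: nat) ^ w" using w inv(4) by auto
    ultimately have reg: "regs ?s3 (100 + 3 * s) = gone X s" "regs ?s3 (101 + 3 * s) = kept X s" "regs ?s3 (102 + 3 * s) = far X s"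
      using Xw[of "Suc s" n] by (auto simp: gone_def kept_def far_def)
    have st3: "at_stage X s ?s3" "\<forall>u<n. arrays ?s3 4 u = picks X s u"
      using f3 2 unfolding at_stage_def by (auto simp: frame_def env_def row_table_def elist_def)
    have e3: "env n (length es) D ?s3" "regs ?s3 5 = length L" "elist ?s3 7 8 L" "row_table n ?s3"
        "\<And>u. u < n \<Longrightarrow> arrays ?s3 100 u = col X u" "\<And>u. u < n \<Longrightarrow> arrays ?s3 4 u = picks X s u"
      using st3 by (auto simp: at_stage_def L_def)
    have wl: "n < 2 ^ w" "n * n < 2 ^ w" "length L + 1 < 2 ^ w" using w inv(3) by auto
    have cw: "col X u < 2 ^ w" for u using col_le[where X = X, OF X(1), of u] w(5) by linarith
    have pn: "picks X s u < n" if "u < n" for u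
      unfolding picks_def using picked_less[OF _ that] bo by (simp add: L_def)
    note M = halts_merge[where a = "101 + 2 * s" and c = "col X" and pk = "picks X s", OF inv(2) wl e3 reg _ _ _ _ _ cw pn stage_step(7)[where X = X, OF X(1) s]]
    show ?case
    proof (rule halts_run_Cons, goal_cases)
     case 3
     show ?case
     proof (rule halts_run_Cons, goal_cases)
      case 3
      show ?case
      proof (rule halts_Cons[OF M], goal_cases)
        case (10 s4)
        define s5 where "s5 = run w (Move 10 (101 + 3 * s)) s4"
        have a: "at_stage X (Suc s) s5"
        proof -
          have k4: "regs s4 (101 + 3 * s) = kept X s" "regs s4 (100 + 3 * s) = gone X s" "regs s4 (102 + 3 * s) = far X s"
            using 10(2) reg by (auto simp: frame_def)
          have "kept X s < 2 ^ w" using stage_invariant[where X = X and s = "Suc s", OF X(1)] s w(5) by (simp add: stage_Suc)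
          then have s5: "arrays s5 = arrays s4" "regs s5 = (regs s4)(10 := kept X s)"
            unfolding s5_def using k4 by simp_all
          have mid: "mids X s (arrays s4 (101 + 2 * s))" using 10(1) unfolding mids_def L_def by blast
          have arr: "arrays s4 (100 + 2 * j) = arrays ?s3 (100 + 2 * j)" for j
          proof -
            have "100 + 2 * j \<noteq> 101 + 2 * s" by presburger
            then show ?thesis by (intro frame_arrays[OF 10(2)]) simp
          qed
          have X3: "arrays ?s3 (100 + 2 * j) v = X j v" if "1 \<le> j" "j + 2 \<le> k" "v \<le> n" for j v
            using st3(1) that unfolding at_stage_def by blast
          have I3: "regs ?s3 (100 + 3 * i) = gone X i" "regs ?s3 (101 + 3 * i) = kept X i"
              "regs ?s3 (102 + 3 * i) = far X i" "mids X i (arrays ?s3 (101 + 2 * i))" if "i < s" for i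
            using st3(1) that unfolding at_stage_def by blast+
          have a4: "arrays s4 (101 + 2 * i) = arrays ?s3 (101 + 2 * i)" if "i < s" for i
            using that by (intro frame_arrays[OF 10(2)]) simp
          have r4: "regs s4 (100 + 3 * i) = regs ?s3 (100 + 3 * i)" "regs s4 (101 + 3 * i) = regs ?s3 (101 + 3 * i)"
            "regs s4 (102 + 3 * i) = regs ?s3 (102 + 3 * i)" for i
            by (intro frame_regs[OF 10(2)]; simp)+
          have "env n (length es) D s5" using e3(1) 10(2) by (auto simp: s5 frame_def env_def)
          moreover have "row_table n s5" using e3(4) 10(2) by (auto simp: s5 frame_def row_table_def)
          moreover have "\<forall>u<n. arrays s5 100 u = col X u" using arr[of 0] e3(5) by (simp add: s5)
          moreover have "\<forall>j v. 1 \<le> j \<longrightarrow> j + 2 \<le> k \<longrightarrow> v \<le> n \<longrightarrow> arrays s5 (100 + 2 * j) v = X j v"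
            unfolding s5 arr using X3 by blast
          moreover have "regs s5 5 = length (cur X (Suc s))" "elist s5 7 8 (cur X (Suc s))" "regs s5 10 = top_col X (Suc s)"
            using 10(1) by (simp_all add: s5 stage_Suc L_def elist_def)
          moreover have "regs s5 (100 + 3 * i) = gone X i \<and> regs s5 (101 + 3 * i) = kept X i \<and>
              regs s5 (102 + 3 * i) = far X i \<and> mids X i (arrays s5 (101 + 2 * i))" if "i < Suc s" for i
          proof (cases "i = s")
            case True
            then show ?thesis using k4 mid by (simp add: s5)
          next
            case False
            then have "i < s" using that by simp
            then show ?thesis using I3[of i] a4[of i] r4[of i] by (simp add: s5 del: run.simps)
          qed
          ultimately show ?thesis unfolding at_stage_def by blast
        qed
        show ?case by (intro halts_run_Cons halts_Nil) (use a inv(3) lo in \<open>auto simp: s5_def[symmetric] simp del: run.simps\<close>)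
      qed (use inv(3) lo in auto)
     qed (use inv(3) lo in auto)
    qed (use inv(3) lo in auto)
  qed (use bo lo w 1 r Xw in \<open>auto simp: at_stage_def\<close>)
qed (use s in auto)

end

lemma halts_step:
  assumes "halts w p s T Q" "\<And>s'. Q s' \<Longrightarrow> frame p s s' \<Longrightarrow> halts w (seqs ps) s' U R"
  shows "halts w (seqs (p # ps)) s (T + U) R"
  unfolding seqs.simps by (rule halts_Seq[OF assms order_refl])

lemma halts_run_step:
  assumes "while_free p" "halts w (seqs ps) (run w p s) U R"
  shows "halts w (seqs (p # ps)) s (cost p + U) R"
  by (rule halts_step[where Q = "\<lambda>s'. s' = run w p s"]) (use assms in \<open>auto intro: halts_run\<close>)

section \<open>Preparation, detection and the complete round\<close>

context contraction
begin

definition caps :: "nat \<Rightarrow> nat" where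
  "caps j = (if j = 0 then k else D)"

definition prepare_prog :: prog where
  "prepare_prog = seqs [sample_prog caps D (k - 1),
     For 30 1 (seqs [Load 11 0 30, Load 12 1 30, Store 7 30 11, Store 8 30 12]), Move 5 1,
     orient_prog, kill_prog k, filter_prog, Const 10 k]"

text \<open>The last three instructions copy entry \<open>k\<close> of array 2 to entry 0: colours
  run from 1 to \<open>k\<close>, the output is read from the entries below
  \<open>k\<close>.\<close>

definition detect_prog :: prog where
  "detect_prog = seqs [orient_prog, pick_prog (102 + 2 * (k - 3)), triangle_prog, recover_prog (k - 3),
     Const 16 k, Load 12 2 16, Store 2 3 12]"

definition round_prog :: prog where
  "round_prog = seqs [prepare_prog, stages_prog (k - 3), detect_prog]"

text \<open>The value 0 outside the range drawn makes \<open>samples\<close> equal as functions for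
  tapes that agree on the relevant flips; \<open>choice_cong\<close> asks for equality at all
  arguments.\<close>

definition samples :: "bool stream \<Rightarrow> nat \<Rightarrow> nat \<Rightarrow> nat" where
  "samples \<omega> j v = (if j < k - 1 \<and> v \<le> n then sample caps D n \<omega> j v else 0)"

definition detected :: "(nat \<Rightarrow> nat \<Rightarrow> nat) \<Rightarrow> bool" where
  "detected X \<longleftrightarrow> (\<exists>e\<in>set (orient D (cur X (k - 3))). triangle (col X) (picks X (k - 3)) e)"

definition ready :: "state \<Rightarrow> bool" where
  "ready st \<longleftrightarrow> env n (length es) D st \<and> row_table n st \<and> elist st 0 1 es"

text \<open>The brackets mirror the nesting of \<open>halts_step\<close>, whose time bound is the
  sum of the bounds of the head and of the tail of the program.\<close>

definition prepare_time :: nat where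
  "prepare_time = (1 + (k - 1) * (10 + (n + 1) * (5 + 4 * D))) + ((2 + 7 * length es) + (1 + ((10 + 130 * length es) +
     ((5 + 60 * length es) + ((5 + 14 * length es) + 2)))))"

definition stage_time :: nat where
  "stage_time = 50 + 5 * n + 212 * length es"

definition detect_time :: nat where
  "detect_time = (10 + 130 * length es) + ((5 + 5 * n + 22 * length es) + ((5 + 44 * length es) + ((7 * (k - 3) + 1) + 4)))"

definition round_time :: nat where
  "round_time = prepare_time + ((1 + (k - 3) * stage_time) + (detect_time + 1))"

lemma samples_le:
  assumes "k \<le> D"
  shows "samples \<omega> j v \<le> D" "samples \<omega> 0 v \<le> k"
proof -
  have "last_success (caps j) D \<omega>' \<le> D" for \<omega>'
    using last_success_le[of "caps j" D \<omega>'] assms by (simp add: caps_def split: if_splits)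
  then show "samples \<omega> j v \<le> D" by (simp add: samples_def sample_def)
  show "samples \<omega> 0 v \<le> k" using last_success_le[of k] by (simp add: samples_def sample_def caps_def)
qed

lemma stages_prog_frame [simp]:
  "r < 100 \<Longrightarrow> r \<notin> {5, 6, 7, 8, 10, 11, 12, 13, 14, 15, 16, 17, 18, 19, 20, 21, 30} \<Longrightarrow> r \<notin> writes (stages_prog j)"
  "a < 100 \<Longrightarrow> a \<notin> {4, 5, 7, 8, 9, 10, 11, 12, 14, 15, 16} \<Longrightarrow> a \<notin> stores (stages_prog j)"
  "flip_free (stages_prog j)"
  by (induction j) auto

end

context contraction_run
begin

lemma ready_frame:
  "ready st \<Longrightarrow> frame p st st' \<Longrightarrow> {0, 1, 2, 3, 4} \<inter> writes p = {} \<Longrightarrow> {0, 1, 13} \<inter> stores p = {} \<Longrightarrow> ready st'"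
  unfolding ready_def env_def row_table_def elist_def by (auto simp: frame_def disjoint_iff)

lemma halts_prepare:
  assumes st: "ready st"
  defines "X \<equiv> samples (tape st)"
  shows "halts w prepare_prog st prepare_time (\<lambda>st'. ready st' \<and> at_stage X 0 st' \<and>
    tape st' = sdrop ((k - 1) * (n + 1) * D) (tape st))"
proof -
  let ?tp = "\<lambda>st'. tape st' = sdrop ((k - 1) * (n + 1) * D) (tape st)"
  have caps: "caps j < 2 ^ w" for j using w by (simp add: caps_def)
  have env: "env n (length es) D st'" "elist st' 0 1 es" "row_table n st'" if "ready st'" for st' using that by (simp_all add: ready_def)
  have nw: "n < 2 ^ w" "length es < 2 ^ w" "2 * length es < 2 ^ w" "n + 1 < 2 ^ w" using w by auto
  have hv: "halving D es" by (rule embedded_halving[OF embedded_es])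
  define out where "out = orient D es"
  have out: "ends_below n out" "length out \<le> 2 * length es" "length out < 2 ^ w"
    unfolding out_def using ends_below_orient[OF ends_below_es] length_orient[of D es] w by auto
  have X0: "X 0 u \<le> k" for u unfolding X_def by (rule samples_le(2)[OF D(2)])
  have samp: "arrays s1 (100 + 2 * j) v = X j v"
    if "\<forall>j<k - 1. \<forall>v\<le>n. arrays s1 (100 + 2 * j) v = sample caps D n (tape st) j v" "j < k - 1" "v \<le> n" for s1 j v
    using that by (simp add: X_def samples_def)
  let ?X = "\<lambda>s1. \<forall>j<k - 1. \<forall>v\<le>n. 1 \<le> j \<longrightarrow> arrays s1 (100 + 2 * j) v = X j v"
  have Xf: "?X s2" if "?X s1" "frame p s1 s2" "\<forall>j\<ge>1. 100 + 2 * j \<notin> stores p" for s1 s2 p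
    using that by (simp add: frame_def)
  show ?thesis
    unfolding prepare_prog_def prepare_time_def
  proof (rule halts_step[OF halts_sample[OF env(1)[OF st] caps w_pos nw(4)]], goal_cases)
    case (1 s1)
    have r1: "ready s1" by (rule ready_frame[OF st 1(2)]) auto
    have X1: "?X s1" "\<And>u. u < n \<Longrightarrow> arrays s1 100 u = X 0 u" "?tp s1"
      using samp[of s1] 1(1) k samp[of s1 0] by auto
    have len: "regs s1 1 = length es" using env(1)[OF r1] by (simp add: env_def)
    show ?case
    proof (rule halts_step[OF halts_copy[OF ends_below_es nw(1,2) env(1)[OF r1] len env(2)[OF r1]]], goal_cases)
      case (5 s2)
      have r2: "ready s2" by (rule ready_frame[OF r1 5(2)]) auto
      have X2: "?X s2" "\<And>u. u < n \<Longrightarrow> arrays s2 100 u = X 0 u" "?tp s2"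
        using Xf[OF X1(1) 5(2)] X1(2,3) 5(2) by (auto simp: frame_def)
      let ?s3 = "run w (Move 5 1) s2"
      have s3: "ready ?s3" "?X ?s3" "\<And>u. u < n \<Longrightarrow> arrays ?s3 100 u = X 0 u" "?tp ?s3" "regs ?s3 5 = length es" "elist ?s3 7 8 es"
        using r2 X2 5(1) nw(2) env(1)[OF r2] by (auto simp: ready_def env_def row_table_def elist_def)
      show ?case
      proof (rule halts_run_step[where p = "Move 5 1", unfolded cost.simps], goal_cases)
        case 2
        show ?case
        proof (rule halts_step[OF halts_orient[OF ends_below_es nw(1,3) hv env(1)[OF s3(1)] s3(5,6)]], goal_cases)
          case (1 s4)
          have r4: "ready s4" by (rule ready_frame[OF s3(1) 1(2)]) auto
          have X4: "?X s4" "\<And>u. u < n \<Longrightarrow> arrays s4 100 u = X 0 u" "?tp s4"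
            using Xf[OF s3(2) 1(2)] s3(3,4) 1(2) by (auto simp: frame_def)
          have o4: "regs s4 7 = length out" "elist s4 11 12 out" using 1(1) by (auto simp: out_def)
          have "halts w (kill_prog k) s4 (5 + 30 * length out) (\<lambda>s'. \<forall>u<n. arrays s' 100 u = kill k (X 0) out u)"
            using k w(5) by (intro halts_kill[OF out(1) nw(1) out(3) _ _ env(1)[OF r4] o4 X4(2) X0]) auto
          then have kl: "halts w (kill_prog k) s4 (5 + 60 * length es) (\<lambda>s'. \<forall>u<n. arrays s' 100 u = col X u)"
            by (rule halts_mono) (use out(2) in \<open>auto simp: col_def out_def\<close>)
          show ?case
          proof (rule halts_step[OF kl], goal_cases)
            case (1 s5)
            have r5: "ready s5" by (rule ready_frame[OF r4 1(2)]) auto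
            have X5: "?X s5" "\<And>u. u < n \<Longrightarrow> arrays s5 100 u = col X u" "?tp s5"
              using Xf[OF X4(1) 1(2)] 1(1) X4(3) 1(2) by (auto simp: frame_def)
            have cw: "col X u < 2 ^ w" for u using col_le[where X = X, OF X0, of u] w(5) by linarith
            note fl = halts_filter[where c = "col X", OF ends_below_es nw(1,2) env(1,2)[OF r5] X5(2) cw]
            show ?case
            proof (rule halts_step[OF fl], goal_cases)
              case (2 s6)
              have r6: "ready s6" by (rule ready_frame[OF r5 2(2)]) auto
              have X6: "?X s6" "\<And>u. u < n \<Longrightarrow> arrays s6 100 u = col X u" "?tp s6"
                using Xf[OF X5(1) 2(2)] X5(2,3) 2(2) by (auto simp: frame_def)
              have L6: "regs s6 5 = length (start X)" "elist s6 7 8 (start X)" using 2(1) by (auto simp: start_def Let_def)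
              let ?s7 = "run w (Const 10 k) s6"
              have "ready ?s7" using r6 by (auto simp: ready_def env_def row_table_def elist_def)
              moreover have "at_stage X 0 ?s7"
                unfolding at_stage_def
                using r6 X6 L6 w(5) by (auto simp: ready_def env_def row_table_def elist_def)
              ultimately show ?case using X6(3) by (intro halts_run[where T = 2]) auto
            qed auto
          qed
        qed
      qed auto
    qed auto
  qed
qed

lemma halts_stages:
  assumes X: "\<And>v. X 0 v \<le> k" "\<And>j v. X j v \<le> D" and st: "at_stage X 0 st"
  shows "j + 3 \<le> k \<Longrightarrow> halts w (stages_prog j) st (1 + j * stage_time) (at_stage X j)"
proof (induction j)
  case 0
  then show ?case using st by (intro halts_run) auto
next
  case (Suc j)
  then have "halts w (stages_prog j) st (1 + j * stage_time) (at_stage X j)" "j + 4 \<le> k" by auto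
  then show ?case
    unfolding stages_prog.simps
    by (intro halts_Seq[where Q = "at_stage X j" and T = "1 + j * stage_time" and U = stage_time])
      (use halts_stage[where X = X, OF X] in \<open>auto simp: stage_time_def\<close>)
qed

lemma halts_detect:
  assumes X: "\<And>v. X 0 v \<le> k" "\<And>j v. X j v \<le> D" and st: "at_stage X (k - 3) st"
  shows "halts w detect_prog st detect_time (\<lambda>st'. regs st' 9 = of_bool (detected X) \<and>
    (detected X \<longrightarrow> induced_cycle G k (output_set k st')))"
proof -
  define s where "s = k - 3"
  have s: "s + 3 \<le> k" using k by (simp add: s_def)
  define A where "A = orient D (cur X s)"
  have inv: "ends_below n (cur X s)" "length (cur X s) \<le> length es" "k - s \<le> top_col X s"
     "\<And>u v. (u, v) \<in> set (cur X s) \<Longrightarrow> {col X u, col X v} \<in> colour_cycle (k - s) (top_col X s)"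
    using stage_invariant[where X = X, OF X(1) s] by auto
  have A: "ends_below n A" "length A \<le> 2 * length es" "length A < 2 ^ w" "n < 2 ^ w"
    using ends_below_orient[OF inv(1)] length_orient[of D "cur X s"] inv(2) w unfolding A_def by auto
  have at: "at_stage X s st" using st by (simp add: s_def)
  have cne: "col X (fst e) \<noteq> col X (snd e)" if "e \<in> set A" for e
  proof -
    have "(fst e, snd e) \<in> set (cur X s) \<or> (snd e, fst e) \<in> set (cur X s)" using that set_orient[of "fst e" "snd e"] by (simp add: A_def)
    then have "{col X (fst e), col X (snd e)} \<in> colour_cycle (k - s) (top_col X s)" using inv(4) by (metis insert_commute)
    moreover have K: "k - s = 3" using k by (simp add: s_def)
    ultimately show ?thesis using inv(3) unfolding K colour_cycle_3 insert_iff empty_iff doubleton_eq_iff by auto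
  qed
  have cw: "col X u < 2 ^ w" for u using col_le[where X = X, OF X(1), of u] w(5) by linarith
  have Xw: "X j v < 2 ^ w" for j v using X(2)[of j v] w(4) by linarith
  have pn: "picks X s u < n" if "u < n" for u unfolding picks_def using picked_less[OF A(1) that] by (simp add: A_def)
  show ?thesis
    unfolding detect_prog_def detect_time_def s_def[symmetric]
  proof (rule halts_step[OF halts_orient_cur[where X = X, OF X(1) s at]], goal_cases)
    case (1 s1)
    have 1: "at_stage X s s1" "regs s1 7 = length A" "elist s1 11 12 A"
      using 1 at by (auto simp: at_stage_def frame_def env_def row_table_def elist_def A_def)
    have e1: "env n (length es) D s1" using 1(1) by (simp add: at_stage_def)
    have r: "arrays s1 (102 + 2 * s) u = X (Suc s) u" if "u < n" for u
    proof -
      have "arrays s1 (100 + 2 * j) v = X j v" if "1 \<le> j" "j + 2 \<le> k" "v \<le> n" for j v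
        using 1(1) that unfolding at_stage_def by blast
      from this[of "Suc s" u] have "arrays s1 (100 + 2 * Suc s) u = X (Suc s) u" using that s by simp
      then show ?thesis by simp
    qed
    have "halts w (pick_prog (102 + 2 * s)) s1 (5 + 5 * n + 11 * length A) (\<lambda>s'. \<forall>u<n. arrays s' 4 u = picked (X (Suc s)) A u)"
      using r Xw by (intro halts_pick[OF A(1,4,3) e1 1(2,3)]) auto
    then have pk: "halts w (pick_prog (102 + 2 * s)) s1 (5 + 5 * n + 22 * length es) (\<lambda>s'. \<forall>u<n. arrays s' 4 u = picks X s u)"
      by (rule halts_mono) (use A(2) in \<open>auto simp: picks_def A_def\<close>)
    show ?case
    proof (rule halts_step[OF pk], goal_cases)
      case (1 s2)
      have 2: "at_stage X s s2" "regs s2 7 = length A" "elist s2 11 12 A"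
        using 1(2) \<open>at_stage X s s1\<close> \<open>regs s1 7 = length A\<close> \<open>elist s1 11 12 A\<close>
        by (auto simp: at_stage_def frame_def env_def row_table_def elist_def)
      have "halts w triangle_prog s2 (5 + 22 * length A) (\<lambda>s'.
          regs s' 9 = of_bool (\<exists>e\<in>set A. triangle (col X) (picks X s) e) \<and>
          ((\<exists>e\<in>set A. triangle (col X) (picks X s) e) \<longrightarrow> (\<exists>e\<in>set A. holds_triangle (col X) (picks X s) (arrays s' 2) e)))"
        using 2 1(1) cw pn cne
        by (intro halts_triangle[OF A(1,4,3) w_pos, of "length es" D]) (auto simp: at_stage_def)
      then have tr: "halts w triangle_prog s2 (5 + 44 * length es) (\<lambda>s'. regs s' 9 = of_bool (detected X) \<and>
          (detected X \<longrightarrow> coloured_cycle X s (arrays s' 2)))"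
      proof (rule halts_mono, goal_cases)
        case (2 s')
        have "coloured_cycle X s (arrays s' 2)" if "e \<in> set A" "holds_triangle (col X) (picks X s) (arrays s' 2) e" for e
          using triangle_coloured_cycle[where X = X and S = "arrays s' 2", OF X(1)] that unfolding s_def A_def by blast
        then show ?case using 2(1) unfolding detected_def A_def s_def by blast
      qed (use A(2) in simp)
      show ?case
      proof (rule halts_step[OF tr], goal_cases)
        case (1 s3)
        have 3: "at_stage X s s3"
          using 1(2) 2(1) by (auto simp: at_stage_def frame_def env_def row_table_def elist_def)
        let ?s4 = "run w (recover_prog s) s3"
        have f4: "frame (recover_prog s) s3 ?s4" by (rule run_loop_free_frame) simp
        have reg9: "regs ?s4 9 = of_bool (detected X)" "regs ?s4 3 = 0"
          using f4 1(1) 3 by (auto simp: frame_def at_stage_def env_def)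
        have rec: "coloured_cycle X 0 (arrays ?s4 2)" if "detected X"
        proof (rule run_recover[where n = n and m = "gone X" and t = "kept X" and p = "far X"
              and mid = "\<lambda>i. arrays s3 (101 + 2 * i)" and P = "coloured_cycle X"], goal_cases)
          case (4 i S)
          have i: "i + 4 \<le> k" using 4(1) s by simp
          have "mids X i (arrays s3 (101 + 2 * i))" using 3 4(1) by (simp add: at_stage_def)
          then show ?case
            using coloured_cycle_backward[where X = X and mid = "\<lambda>x y. arrays s3 (101 + 2 * i) (x * n + y)", OF X(1) i 4(2)]
            unfolding mids_def by blast
        qed (use 3 1(1) that w in \<open>auto simp: at_stage_def\<close>)
        have out: "induced_cycle G k (output_set k (run w (Seq (Const 16 k) (Seq (Load 12 2 16) (Store 2 3 12))) ?s4))" if d: "detected X"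
        proof -
          let ?S = "arrays ?s4 2"
          have ind: "induced_cycle G k (?S ` {1..k})" by (rule coloured_cycle_induced[where X = X, OF X(1) rec[OF d]])
          then have sub: "?S ` {1..k} \<subseteq> {..<n}" using G(1) by (simp add: induced_cycle_def)
          have "?S k \<in> {..<n}" using k by (intro subsetD[OF sub] imageI) simp
          then have "?S k < n" by simp
          then have "arrays (run w (Seq (Const 16 k) (Seq (Load 12 2 16) (Store 2 3 12))) ?s4) 2 = ?S(0 := ?S k)"
            using w reg9(2) by simp
          moreover have "?S(0 := ?S k) ` {..<k} = ?S ` {1..k}"
          proof (intro set_eqI iffI)
            fix v assume "v \<in> ?S ` {1..k}"
            then obtain i where i: "v = ?S i" "1 \<le> i" "i \<le> k" by auto
            show "v \<in> ?S(0 := ?S k) ` {..<k}"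
              using i k by (cases "i = k") (auto intro!: image_eqI[of _ _ 0] image_eqI[of _ _ i])
          qed (use k in \<open>auto split: if_splits\<close>)
          ultimately show ?thesis using ind by (simp add: output_set_def)
        qed
        have "halts w (seqs (recover_prog s # [Const 16 k, Load 12 2 16, Store 2 3 12])) s3 (cost (recover_prog s) + 4) (\<lambda>st'. regs st' 9 = of_bool (detected X) \<and>
           (detected X \<longrightarrow> induced_cycle G k (output_set k st')))"
          by (rule halts_run_step) (use out reg9 in \<open>auto intro!: halts_run\<close>)
        then show ?case by simp
      qed
    qed
  qed
qed

lemma halts_round:
  assumes st: "ready st"
  shows "halts w round_prog st round_time (\<lambda>st'. ready st' \<and> tape st' = sdrop ((k - 1) * (n + 1) * D) (tape st) \<and>
    regs st' 9 = of_bool (detected (samples (tape st))) \<and>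
    (detected (samples (tape st)) \<longrightarrow> induced_cycle G k (output_set k st')))"
  unfolding round_prog_def round_time_def
proof (rule halts_step[OF halts_prepare[OF st]], goal_cases)
  case (1 s1)
  let ?X = "samples (tape st)"
  have X: "?X 0 v \<le> k" "?X j v \<le> D" for j v by (rule samples_le[OF D(2)])+
  have k3: "k - 3 + 3 \<le> k" using k by simp
  show ?case
  proof (rule halts_step[OF halts_stages[where X = ?X, OF X _ k3]], goal_cases)
    case (2 s2)
    have r2: "ready s2" by (rule ready_frame[OF _ 2(2)]) (use 1 in auto)
    have t2: "tape s2 = tape s1" using 2(2) by (simp add: frame_def)
    show ?case
    proof (rule halts_step[OF halts_detect[where X = ?X, OF X 2(1)]], goal_cases)
      case (1 s3)
      have "ready s3" by (rule ready_frame[OF r2 1(2)]) (auto simp: detect_prog_def)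
      moreover have "tape s3 = tape s2" using 1(2) by (simp add: frame_def detect_prog_def)
      ultimately show ?case using 1(1) t2 \<open>ready s1 \<and> _\<close> by (intro halts_Nil) auto
    qed
  qed (use 1 in auto)
qed

end

section \<open>The Las Vegas loop\<close>

text \<open>A unary code for \<open>a\<close>: flip number \<open>a - 1\<close> succeeds and all
  others fail, where \<open>a = 0\<close> means that all fail. Other outcomes may give
  \<open>a\<close> too; fixing this one turns a wanted sample into wanted values of single
  flips.\<close>

lemma last_success_eq:
  assumes "\<And>b. b < q \<Longrightarrow> \<omega> !! b \<longleftrightarrow> b + 1 = a" "a \<le> q" "a \<le> cap"
  shows "last_success cap q \<omega> = a"
proof -
  have "last_success cap r \<omega> = (if a \<le> r then a else 0)" if "r \<le> q" for r
    using that by (induction r) (use assms in \<open>auto simp: le_Suc_eq\<close>)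
  then show ?thesis using assms(2) by simp
qed

lemma last_success_cong: "(\<And>b. b < q \<Longrightarrow> \<omega> !! b = \<omega>' !! b) \<Longrightarrow> last_success cap q \<omega> = last_success cap q \<omega>'"
  by (induction q) auto

lemma exec_While_invariant:
  assumes "exec w p s t s'" "p = While b q" "J s"
    and "\<And>s. J s \<Longrightarrow> test_holds b s \<Longrightarrow> halts w q s T J"
  shows "J s' \<and> \<not> test_holds b s'"
  using assms
proof (induction rule: exec.induct)
  case (WhileTrue b' s p' t s' u s'')
  then have "J s'" using halts_exec by blast
  then show ?case using WhileTrue by simp
qed auto

text \<open>A good block forces the loop to end after its round, though it may end earlier for other
  reasons. So the index of the first good block bounds the number of rounds.\<close>

lemma exec_While_blocks:
  assumes J: "\<And>s. J s \<Longrightarrow> test_holds b s \<Longrightarrow> halts w q s T (\<lambda>s'. J s' \<and> tape s' = sdrop N (tape s) \<and>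
      (good (stake N (tape s)) \<longrightarrow> \<not> test_holds b s'))"
    and "J s" "\<not> all_bad good N (Suc j) (tape s)"
  shows "\<exists>t s'. exec w (While b q) s t s' \<and> t \<le> (T + 1) * Suc j + 1"
  using assms(2,3)
proof (induction j arbitrary: s)
  case (0 s)
  show ?case
  proof (cases "test_holds b s")
    case True
    obtain t s1 where 1: "exec w q s t s1" "t \<le> T" "good (stake N (tape s)) \<longrightarrow> \<not> test_holds b s1"
      using J[OF 0(1) True] by (auto simp: halts_def)
    have "good (stake N (tape s))" using 0(2) by (simp add: all_bad_def)
    then have "exec w (While b q) s (1 + t + 1) s1"
      using 1 by (intro exec.WhileTrue[OF True 1(1)] exec.WhileFalse) auto
    then show ?thesis using 1(2) by (intro exI conjI) auto
  next
    case False
    then show ?thesis using exec.WhileFalse[OF False, of w q] by (intro exI conjI) auto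
  qed
next
  case (Suc j s)
  show ?case
  proof (cases "test_holds b s")
    case True
    obtain t s1 where 1: "exec w q s t s1" "t \<le> T" "J s1" "tape s1 = sdrop N (tape s)"
        "good (stake N (tape s)) \<longrightarrow> \<not> test_holds b s1"
      using J[OF Suc.prems(1) True] by (auto simp: halts_def)
    show ?thesis
    proof (cases "test_holds b s1")
      case t1: True
      then have "\<not> all_bad good N (Suc j) (tape s1)" using Suc.prems(2) 1(4,5) all_bad_Suc[of good N "Suc j" "tape s"] by auto
      then obtain u s2 where 2: "exec w (While b q) s1 u s2" "u \<le> (T + 1) * Suc j + 1" using Suc.IH[OF 1(3)] by blast
      have "1 + t + u \<le> (T + 1) * Suc (Suc j) + 1" using 1(2) 2(2) by simp
      then show ?thesis using exec.WhileTrue[OF True 1(1) 2(1)] by blast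
    next
      case False
      have "exec w (While b q) s (1 + t + 1) s1" by (rule exec.WhileTrue[OF True 1(1) exec.WhileFalse[OF False]])
      moreover have "1 + t + 1 \<le> (T + 1) * Suc (Suc j) + 1" using 1(2) by simp
      ultimately show ?thesis by blast
    qed
  next
    case False
    have "1 \<le> (T + 1) * Suc (Suc j) + 1" by simp
    then show ?thesis using exec.WhileFalse[OF False, of w q] by blast
  qed
qed

text \<open>If block \<open>j\<close> is the first good one, the summands up to \<open>j\<close> are
  all present and pay for at most \<open>j + 1\<close> rounds; the initial time \<open>U\<close> is
  charged to each of them. If no block is good, the right-hand side is infinite, so non-terminating
  runs are covered as well.\<close>

lemma run_time_blocks:
  assumes J: "\<And>s. J s \<Longrightarrow> test_holds b s \<Longrightarrow> halts w q s T (\<lambda>s'. J s' \<and> tape s' = sdrop N (tape s) \<and>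
      (good (stake N (tape s)) \<longrightarrow> \<not> test_holds b s'))"
    and p: "halts w p s U (\<lambda>s'. J s' \<and> tape s' = tape s)"
  shows "run_time w (Seq p (While b q)) s \<le> (\<Sum>j. of_nat (U + T + 2) * of_bool (all_bad good N j (tape s)))"
proof -
  let ?g = "\<lambda>j. of_nat (U + T + 2) * of_bool (all_bad good N j (tape s)) :: ennreal"
  have mono: "sum ?g A \<le> suminf ?g" if "finite A" for A by (rule sum_le_suminf) (use that in auto)
  show ?thesis
  proof (cases "\<exists>j. \<not> all_bad good N (Suc j) (tape s)")
    case True
    define j where "j = (LEAST j. \<not> all_bad good N (Suc j) (tape s))"
    have j: "\<not> all_bad good N (Suc j) (tape s)" unfolding j_def using True by (rule LeastI_ex)
    have bad: "all_bad good N i (tape s)" if "i \<le> j" for i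
    proof (cases i)
      case (Suc i')
      then have "i' < j" using that by simp
      then show ?thesis using not_less_Least[of i'] Suc unfolding j_def by blast
    qed (simp add: all_bad_def)
    obtain t s1 where 1: "exec w p s t s1" "t \<le> U" "J s1" "tape s1 = tape s" using p by (auto simp: halts_def)
    obtain u s2 where 2: "exec w (While b q) s1 u s2" "u \<le> (T + 1) * Suc j + 1"
      using exec_While_blocks[of J b w q T N good s1 j, OF J 1(3)] j 1(4) by auto
    have "run_time w (Seq p (While b q)) s \<le> of_nat (t + u)"
      unfolding run_time_def using exec.Seq[OF 1(1) 2(1)] by (intro INF_lower) auto
    also have "t + u \<le> (U + T + 2) * Suc j"
    proof -
      have "t + u \<le> U + ((T + 1) * Suc j + 1)" using 1(2) 2(2) by simp
      also have "\<dots> \<le> (U + 1) * Suc j + (T + 1) * Suc j" by simp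
      also have "\<dots> = (U + T + 2) * Suc j" by (simp add: algebra_simps)
      finally show ?thesis .
    qed
    then have "(of_nat (t + u) :: ennreal) \<le> of_nat ((U + T + 2) * Suc j)" by (simp only: of_nat_le_iff)
    also have "\<dots> = (\<Sum>i<Suc j. of_nat (U + T + 2))"
      by (simp only: sum_constant card_lessThan of_nat_mult) (rule mult.commute)
    also have "\<dots> = sum ?g {..<Suc j}" by (intro sum.cong) (use bad in auto)
    also have "\<dots> \<le> suminf ?g" by (rule mono) simp
    finally show ?thesis .
  next
    case False
    have all: "all_bad good N j (tape s)" for j
    proof (cases j)
      case (Suc j')
      then show ?thesis using False by simp
    qed (simp add: all_bad_def)
    have "suminf ?g = \<top>"
    proof (rule ccontr)
      assume "suminf ?g \<noteq> \<top>"
      then have "suminf ?g < \<top>" by (simp add: less_top)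
      then obtain m :: nat where m: "suminf ?g < of_nat m" by (rule ennreal_Ex_less_of_nat[THEN exE])
      have "(of_nat m :: ennreal) \<le> of_nat ((U + T + 2) * m)" by (simp only: of_nat_le_iff) simp
      also have "\<dots> = (\<Sum>i<m. of_nat (U + T + 2))"
        by (simp only: sum_constant card_lessThan of_nat_mult) (rule mult.commute)
      also have "\<dots> = sum ?g {..<m}" by (intro sum.cong) (use all in auto)
      also have "\<dots> \<le> suminf ?g" by (rule mono) simp
      finally show False using m by simp
    qed
    then show ?thesis by simp
  qed
qed

context contraction
begin

definition init_prog :: prog where
  "init_prog = seqs [Const 2 1, Const 4 D, Const 11 0, For 30 0 (seqs [Store 13 30 11, Add 11 11 0])]"

definition search_prog :: prog where
  "search_prog = Seq init_prog (While (Equal 9 3) round_prog)"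

end

context contraction_run
begin

lemma halts_init:
  "halts w init_prog (input_state n es \<omega>) (10 + 5 * n) (\<lambda>st'. ready st' \<and> regs st' 9 = 0 \<and> tape st' = \<omega>)"
proof -
  have w1: "Suc 0 < 2 ^ w" using w(1) by simp
  define st where "st = run w (Const 11 0) (run w (Const 4 D) (run w (Const 2 1) (input_state n es \<omega>)))"
  have st: "env n (length es) D st" "regs st 11 = 0" "regs st 9 = 0" "tape st = \<omega>" "elist st 0 1 es"
    unfolding st_def using w w1 w_pos by (auto simp: env_def input_state_def elist_def)
  define I where "I j st' \<longleftrightarrow> regs st' 11 = j * n \<and> (\<forall>v<j. arrays st' 13 v = v * n)" for j and st' :: state
  have "halts w (seqs [For 30 0 (seqs [Store 13 30 11, Add 11 11 0])]) st (5 + 5 * n) (\<lambda>st'. ready st' \<and> regs st' 9 = 0 \<and> tape st' = \<omega>)"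
  proof (rule halts_Cons[OF halts_For[where T = 3 and N = n and U = "2 + 5 * n" and I = I]], goal_cases)
    case (11 j st')
    \<comment> \<open>The multiples of \<open>n\<close> are produced by repeated addition. The
      accumulator ends at \<open>n * n\<close>, which must still fit into a word.\<close>
    have "Suc j * n \<le> n * n" using 11(1) by (intro mult_le_mono1) simp
    then have "Suc j * n < 2 ^ w" using w(2) by linarith
    moreover have "regs st' 0 = n" using 11(3) st(1) by (auto simp: frame_def env_def)
    ultimately show ?case using 11(1,2,4) by (intro halts_run) (auto simp: I_def less_Suc_eq add.commute)
  next
    case (14 st')
    then show ?case
      using st by (intro halts_Nil) (auto simp: ready_def env_def row_table_def elist_def I_def frame_def)
  qed (use st w in \<open>auto simp: env_def I_def\<close>)
  then have h: "halts w (seqs [For 30 0 (seqs [Store 13 30 11, Add 11 11 0])]) st (10 + 5 * n - 1 - 1 - 1)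
      (\<lambda>st'. ready st' \<and> regs st' 9 = 0 \<and> tape st' = \<omega>)" by (rule halts_mono) simp_all
  show ?thesis
    unfolding init_prog_def
  proof (rule halts_run_Cons, goal_cases)
    case 3
    show ?case
    proof (rule halts_run_Cons, goal_cases)
      case 3
      show ?case
      proof (rule halts_run_Cons, goal_cases)
        case 3
        show ?case using h by (simp add: st_def del: run.simps seqs.simps)
      qed simp_all
    qed simp_all
  qed simp_all
qed

definition good_state :: "state \<Rightarrow> bool" where
  "good_state st \<longleftrightarrow> ready st \<and> (regs st 9 = 0 \<or> regs st 9 = 1 \<and> induced_cycle G k (output_set k st))"

lemma halts_round_good:
  "good_state st \<Longrightarrow> halts w round_prog st round_time (\<lambda>st'. good_state st' \<and>
     tape st' = sdrop ((k - 1) * (n + 1) * D) (tape st) \<and> (detected (samples (tape st)) \<longrightarrow> \<not> test_holds (Equal 9 3) st'))"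
  unfolding good_state_def
  by (rule halts_mono[OF halts_round order_refl]) (auto simp: ready_def env_def)

text \<open>The loop is left only with a nonzero flag, and \<open>good_state\<close> ties such a
  flag to a found cycle. No probability enters.\<close>

lemma search_correct:
  assumes "exec w search_prog (input_state n es \<omega>) t st"
  shows "induced_cycle G k (output_set k st)"
proof -
  from assms obtain t1 s1 t2 where 1: "exec w init_prog (input_state n es \<omega>) t1 s1"
      "exec w (While (Equal 9 3) round_prog) s1 t2 st"
    unfolding search_prog_def by cases auto
  have "good_state s1" using halts_exec[OF halts_init 1(1)] by (simp add: good_state_def)
  moreover have "halts w round_prog s round_time good_state" if "good_state s" for s
    by (rule halts_mono[OF halts_round_good[OF that]]) auto
  ultimately have "good_state st \<and> \<not> test_holds (Equal 9 3) st"
    using exec_While_invariant[OF 1(2) refl, of good_state] by blast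
  then show ?thesis by (auto simp: good_state_def ready_def env_def)
qed

end

section \<open>Probability that one round succeeds\<close>

context contraction_graph
begin

text \<open>The flips that have to take prescribed values: those of the colours of the cycle and of its
  out-neighbours, and in each stage those of the cycle vertices and of the flip stored at \<open>n\<close>.  Their
  number does not depend on the graph.\<close>

lemma detection_cylinder:
  assumes C: "induced_cycle G k C"
  obtains I f where "card (I \<inter> {..<(k - 1) * (n + 1) * D}) \<le> D * (k + k * D + k * (k + 1))"
    "\<And>\<omega>. (\<forall>i<(k - 1) * (n + 1) * D. i \<in> I \<longrightarrow> \<omega> !! i = f (stake i \<omega>)) \<Longrightarrow> detected (samples \<omega>)"
proof -
  obtain S W \<rho> where S: "S ` {1..k} = C" "C \<subseteq> {..<n}" "W \<subseteq> {..<n}" "card W \<le> k + k * D" "\<And>v. \<rho> v \<le> k"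
    "\<And>X. (\<And>v. v \<in> W \<Longrightarrow> X 0 v = \<rho> v) \<Longrightarrow> coloured_cycle X 0 S"
    using induced_cycle_coloured[OF C] by blast
  have Ck: "card C = k" using C by (simp add: induced_cycle_def)
  have fin: "finite C" "finite W" using S(2,3) finite_subset by auto
  define target where "target X j v = (if j = 0 then \<rho> v else choice S X (j - 1) v)" for X and j v :: nat
  define V where "V j = (if j = 0 then W else insert n C)" for j :: nat
  \<comment> \<open>The place on the tape of flip \<open>b\<close> of the sample of \<open>v\<close>
    in array number \<open>j\<close>: samples are ordered by \<open>j\<close> before
    \<open>v\<close>, so all samples with smaller \<open>j\<close> come earlier.\<close>
  define pos where "pos j v b = (j * (n + 1) + v) * D + b" for j v b
  define I where "I = (\<lambda>(b, v). pos 0 v b) ` ({..<D} \<times> W) \<union> (\<lambda>(b, j, v). pos j v b) ` ({..<D} \<times> ({1..<k - 1} \<times> insert n C))"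
  \<comment> \<open>The length of the prefix encodes \<open>j\<close>, \<open>v\<close> and the flip
    number, and the wanted flip is that of the unary code of the target. Padding the prefix with
    \<open>False\<close> is harmless: the target for \<open>j\<close> depends only on samples with
    smaller index, whose flips all lie in the prefix.\<close>
  define f where "f xs = (let i = length xs in
      i mod D + 1 = target (samples (xs @- sconst False)) (i div D div (n + 1)) (i div D mod (n + 1)))" for xs
  have D0: "D > 0" using D(2) k by simp
  have "card I \<le> card ({..<D} \<times> W) + card ({..<D} \<times> ({1..<k - 1} \<times> insert n C))"
    unfolding I_def by (rule order_trans[OF card_Un_le]) (intro add_mono card_image_le; use fin in simp)
  also have "\<dots> = D * (card W + (k - 2) * card (insert n C))"
    by (simp only: card_cartesian_product card_lessThan card_atLeastLessThan distrib_left diff_diff_left one_add_one)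
  also have "\<dots> \<le> D * (k + k * D + k * (k + 1))"
  proof (intro mult_le_mono2 add_mono S(4) mult_le_mono)
    show "card (insert n C) \<le> k + 1" using card_insert_le_m1[of "k + 1" C n] Ck by (simp add: card_insert_if fin)
  qed simp
  finally have cardI: "card I \<le> D * (k + k * D + k * (k + 1))" .
  have finI: "finite I" unfolding I_def using fin by simp
  have det: "detected (samples \<omega>)" if \<omega>: "\<forall>i<(k - 1) * (n + 1) * D. i \<in> I \<longrightarrow> \<omega> !! i = f (stake i \<omega>)" for \<omega>
  proof -
    let ?X = "samples \<omega>"
    have val: "?X j v = target ?X j v" if j: "j < k - 1" and v: "v \<in> V j" for j v
    proof -
      have vn: "v \<le> n" using v S(2,3) by (auto simp: V_def split: if_splits)
      have cap: "target ?X j v \<le> caps j" using S(5) choice_le by (simp add: target_def caps_def)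
      have capD: "caps j \<le> D" using D(2) by (simp add: caps_def)
      have bit: "\<omega> !! pos j v b \<longleftrightarrow> b + 1 = target ?X j v" if b: "b < D" for b
      proof -
        let ?i = "pos j v b"
        have "?i \<in> I"
        proof (cases "j = 0")
          case True
          then show ?thesis using b v unfolding I_def V_def by (intro UnI1 image_eqI[of _ _ "(b, v)"]) auto
        next
          case False
          then show ?thesis using b v j unfolding I_def V_def by (intro UnI2 image_eqI[of _ _ "(b, j, v)"]) auto
        qed
        moreover have "?i < (k - 1) * (n + 1) * D"
        proof -
          have "?i < (j * (n + 1) + v) * D + D" using b by (simp add: pos_def)
          also have "\<dots> = (j * (n + 1) + v + 1) * D" by simp
          also have "\<dots> \<le> ((j + 1) * (n + 1)) * D" using vn by (intro mult_le_mono1) simp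
          also have "\<dots> \<le> (k - 1) * (n + 1) * D" using j by (intro mult_le_mono1) simp
          finally show ?thesis .
        qed
        ultimately have "\<omega> !! ?i = f (stake ?i \<omega>)" using \<omega> by blast
        moreover have "?i mod D = b" "?i div D = j * (n + 1) + v" unfolding pos_def using b D0 by simp_all
        moreover have "(j * (n + 1) + v) div (n + 1) = j" by (subst div_mult_self3) (use vn in simp_all)
        moreover have "(j * (n + 1) + v) mod (n + 1) = v" by (subst mod_mult_self3) (use vn in simp)
        moreover have "target (samples (stake ?i \<omega> @- sconst False)) j v = target ?X j v"
        proof (cases "j = 0")
          case False
          have "samples (stake ?i \<omega> @- sconst False) j' = ?X j'" if j': "j' \<le> j - 1" for j'
          proof
            fix v'
            show "samples (stake ?i \<omega> @- sconst False) j' v' = ?X j' v'"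
            proof (cases "j' < k - 1 \<and> v' \<le> n")
              case True
              have "(stake ?i \<omega> @- sconst False) !! ((j' * (n + 1) + v') * D + b') = \<omega> !! ((j' * (n + 1) + v') * D + b')"
                if b': "b' < D" for b'
              proof -
                have "(j' * (n + 1) + v') * D + b' < (j' * (n + 1) + v' + 1) * D" using b' by simp
                also have "\<dots> \<le> ((j' + 1) * (n + 1)) * D" using True by (intro mult_le_mono1) simp
                also have "\<dots> \<le> (j * (n + 1) + v) * D" using j' False by (intro mult_le_mono1 trans_le_add1) simp
                also have "\<dots> \<le> ?i" by (simp add: pos_def)
                finally show ?thesis by (simp add: stake_nth shift_snth_less)
              qed
              then have "last_success (caps j') D (sdrop ((j' * (n + 1) + v') * D) (stake ?i \<omega> @- sconst False)) =
                 last_success (caps j') D (sdrop ((j' * (n + 1) + v') * D) \<omega>)"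
                by (intro last_success_cong) (simp only: sdrop_snth)
              then show ?thesis using True by (simp add: samples_def sample_def)
            next
              case False
              show ?thesis unfolding samples_def if_not_P[OF False] by (rule refl)
            qed
          qed
          then have c: "choice S (samples (stake ?i \<omega> @- sconst False)) (j - 1) = choice S ?X (j - 1)"
            by (rule choice_cong)
          show ?thesis unfolding target_def c by (rule refl)
        qed (simp add: target_def)
        ultimately show ?thesis by (simp add: f_def)
      qed
      have "last_success (caps j) D (sdrop ((j * (n + 1) + v) * D) \<omega>) = target ?X j v"
      proof (rule last_success_eq)
        fix b assume "b < D"
        then show "sdrop ((j * (n + 1) + v) * D) \<omega> !! b \<longleftrightarrow> b + 1 = target ?X j v"
          using bit by (simp only: sdrop_snth pos_def)
      qed (use cap capD in linarith)+
      then show ?thesis using j vn by (simp add: samples_def sample_def)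
    qed
    have X0: "?X 0 v \<le> k" for v by (rule samples_le(2)[OF D(2)])
    have "coloured_cycle ?X 0 S" using val[of 0] k by (intro S(6)) (simp add: V_def target_def)
    moreover have "?X (Suc s) v = choice S ?X s v" if "s + 3 \<le> k" "v \<in> insert n (S ` {1..k})" for s v
      using val[of "Suc s" v] that S(1) by (simp add: V_def target_def)
    ultimately show ?thesis unfolding detected_def using choice_detects[where X = ?X, OF X0] by blast
  qed
  show ?thesis
  proof (rule that[of I f])
    show "card (I \<inter> {..<(k - 1) * (n + 1) * D}) \<le> D * (k + k * D + k * (k + 1))"
      by (rule order_trans[OF card_mono cardI]) (use finI in auto)
  qed (use det in blast)
qed

end

context contraction_run
begin

text \<open>A block is called good if it lies in the cylinder of prescribed flips. Detection may be
  more likely than that, but the cylinder implies it and has probability at least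
  \<open>(1 / 2) ^ B\<close>, with \<open>B\<close> free of \<open>n\<close>.\<close>

lemma search_expected_time:
  assumes C: "induced_cycle G k C"
  shows "expected_time w search_prog (input_state n es) \<le>
    of_nat ((10 + 5 * n + round_time + 2) * 2 ^ (D * (k + k * D + k * (k + 1))))"
proof -
  define N where "N = (k - 1) * (n + 1) * D"
  define B where "B = D * (k + k * D + k * (k + 1))"
  define T where "T = 10 + 5 * n + round_time + 2"
  obtain I f where I: "card (I \<inter> {..<N}) \<le> B"
    "\<And>\<omega>. (\<forall>i<N. i \<in> I \<longrightarrow> \<omega> !! i = f (stake i \<omega>)) \<Longrightarrow> detected (samples \<omega>)"
    using detection_cylinder[OF C] unfolding N_def B_def by blast
  define good where "good xs \<longleftrightarrow> (\<forall>i<N. i \<in> I \<longrightarrow> xs ! i = f (take i xs))" for xs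
  have good: "good (stake N \<omega>) \<longleftrightarrow> (\<forall>i<N. i \<in> I \<longrightarrow> \<omega> !! i = f (stake i \<omega>))" for \<omega>
    unfolding good_def by (auto simp: take_stake min_def)
  interpret prob_space coin_flips by (rule prob_space_coin_flips)
  have "ennreal ((1 / 2) ^ B) \<le> ennreal ((1 / 2) ^ card (I \<inter> {..<N}))"
    using I(1) by (intro ennreal_leI power_decreasing) auto
  also have "\<dots> = (1 / 2) ^ card (I \<inter> {..<N})"
  proof -
    have "ennreal (1 / 2) = 1 / 2" by (metis divide_ennreal ennreal_1 ennreal_numeral zero_le_one zero_less_numeral)
    then show ?thesis by (simp flip: ennreal_power)
  qed
  also have "\<dots> = emeasure coin_flips {\<omega>. good (stake N \<omega>)}"
    unfolding good by (rule emeasure_adaptive_cylinder[symmetric])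
  finally have p: "(1 / 2) ^ B \<le> measure coin_flips {\<omega>. good (stake N \<omega>)}"
    by (simp add: emeasure_eq_measure)
  have rt: "run_time w search_prog (input_state n es \<omega>) \<le> (\<Sum>j. of_nat T * of_bool (all_bad good N j \<omega>))" for \<omega>
  proof -
    have "run_time w (Seq init_prog (While (Equal 9 3) round_prog)) (input_state n es \<omega>) \<le>
      (\<Sum>j. of_nat (10 + 5 * n + round_time + 2) * of_bool (all_bad good N j (tape (input_state n es \<omega>))))"
    proof (rule run_time_blocks[where J = good_state])
      fix s assume "good_state s"
      then show "halts w round_prog s round_time (\<lambda>s'. good_state s' \<and> tape s' = sdrop N (tape s) \<and>
          (good (stake N (tape s)) \<longrightarrow> \<not> test_holds (Equal 9 3) s'))"
        using halts_mono[OF halts_round_good order_refl] I(2) good unfolding N_def by (smt (verit, best))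
    next
      show "halts w init_prog (input_state n es \<omega>) (10 + 5 * n) (\<lambda>s'. good_state s' \<and> tape s' = tape (input_state n es \<omega>))"
        by (rule halts_mono[OF halts_init order_refl]) (simp add: good_state_def input_state_def)
    qed
    then show ?thesis by (simp add: search_prog_def T_def input_state_def)
  qed
  have "expected_time w search_prog (input_state n es) \<le> ennreal (T / (1 / 2) ^ B)"
    unfolding expected_time_def by (rule expected_blocks[OF _ p rt]) simp
  also have "T / (1 / 2) ^ B = real (T * 2 ^ B)" by (simp add: power_divide)
  finally show ?thesis by (simp add: T_def B_def ennreal_of_nat_eq_real_of_nat del: of_nat_mult of_nat_add)
qed

end

section \<open>Explicit constants and the word size\<close>

context contraction
begin

lemma round_time_le:
  assumes "1 \<le> n" "length es \<le> d * n"
  shows "10 + 5 * n + round_time + 2 \<le> (k * (100 + 8 * D + 212 * d) + 500 * d + 100) * n"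
proof -
  have "10 + (n + 1) * (5 + 4 * D) \<le> 10 * n + (2 * n) * (5 + 4 * D)"
    using assms(1) by (intro add_mono mult_le_mono1) auto
  also have "\<dots> = (20 + 8 * D) * n" by (simp add: algebra_simps)
  finally have "(k - 1) * (10 + (n + 1) * (5 + 4 * D)) \<le> k * ((20 + 8 * D) * n)" by (intro mult_le_mono) auto
  moreover have "stage_time \<le> (55 + 212 * d) * n"
    using assms unfolding stage_time_def by (simp add: algebra_simps)
  then have "(k - 3) * stage_time \<le> k * ((55 + 212 * d) * n)" by (intro mult_le_mono) auto
  moreover have "k * 1 \<le> k * n" using assms(1) by (intro mult_le_mono2) simp
  then have "7 * (k - 3) \<le> 7 * (k * n)" by linarith
  moreover have "(k * (100 + 8 * D + 212 * d) + 500 * d + 100) * n =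
      k * ((20 + 8 * D) * n) + k * ((55 + 212 * d) * n) + 25 * (k * n) + 500 * (d * n) + 100 * n"
    by (simp add: algebra_simps)
  ultimately show ?thesis
    using assms unfolding round_time_def prepare_time_def detect_time_def by linarith
qed

end

text \<open>Two of the factors \<open>n + 2\<close> provide the quadratic term for the tables. The
  other \<open>e = 2 * d + D + k + 4\<close> factors amount to at least \<open>2 ^ e\<close>, which
  exceeds \<open>e\<close> and so dominates all constants, also for small \<open>n\<close>.\<close>

lemma word_size:
  fixes n d D k w :: nat
  assumes "(n + 2) ^ (2 * d + D + k + 6) \<le> 2 ^ w" "m \<le> d * n"
  shows "n + 2 < 2 ^ w" "n * n + 2 < 2 ^ w" "2 * m + 2 < 2 ^ w" "D + 2 < 2 ^ w" "k + 2 < 2 ^ w"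
proof -
  define e where "e = 2 * d + D + k + 4"
  have "e < 2 ^ e" by (rule less_exp)
  also have "(2 :: nat) ^ e \<le> (n + 2) ^ e" by (rule power_mono) auto
  finally have "(n + 2) ^ 2 * (e + 1) \<le> (n + 2) ^ 2 * (n + 2) ^ e" by (intro mult_le_mono2) simp
  also have "\<dots> = (n + 2) ^ (2 * d + D + k + 6)" by (simp add: e_def flip: power_add)
  also have "\<dots> \<le> 2 ^ w" by (rule assms(1))
  finally have *: "(n * n + 4 * n + 4) * (e + 1) \<le> 2 ^ w" by (simp add: power2_eq_square algebra_simps)
  have le: "a < 2 ^ w" if "a < (n * n + 4 * n + 4) * (e + 1)" for a using that * by linarith
  have 1: "(n * n + 4 * n + 4) * 1 \<le> (n * n + 4 * n + 4) * (e + 1)" by (rule mult_le_mono2) simp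
  have 2: "1 * (e + 1) \<le> (n * n + 4 * n + 4) * (e + 1)" by (rule mult_le_mono1) simp
  have "(n + 1) * (e + 1) \<le> (n * n + 4 * n + 4) * (e + 1)" by (rule mult_le_mono1) simp
  moreover have "(n + 1) * (e + 1) = n * e + n + e + 1" by simp
  moreover have "2 * (d * n) \<le> n * e" by (simp add: e_def algebra_simps)
  ultimately have 3: "2 * (d * n) + e + 1 \<le> (n * n + 4 * n + 4) * (e + 1)" by linarith
  have "n + 2 < n * n + 4 * n + 4" "n * n + 2 < n * n + 4 * n + 4" by simp_all
  from this[THEN less_le_trans, OF 1[unfolded mult_1_right]]
  show "n + 2 < 2 ^ w" "n * n + 2 < 2 ^ w" by (simp_all only: le)
  show "2 * m + 2 < 2 ^ w" by (rule le) (use 3 assms(2) in \<open>simp add: e_def\<close>)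
  show "D + 2 < 2 ^ w" by (rule le, rule less_le_trans[OF _ 2]) (simp add: e_def)
  show "k + 2 < 2 ^ w" by (rule le, rule less_le_trans[OF _ 2]) (simp add: e_def)
qed

theorem theorem7:
  fixes F :: "nat graph set" and k :: nat
  assumes "\<And>G. G \<in> F \<Longrightarrow> is_graph G"
    and "minor_closed F"
    and "\<exists>H. is_graph H \<and> H \<notin> F"
    and "k \<ge> 3"
  shows "\<exists>(P :: prog) (C :: nat) (d :: nat).
    \<forall>G\<in>F. \<forall>n es w.
      verts G = {..<n} \<and> edge_list G es \<and> (\<exists>S. induced_cycle G k S) \<and> (n + 2) ^ d \<le> 2 ^ w \<longrightarrow>
        (\<forall>\<omega> t s. exec w P (input_state n es \<omega>) t s \<longrightarrow> induced_cycle G k (output_set k s)) \<and>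
        expected_time w P (input_state n es) \<le> of_nat (C * n)"
proof -
  have F: "hereditary F" by (rule hereditary_minor_closed[OF assms(1,2)])
  obtain c where c: "\<And>G. G \<in> F \<Longrightarrow> card (edges G) \<le> c * card (verts G)"
    using minor_closed_sparse[OF assms(1,2)] assms(3) by blast
  \<comment> \<open>The part \<open>4 * c\<close> makes each peeling round halve the edge list; the
    part \<open>k\<close> ensures that \<open>D\<close> flips can encode a colour as well as an
    out-neighbour.\<close>
  define D where "D = 4 * c + k"
  define B where "B = D * (k + k * D + k * (k + 1))"
  define c' where "c' = k * (100 + 8 * D + 212 * c) + 500 * c + 100"
  show ?thesis
  \<comment> \<open>Outside the locale the program takes only \<open>k\<close> and \<open>D\<close>
    as arguments, so one program serves all \<open>n\<close>, \<open>es\<close> and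
    \<open>w\<close>.\<close>
  proof (rule exI[of _ "contraction.search_prog k D"], rule exI[of _ "c' * 2 ^ B"], rule exI[of _ "2 * c + D + k + 6"],
      intro ballI allI impI)
    fix G n es w
    assume G: "G \<in> F" and "verts G = {..<n} \<and> edge_list G es \<and> (\<exists>S. induced_cycle G k S) \<and>
      (n + 2) ^ (2 * c + D + k + 6) \<le> 2 ^ w"
    then obtain S where V: "verts G = {..<n}" and el: "edge_list G es" and S: "induced_cycle G k S"
      and w: "(n + 2) ^ (2 * c + D + k + 6) \<le> 2 ^ w" by blast
    have es: "edges G = eset es" "simple es"
      using el by (simp_all add: edge_list_def eset_def simple_def case_prod_unfold)
    have m: "length es \<le> c * n" using c[OF G] card_eset[OF es(2)] es(1) V by simp
    interpret contraction_run k D n es F G c w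
      by unfold_locales
        (use F G c V es assms(4) word_size[OF w m] in \<open>simp_all add: D_def\<close>)
    have "n > 0" using S V assms(4) by (cases n) (auto simp: induced_cycle_def)
    then have time: "10 + 5 * n + round_time + 2 \<le> c' * n" unfolding c'_def by (intro round_time_le m) simp
    have "expected_time w search_prog (input_state n es) \<le> of_nat ((10 + 5 * n + round_time + 2) * 2 ^ B)"
      unfolding B_def by (rule search_expected_time[OF S])
    also have "\<dots> \<le> of_nat (c' * n * 2 ^ B)" using time by (intro of_nat_mono mult_le_mono1)
    also have "c' * n * 2 ^ B = c' * 2 ^ B * n" by simp
    finally show "(\<forall>\<omega> t s. exec w search_prog (input_state n es \<omega>) t s \<longrightarrow> induced_cycle G k (output_set k s)) \<and>
        expected_time w search_prog (input_state n es) \<le> of_nat (c' * 2 ^ B * n)"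
      using search_correct by blast
  qed
qed

end
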